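(* Let $v(\lambda)$ and $u(\lambda)$ be given (fixed) spectral densities, $P_0>0$, and $$D_v^u=\Big\{f(\lambda)\ \Big|\ v(\lambda)\le f(\lambda)\le u(\lambda),\ \frac1{2\pi}\int_{-\pi}^\pi f(\lambda)d\lambda\le P_0\Big\}.$$ Consider the equation $$D^\mu AW^\mu\varphi=\alpha\overline\varphi,\qquad\alpha\in\mathbb C,\qquad(\mathrm E)$$ and densities of the form $$f^0(\lambda)=\max\Big\{v(\lambda),\min\Big\{u(\lambda),\Big|c\sum_{k=0}^\infty(D^\mu A\varphi_\mu)_ke^{i\lambda k}\Big|^2\Big\}\Big\},\qquad \varphi_\mu=W^\mu\varphi,\ c\text{ a constant}.\qquad(\mathrm F)$$ Let $\nu_uP_0$ be the maximum value of $\|D^\mu AW^\mu\varphi\|^2$ on the set of those solutions $\varphi$ of (E) which satisfy the inequalities $v(\lambda)\le|\sum_{k=0}^\infty\varphi(k)e^{-i\lambda k}|^2\le u(\lambda)$, satisfy $\|\varphi\|^2=P_0$ and determine the canonical factorization of the spectral density $f^0(\lambda)=|\sum_{k\ge0}\varphi(k)e^{-i\lambda k}|^2$. Let $\nu_u^+P_0$ be the maximum value of $\|D^\mu AW^\mu\varphi\|^2$ on the set of those $\varphi$ which satisfy $\|\varphi\|^2=P_0$ and determine the canonical factorization of the spectral density $f^0(\lambda)$ given by (F). 1. If there exists a solution $\varphi^0=\{\varphi^0(m):m\ge0\}$ of (E) which satisfies $\|\varphi^0\|^2=P_0$ and $\nu_uP_0=\nu_u^+P_0=\|D^\mu AW^\mu\varphi^0\|^2$,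 then the spectral density $$f^0(\lambda)=\Big|\sum_{k=0}^\infty\varphi^0(k)e^{-i\lambda k}\Big|^2$$ is least favorable in the class $D_v^u$ for the optimal estimation of the functional $A\xi=\sum_{k=0}^\infty a(k)\xi(k)$ of the unknown values $\xi(k)$, $k\ge0$, of the stochastic sequence with stationary $n$th increments, and the increment sequence $\xi^{(n)}(m,\mu)$ admits a one-sided moving average representation. 2. If $\nu_u<\nu_u^+$, the density (F) which admits the canonical factorization is least favorable in the class $D_v^u$. Here the sequence $c\varphi_\mu=\{c\varphi_\mu(k):k\ge0\}$ is determined by the equality $\varphi_\mu=W^\mu\varphi$, by the conditional extremum problem $$\|D^\mu A\varphi_\mu\|^2\to\max,\qquad f(\lambda)=\Big|\sum_{k=0}^\infty\varphi(k)e^{-i\lambda k}\Big|^2\in D_v^u,$$ and by the condition $\int_{-\pi}^\pi f(\lambda)d\lambda=2\pi P_0$. 3. The minimax-robust spectral characteristic is calculated by the formulas (with $f=f^0$ the least favorable density) $$h_\mu^{(a)}(\lambda)=A(e^{i\lambda})-r_\mu^{(a)}(e^{i\lambda})\Phi_\mu^{-1}(e^{-i\lambda}),\quad A(e^{i\lambda})=\sum_{k=0}^\infty(D^\mu a)_ke^{i\lambda k},\quad r_\mu^{(a)}(e^{i\lambda})=\sum_{j=0}^\infty(D^\mu A\varphi_\mu)_je^{i\lambda j}.$$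
   Context: Let $n\ge 1$ and $\mu>0$ be integers. For a stochastic sequence $\{\xi(m),m\in\mathbb Z\}$ put $\xi^{(n)}(m,\mu)=\sum_{l=0}^n(-1)^l\binom nl\xi(m-l\mu)$. The sequence has stationary $n$th increments if $\mathrm E\xi^{(n)}(m_0,\mu)$ and $\mathrm E\xi^{(n)}(m_0+m,\mu_1)\overline{\xi^{(n)}(m_0,\mu_2)}$ exist for all integers $m_0,m,\mu,\mu_1,\mu_2$ and do not depend on $m_0$; the mean of the increments is assumed to be $0$. It has spectral density $f$ if $\xi^{(n)}(m,\mu)=\int_{-\pi}^{\pi}e^{i\lambda m}(1-e^{-i\mu\lambda})^n(i\lambda)^{-n}dZ(\lambda)$ with an orthogonal stochastic measure $Z$, $\mathrm E|Z(d\lambda)|^2=\frac1{2\pi}f(\lambda)d\lambda$. A one-sided moving average representation is $\xi^{(n)}(m,\mu)=\sum_{k\ge0}\varphi^{(n)}(k,\mu)\varepsilon_{m-k}$ with $\varepsilon$ uncorrelated, mean $0$, variance $1$ and square summable coefficients. Canonical factorization of $f$: $f(\lambda)=|\Phi(e^{-i\lambda})|^2$, $\Phi(z)=\sum_{k\ge0}\varphi(k)z^k$, with convergence radius $>1$ and no zeros of $\Phi$ in $\{|z|\le1\}$; the sequence $\varphi=(\varphi(0),\varphi(1),\ldots)\in\ell_2$ is said to define (determine) the factorization. Let $w_\mu(z)=\sum_{k\ge0}w_\mu(k)z^k=\exp\{\frac1{4\pi}\int_{-\pi}^{\pi}\frac{e^{i\lambda}+z}{e^{i\lambda}-z}\ln\frac{|1-e^{-i\lambda\mu}|^{2n}}{\lambda^{2n}}d\lambda\}$,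 so $|w_\mu(e^{-i\lambda})|^2=|1-e^{-i\lambda\mu}|^{2n}\lambda^{-2n}$. $W^\mu$ is the operator in $\ell_2$ with elements $W^\mu_{j,k}=w_\mu(j-k)$ for $0\le k\le j$, $0$ for $j<k$; $\varphi_\mu=W^\mu\varphi$ and $\Phi_\mu(z)=\sum_k\varphi_\mu(k)z^k=w_\mu(z)\Phi(z)$. The numbers $d_\mu(k)$ are defined by $\sum_{k\ge0}d_\mu(k)x^k=(\sum_{j\ge0}x^{\mu j})^n$. $D^\mu$ is the operator in $\ell_2$ with elements $d_\mu(j-k)$ for $0\le k\le j$, $0$ for $j<k$; $A$ has elements $(A)_{k,j}=a(k+j)$, $k,j\ge0$; $a=(a(0),a(1),\ldots)^T$. Standing assumption: $\sum_k|(D^\mu a)_k|<\infty$, $\sum_k(k+1)|(D^\mu a)_k|^2<\infty$. Norms are $\ell_2$ norms; the bar is coordinatewise conjugation. Estimation: $A\xi$ is understood as $A\xi=B\xi-V\xi$, $B\xi=\sum_{k\ge0}b_\mu(k)\xi^{(n)}(k,\mu)$, $b_\mu(k)=(D^\mu a)_k$, $V\xi=\sum_{k=-\mu n}^{-1}v_\mu(k)\xi(k)$, $v_\mu(k)=\sum_{l=\lceil-k/\mu\rceil}^n(-1)^l\binom nlb_\mu(l\mu+k)$. The observations are $\xi(m)$, $m\le-1$. $L_2^{0-}(f)$ is the closed subspace of $L_2(f)$ generated by $e^{i\lambda k}(1-e^{-i\lambda\mu})^n(i\lambda)^{-n}$, $k\le-1$. A linear estimate with spectral characteristic $h$ is $\hat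 A\xi=-V\xi+\int h(\lambda)(1-e^{-i\lambda\mu})^n(i\lambda)^{-n}dZ(\lambda)$ with $h(\lambda)(1-e^{-i\lambda\mu})^n(i\lambda)^{-n}\in L_2^{0-}(f)$; $\Delta(h;f)=\mathrm E|A\xi-\hat A\xi|^2$ is its mean square error under $f$, and $h^{(a)}_\mu(f)$ is the spectral characteristic minimizing it. If $f$ admits the canonical factorization, $\Delta(h^{(a)}_\mu(f);f)=\|D^\mu A\varphi_\mu\|^2$. A density $f^0\in D$ is least favorable in a class $D$ for the optimal linear estimation of $A\xi$ if $\Delta(h^{(a)}_\mu(f^0);f^0)=\max_{f\in D}\Delta(h^{(a)}_\mu(f);f)$. Let $H_D$ be the set of $h$ which are spectral characteristics of linear estimates for every $f\in D$, i.e. $h(\lambda)(1-e^{-i\lambda\mu})^n(i\lambda)^{-n}\in\bigcap_{f\in D}L_2^{0-}(f)$. A spectral characteristic $h^0\in H_D$ is minimax-robust if $\min_{h\in H_D}\max_{f\in D}\Delta(h;f)=\max_{f\in D}\Delta(h^0;f)$.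
   Formalization: In part 1 the solution φ⁰ is taken to be one of those over which ν_uP₀ is the maximum, so it also satisfies v ≤ |Σφ⁰(k)e^{-iλk}|² ≤ u and determines the canonical factorization; for an arbitrary solution of (E) the claim fails. *)

theory Defs
  imports "HOL-Complex_Analysis.Complex_Analysis" "HOL-Probability.Probability"
begin

definition l2 :: "(nat \<Rightarrow> complex) \<Rightarrow> bool" where
  "l2 x \<longleftrightarrow> summable (\<lambda>k. (cmod (x k))\<^sup>2)"

definition l2norm :: "(nat \<Rightarrow> complex) \<Rightarrow> real" where
  "l2norm x = sqrt (\<Sum>k. (cmod (x k))\<^sup>2)"

definition powser :: "(nat \<Rightarrow> complex) \<Rightarrow> complex \<Rightarrow> complex" where
  "powser x z = (\<Sum>k. x k * z ^ k)"

definition mat_app :: "(nat \<Rightarrow> nat \<Rightarrow> complex) \<Rightarrow> (nat \<Rightarrow> complex) \<Rightarrow> nat \<Rightarrow> complex" where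
  "mat_app T x = (\<lambda>k. \<Sum>j. T k j * x j)"

definition mat_mul ::
  "(nat \<Rightarrow> nat \<Rightarrow> complex) \<Rightarrow> (nat \<Rightarrow> nat \<Rightarrow> complex) \<Rightarrow> nat \<Rightarrow> nat \<Rightarrow> complex" where
  "mat_mul S T = (\<lambda>k j. \<Sum>i. S k i * T i j)"

definition dcoeff :: "nat \<Rightarrow> nat \<Rightarrow> nat \<Rightarrow> complex" where
  "dcoeff n \<mu> k = fps_nth ((Abs_fps (\<lambda>i. if \<mu> dvd i then 1 else 0)) ^ n) k"

text \<open>
  The first index is the row, so \<open>D\<^sup>\<mu>\<close> is upper triangular:
  \<open>(D\<^sup>\<mu> a)\<^sub>k = \<Sum>j\<ge>k. d\<^sub>\<mu>(j - k) a(j)\<close>. This is the orientation for which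
  \<open>B\<xi> - V\<xi>\<close> is formally \<open>\<Sum>k. a(k) \<xi>(k)\<close> and \<open>(D\<^sup>\<mu> A)\<^sub>k\<^sub>,\<^sub>j = (D\<^sup>\<mu> a)(k + j)\<close>.
  The matrix \<open>W\<^sup>\<mu>\<close> below is lower triangular.
\<close>

definition Dmat :: "nat \<Rightarrow> nat \<Rightarrow> nat \<Rightarrow> nat \<Rightarrow> complex" where
  "Dmat n \<mu> k j = (if k \<le> j then dcoeff n \<mu> (j - k) else 0)"

definition Amat :: "(nat \<Rightarrow> complex) \<Rightarrow> nat \<Rightarrow> nat \<Rightarrow> complex" where
  "Amat a k j = a (k + j)"

definition bcoeff :: "nat \<Rightarrow> nat \<Rightarrow> (nat \<Rightarrow> complex) \<Rightarrow> nat \<Rightarrow> complex" where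
  "bcoeff n \<mu> a = mat_app (Dmat n \<mu>) a"

text \<open>The first conjunct says that \<open>D\<^sup>\<mu> a\<close> is defined, which the other two presuppose.\<close>

definition admissible_coeffs :: "nat \<Rightarrow> nat \<Rightarrow> (nat \<Rightarrow> complex) \<Rightarrow> bool" where
  "admissible_coeffs n \<mu> a \<longleftrightarrow>
     (\<forall>k. summable (\<lambda>j. Dmat n \<mu> k j * a j)) \<and>
     summable (\<lambda>k. cmod (bcoeff n \<mu> a k)) \<and>
     summable (\<lambda>k. (real k + 1) * (cmod (bcoeff n \<mu> a k))\<^sup>2)"

definition wfun :: "nat \<Rightarrow> nat \<Rightarrow> complex \<Rightarrow> complex" where
  "wfun n \<mu> z = exp (complex_of_real (1 / (4 * pi)) *
     (LINT t|lebesgue_on {-pi..pi}.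
        (cis t + z) / (cis t - z) *
        complex_of_real (ln ((cmod (1 - cis (- (real \<mu> * t)))) ^ (2 * n) / t ^ (2 * n)))))"

definition wcoeff :: "nat \<Rightarrow> nat \<Rightarrow> nat \<Rightarrow> complex" where
  "wcoeff n \<mu> k = fps_nth (fps_expansion (wfun n \<mu>) 0) k"

definition Wmat :: "nat \<Rightarrow> nat \<Rightarrow> nat \<Rightarrow> nat \<Rightarrow> complex" where
  "Wmat n \<mu> j k = (if k \<le> j then wcoeff n \<mu> (j - k) else 0)"

definition phi_mu :: "nat \<Rightarrow> nat \<Rightarrow> (nat \<Rightarrow> complex) \<Rightarrow> nat \<Rightarrow> complex" where
  "phi_mu n \<mu> \<phi> = mat_app (Wmat n \<mu>) \<phi>"

text \<open>
  \<open>D\<^sup>\<mu>\<close> alone is unbounded, so \<open>D\<^sup>\<mu> A\<close> is the operator whose matrix is the matrix product; by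
  the weighted summability of \<open>D\<^sup>\<mu> a\<close> it is a Hilbert--Schmidt operator in \<open>\<ell>\<^sub>2\<close>.
\<close>

definition DA :: "nat \<Rightarrow> nat \<Rightarrow> (nat \<Rightarrow> complex) \<Rightarrow> (nat \<Rightarrow> complex) \<Rightarrow> nat \<Rightarrow> complex" where
  "DA n \<mu> a x = mat_app (mat_mul (Dmat n \<mu>) (Amat a)) x"

definition DAW :: "nat \<Rightarrow> nat \<Rightarrow> (nat \<Rightarrow> complex) \<Rightarrow> (nat \<Rightarrow> complex) \<Rightarrow> nat \<Rightarrow> complex" where
  "DAW n \<mu> a \<phi> = DA n \<mu> a (phi_mu n \<mu> \<phi>)"

abbreviation circ :: "real measure" where
  "circ \<equiv> lebesgue_on {-pi..pi}"

text \<open>Densities are only determined almost everywhere; all (in)equalities between them are.\<close>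

definition spectral_density :: "(real \<Rightarrow> real) \<Rightarrow> bool" where
  "spectral_density f \<longleftrightarrow> integrable circ f \<and> (AE t in circ. 0 \<le> f t)"

text \<open>
  \<open>|\<Sum>k. \<phi>(k) exp(-i\<lambda>k)|\<^sup>2\<close>. For \<open>\<phi> \<in> \<ell>\<^sub>2\<close> the series converges for almost every \<open>\<lambda>\<close>
  to its mean square sum (Carleson).
\<close>

definition density_of :: "(nat \<Rightarrow> complex) \<Rightarrow> real \<Rightarrow> real" where
  "density_of \<phi> t = (cmod (powser \<phi> (cis (- t))))\<^sup>2"

definition canonical_factorization :: "(nat \<Rightarrow> complex) \<Rightarrow> (real \<Rightarrow> real) \<Rightarrow> bool" where
  "canonical_factorization \<phi> f \<longleftrightarrow>
     conv_radius \<phi> > 1 \<and> (\<forall>z. cmod z \<le> 1 \<longrightarrow> powser \<phi> z \<noteq> 0) \<and>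
     (AE t in circ. f t = density_of \<phi> t)"

definition L2_space :: "(real \<Rightarrow> real) \<Rightarrow> (real \<Rightarrow> complex) set" where
  "L2_space f = {g \<in> borel_measurable circ. integrable circ (\<lambda>t. (cmod (g t))\<^sup>2 * f t)}"

text \<open>The value at \<open>\<lambda> = 0\<close> is immaterial (division by zero yields \<open>0\<close> there).\<close>

definition beta :: "nat \<Rightarrow> int \<Rightarrow> real \<Rightarrow> complex" where
  "beta n \<mu> t = (1 - cis (- (real_of_int \<mu> * t))) ^ n / (\<i> * complex_of_real t) ^ n"

definition L2_past :: "nat \<Rightarrow> nat \<Rightarrow> (real \<Rightarrow> real) \<Rightarrow> (real \<Rightarrow> complex) set" where
  "L2_past n \<mu> f = {g \<in> L2_space f. \<forall>e>0. \<exists>K c. finite K \<and> K \<subseteq> {..-1::int} \<and>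
     (LINT t|circ.
       (cmod (g t - (\<Sum>k\<in>K. c k * (cis (real_of_int k * t) * beta n (int \<mu>) t))))\<^sup>2 * f t) < e}"

definition sq_integrable :: "'w measure \<Rightarrow> ('w \<Rightarrow> complex) \<Rightarrow> bool" where
  "sq_integrable M X \<longleftrightarrow> X \<in> borel_measurable M \<and> integrable M (\<lambda>\<omega>. (cmod (X \<omega>))\<^sup>2)"

definition ms_tendsto :: "'w measure \<Rightarrow> (nat \<Rightarrow> 'w \<Rightarrow> complex) \<Rightarrow> ('w \<Rightarrow> complex) \<Rightarrow> bool" where
  "ms_tendsto M X Y \<longleftrightarrow>
     (\<forall>N. sq_integrable M (X N)) \<and> sq_integrable M Y \<and>
     (\<lambda>N. LINT \<omega>|M. (cmod (X N \<omega> - Y \<omega>))\<^sup>2) \<longlonglongrightarrow> 0"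

definition ms_sums :: "'w measure \<Rightarrow> (nat \<Rightarrow> 'w \<Rightarrow> complex) \<Rightarrow> ('w \<Rightarrow> complex) \<Rightarrow> bool" where
  "ms_sums M X Y \<longleftrightarrow> ms_tendsto M (\<lambda>N \<omega>. \<Sum>k<N. X k \<omega>) Y"

definition incr :: "nat \<Rightarrow> int \<Rightarrow> (int \<Rightarrow> 'w \<Rightarrow> complex) \<Rightarrow> int \<Rightarrow> 'w \<Rightarrow> complex" where
  "incr n \<mu> \<xi> m \<omega> = (\<Sum>l\<le>n. (- 1) ^ l * of_nat (n choose l) * \<xi> (m - int l * \<mu>) \<omega>)"

definition stationary_increments :: "nat \<Rightarrow> 'w measure \<Rightarrow> (int \<Rightarrow> 'w \<Rightarrow> complex) \<Rightarrow> bool" where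
  "stationary_increments n M \<xi> \<longleftrightarrow>
     (\<forall>m. \<xi> m \<in> borel_measurable M) \<and>
     (\<forall>m \<mu>. integrable M (incr n \<mu> \<xi> m) \<and> (LINT \<omega>|M. incr n \<mu> \<xi> m \<omega>) = 0) \<and>
     (\<forall>m\<^sub>0 m \<mu>\<^sub>1 \<mu>\<^sub>2.
        integrable M (\<lambda>\<omega>. incr n \<mu>\<^sub>1 \<xi> (m\<^sub>0 + m) \<omega> * cnj (incr n \<mu>\<^sub>2 \<xi> m\<^sub>0 \<omega>))) \<and>
     (\<forall>m\<^sub>0 m\<^sub>0' m \<mu>\<^sub>1 \<mu>\<^sub>2.
        (LINT \<omega>|M. incr n \<mu>\<^sub>1 \<xi> (m\<^sub>0 + m) \<omega> * cnj (incr n \<mu>\<^sub>2 \<xi> m\<^sub>0 \<omega>)) =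
        (LINT \<omega>|M. incr n \<mu>\<^sub>1 \<xi> (m\<^sub>0' + m) \<omega> * cnj (incr n \<mu>\<^sub>2 \<xi> m\<^sub>0' \<omega>)))"

text \<open>Countable additivity in mean square follows from the conditions below.\<close>

definition orthogonal_measure ::
  "'w measure \<Rightarrow> (real set \<Rightarrow> 'w \<Rightarrow> complex) \<Rightarrow> (real \<Rightarrow> real) \<Rightarrow> bool" where
  "orthogonal_measure M Z f \<longleftrightarrow>
     (\<forall>S\<in>sets circ. sq_integrable M (Z S)) \<and>
     (\<forall>S\<in>sets circ. \<forall>T\<in>sets circ. S \<inter> T = {} \<longrightarrow>
        (AE \<omega> in M. Z (S \<union> T) \<omega> = Z S \<omega> + Z T \<omega>) \<and>
        (LINT \<omega>|M. Z S \<omega> * cnj (Z T \<omega>)) = 0) \<and>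
     (\<forall>S\<in>sets circ.
        (LINT \<omega>|M. (cmod (Z S \<omega>))\<^sup>2) = 1 / (2 * pi) * (LINT t:S|circ. f t))"

definition simple_stoch_integral ::
  "(real set \<Rightarrow> 'w \<Rightarrow> complex) \<Rightarrow> (real \<Rightarrow> complex) \<Rightarrow> 'w \<Rightarrow> complex" where
  "simple_stoch_integral Z s \<omega> =
     (\<Sum>y\<in>s ` {-pi..pi}. y * Z {t\<in>{-pi..pi}. s t = y} \<omega>)"

definition has_stoch_integral ::
  "'w measure \<Rightarrow> (real set \<Rightarrow> 'w \<Rightarrow> complex) \<Rightarrow> (real \<Rightarrow> real) \<Rightarrow>
   (real \<Rightarrow> complex) \<Rightarrow> ('w \<Rightarrow> complex) \<Rightarrow> bool" where
  "has_stoch_integral M Z f g X \<longleftrightarrow>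
     g \<in> L2_space f \<and>
     (\<exists>s. (\<forall>N::nat. simple_function circ (s N)) \<and>
        (\<lambda>N. LINT t|circ. (cmod (s N t - g t))\<^sup>2 * f t) \<longlonglongrightarrow> 0 \<and>
        ms_tendsto M (\<lambda>N. simple_stoch_integral Z (s N)) X)"

definition spectral_representation ::
  "nat \<Rightarrow> 'w measure \<Rightarrow> (int \<Rightarrow> 'w \<Rightarrow> complex) \<Rightarrow> (real set \<Rightarrow> 'w \<Rightarrow> complex) \<Rightarrow>
   (real \<Rightarrow> real) \<Rightarrow> bool" where
  "spectral_representation n M \<xi> Z f \<longleftrightarrow>
     prob_space M \<and> spectral_density f \<and> stationary_increments n M \<xi> \<and>
     orthogonal_measure M Z f \<and>
     (\<forall>m \<mu>. has_stoch_integral M Z f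
        (\<lambda>t. cis (real_of_int m * t) * beta n \<mu> t) (incr n \<mu> \<xi> m))"

definition has_spectral_density ::
  "nat \<Rightarrow> 'w measure \<Rightarrow> (int \<Rightarrow> 'w \<Rightarrow> complex) \<Rightarrow> (real \<Rightarrow> real) \<Rightarrow> bool" where
  "has_spectral_density n M \<xi> f \<longleftrightarrow> (\<exists>Z. spectral_representation n M \<xi> Z f)"

definition one_sided_moving_average :: "'w measure \<Rightarrow> (int \<Rightarrow> 'w \<Rightarrow> complex) \<Rightarrow> bool" where
  "one_sided_moving_average M X \<longleftrightarrow>
     (\<exists>(\<epsilon> :: int \<Rightarrow> 'w \<Rightarrow> complex) (c :: nat \<Rightarrow> complex).
        (\<forall>k. sq_integrable M (\<epsilon> k) \<and> (LINT \<omega>|M. \<epsilon> k \<omega>) = 0) \<and>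
        (\<forall>j k. (LINT \<omega>|M. \<epsilon> j \<omega> * cnj (\<epsilon> k \<omega>)) = (if j = k then 1 else 0)) \<and>
        l2 c \<and>
        (\<forall>m. ms_sums M (\<lambda>k \<omega>. c k * \<epsilon> (m - int k) \<omega>) (X m)))"

definition vcoeff :: "nat \<Rightarrow> nat \<Rightarrow> (nat \<Rightarrow> complex) \<Rightarrow> int \<Rightarrow> complex" where
  "vcoeff n \<mu> a k =
     (\<Sum>l = nat \<lceil>- real_of_int k / real \<mu>\<rceil>..n.
        (- 1) ^ l * of_nat (n choose l) * bcoeff n \<mu> a (nat (int l * int \<mu> + k)))"

definition V_functional ::
  "nat \<Rightarrow> nat \<Rightarrow> (nat \<Rightarrow> complex) \<Rightarrow> (int \<Rightarrow> 'w \<Rightarrow> complex) \<Rightarrow> 'w \<Rightarrow> complex" where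
  "V_functional n \<mu> a \<xi> \<omega> = (\<Sum>k = - (int \<mu> * int n)..-1. vcoeff n \<mu> a k * \<xi> k \<omega>)"

definition is_A_functional ::
  "nat \<Rightarrow> nat \<Rightarrow> (nat \<Rightarrow> complex) \<Rightarrow> 'w measure \<Rightarrow> (int \<Rightarrow> 'w \<Rightarrow> complex) \<Rightarrow>
   ('w \<Rightarrow> complex) \<Rightarrow> bool" where
  "is_A_functional n \<mu> a M \<xi> X \<longleftrightarrow>
     (\<exists>B. ms_sums M (\<lambda>k \<omega>. bcoeff n \<mu> a k * incr n (int \<mu>) \<xi> (int k) \<omega>) B \<and>
          X = (\<lambda>\<omega>. B \<omega> - V_functional n \<mu> a \<xi> \<omega>))"

definition is_estimate ::
  "nat \<Rightarrow> nat \<Rightarrow> (nat \<Rightarrow> complex) \<Rightarrow> 'w measure \<Rightarrow> (int \<Rightarrow> 'w \<Rightarrow> complex) \<Rightarrow>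
   (real set \<Rightarrow> 'w \<Rightarrow> complex) \<Rightarrow> (real \<Rightarrow> real) \<Rightarrow> (real \<Rightarrow> complex) \<Rightarrow> ('w \<Rightarrow> complex) \<Rightarrow> bool" where
  "is_estimate n \<mu> a M \<xi> Z f h Y \<longleftrightarrow>
     (\<exists>H. has_stoch_integral M Z f (\<lambda>t. h t * beta n (int \<mu>) t) H \<and>
          Y = (\<lambda>\<omega>. - V_functional n \<mu> a \<xi> \<omega> + H \<omega>))"

definition spectral_char :: "nat \<Rightarrow> nat \<Rightarrow> (real \<Rightarrow> real) \<Rightarrow> (real \<Rightarrow> complex) \<Rightarrow> bool" where
  "spectral_char n \<mu> f h \<longleftrightarrow> (\<lambda>t. h t * beta n (int \<mu>) t) \<in> L2_past n \<mu> f"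

text \<open>
  The mean square error is the same for all sequences with spectral density \<open>f\<close>. Taking
  probability spaces on the real line is no restriction: every spectral density is
  realized on one of them.
\<close>

definition mse ::
  "nat \<Rightarrow> nat \<Rightarrow> (nat \<Rightarrow> complex) \<Rightarrow> (real \<Rightarrow> complex) \<Rightarrow> (real \<Rightarrow> real) \<Rightarrow> real" where
  "mse n \<mu> a h f = (THE d. \<exists>(M :: real measure) \<xi> Z X Y.
     spectral_representation n M \<xi> Z f \<and>
     is_A_functional n \<mu> a M \<xi> X \<and> is_estimate n \<mu> a M \<xi> Z f h Y \<and>
     d = (LINT \<omega>|M. (cmod (X \<omega> - Y \<omega>))\<^sup>2))"

definition optimal_char ::
  "nat \<Rightarrow> nat \<Rightarrow> (nat \<Rightarrow> complex) \<Rightarrow> (real \<Rightarrow> real) \<Rightarrow> (real \<Rightarrow> complex) \<Rightarrow> bool" where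
  "optimal_char n \<mu> a f h \<longleftrightarrow>
     spectral_char n \<mu> f h \<and>
     (\<forall>h'. spectral_char n \<mu> f h' \<longrightarrow> mse n \<mu> a h f \<le> mse n \<mu> a h' f)"

definition least_favorable ::
  "nat \<Rightarrow> nat \<Rightarrow> (nat \<Rightarrow> complex) \<Rightarrow> (real \<Rightarrow> real) set \<Rightarrow> (real \<Rightarrow> real) \<Rightarrow> bool" where
  "least_favorable n \<mu> a D f0 \<longleftrightarrow>
     f0 \<in> D \<and>
     (\<exists>h0. optimal_char n \<mu> a f0 h0 \<and>
        (\<forall>f\<in>D. \<forall>h. optimal_char n \<mu> a f h \<longrightarrow> mse n \<mu> a h f \<le> mse n \<mu> a h0 f0))"

definition H_class :: "nat \<Rightarrow> nat \<Rightarrow> (real \<Rightarrow> real) set \<Rightarrow> (real \<Rightarrow> complex) set" where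
  "H_class n \<mu> D = {h. \<forall>f\<in>D. spectral_char n \<mu> f h}"

definition minimax_robust ::
  "nat \<Rightarrow> nat \<Rightarrow> (nat \<Rightarrow> complex) \<Rightarrow> (real \<Rightarrow> real) set \<Rightarrow> (real \<Rightarrow> complex) \<Rightarrow> bool" where
  "minimax_robust n \<mu> a D h0 \<longleftrightarrow>
     h0 \<in> H_class n \<mu> D \<and>
     (\<exists>f1\<in>D. \<forall>f\<in>D. mse n \<mu> a h0 f \<le> mse n \<mu> a h0 f1) \<and>
     (\<forall>h\<in>H_class n \<mu> D.
        (SUP f\<in>D. ereal (mse n \<mu> a h0 f)) \<le> (SUP f\<in>D. ereal (mse n \<mu> a h f)))"

definition band_class :: "(real \<Rightarrow> real) \<Rightarrow> (real \<Rightarrow> real) \<Rightarrow> real \<Rightarrow> (real \<Rightarrow> real) set" where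
  "band_class v u P0 =
     {f. spectral_density f \<and> (AE t in circ. v t \<le> f t \<and> f t \<le> u t) \<and>
         1 / (2 * pi) * (LINT t|circ. f t) \<le> P0}"

definition eq_E :: "nat \<Rightarrow> nat \<Rightarrow> (nat \<Rightarrow> complex) \<Rightarrow> (nat \<Rightarrow> complex) \<Rightarrow> bool" where
  "eq_E n \<mu> a \<phi> \<longleftrightarrow> l2 \<phi> \<and> (\<exists>\<alpha>. \<forall>k. DAW n \<mu> a \<phi> k = \<alpha> * cnj (\<phi> k))"

definition density_F ::
  "nat \<Rightarrow> nat \<Rightarrow> (nat \<Rightarrow> complex) \<Rightarrow> (real \<Rightarrow> real) \<Rightarrow> (real \<Rightarrow> real) \<Rightarrow>
   (nat \<Rightarrow> complex) \<Rightarrow> complex \<Rightarrow> real \<Rightarrow> real" where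
  "density_F n \<mu> a v u \<phi> c t =
     max (v t) (min (u t) ((cmod (c * powser (DA n \<mu> a (phi_mu n \<mu> \<phi>)) (cis t)))\<^sup>2))"

definition nu_set ::
  "nat \<Rightarrow> nat \<Rightarrow> (nat \<Rightarrow> complex) \<Rightarrow> (real \<Rightarrow> real) \<Rightarrow> (real \<Rightarrow> real) \<Rightarrow> real \<Rightarrow>
   (nat \<Rightarrow> complex) set" where
  "nu_set n \<mu> a v u P0 =
     {\<phi>. eq_E n \<mu> a \<phi> \<and> (AE t in circ. v t \<le> density_of \<phi> t \<and> density_of \<phi> t \<le> u t) \<and>
         (l2norm \<phi>)\<^sup>2 = P0 \<and> canonical_factorization \<phi> (density_of \<phi>)}"

definition nu_plus_set ::
  "nat \<Rightarrow> nat \<Rightarrow> (nat \<Rightarrow> complex) \<Rightarrow> (real \<Rightarrow> real) \<Rightarrow> (real \<Rightarrow> real) \<Rightarrow> real \<Rightarrow>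
   (nat \<Rightarrow> complex) set" where
  "nu_plus_set n \<mu> a v u P0 =
     {\<phi>. l2 \<phi> \<and> (l2norm \<phi>)\<^sup>2 = P0 \<and>
         (\<exists>c. canonical_factorization \<phi> (density_F n \<mu> a v u \<phi> c))}"

text \<open>\<open>m\<close> is the maximum of \<open>F\<close> on \<open>S\<close>, with the convention that it is \<open>-\<infinity>\<close> if \<open>S\<close> is empty.\<close>

definition max_value :: "('b \<Rightarrow> real) \<Rightarrow> 'b set \<Rightarrow> ereal \<Rightarrow> bool" where
  "max_value F S m \<longleftrightarrow>
     (S = {} \<and> m = -\<infinity>) \<or> (\<exists>x\<in>S. m = ereal (F x) \<and> (\<forall>y\<in>S. F y \<le> F x))"

definition solves_extremum ::
  "nat \<Rightarrow> nat \<Rightarrow> (nat \<Rightarrow> complex) \<Rightarrow> (real \<Rightarrow> real) set \<Rightarrow> (nat \<Rightarrow> complex) \<Rightarrow> bool" where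
  "solves_extremum n \<mu> a D \<phi> \<longleftrightarrow>
     l2 \<phi> \<and> density_of \<phi> \<in> D \<and>
     (\<forall>\<psi>. l2 \<psi> \<and> density_of \<psi> \<in> D \<longrightarrow>
        (l2norm (DA n \<mu> a (phi_mu n \<mu> \<psi>)))\<^sup>2 \<le> (l2norm (DA n \<mu> a (phi_mu n \<mu> \<phi>)))\<^sup>2)"

definition char_formula ::
  "nat \<Rightarrow> nat \<Rightarrow> (nat \<Rightarrow> complex) \<Rightarrow> (nat \<Rightarrow> complex) \<Rightarrow> real \<Rightarrow> complex" where
  "char_formula n \<mu> a \<phi> t =
     powser (bcoeff n \<mu> a) (cis t) -
     powser (DA n \<mu> a (phi_mu n \<mu> \<phi>)) (cis t) * inverse (powser (phi_mu n \<mu> \<phi>) (cis (- t)))"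

end

theory Submission
  imports Defs "HOL-Real_Asymp.Real_Asymp"
begin

text \<open>
  Put \<open>\<beta>(t) = (1 - exp(-i\<mu>t))\<^sup>n / (it)\<^sup>n\<close> and \<open>A(t) = \<Sum>k. b(k) exp(ikt)\<close> with \<open>b = D\<^sup>\<mu> a\<close>.
  Stochastic integration is an isometry, so the mean square error of a spectral characteristic
  \<open>h\<close> under a density \<open>f\<close> is the number
  \<open>\<Delta>(h;f) = 1/(2\<pi>) \<integral> |A - h|\<^sup>2 |\<beta>|\<^sup>2 f\<close> (lemma \<open>mse_integral\<close>); for fixed \<open>h\<close> it is linear in \<open>f\<close>.
  Suppose \<open>f0 = |\<Phi>|\<^sup>2\<close> is a canonical factorization. On the circle \<open>|\<Phi>\<^sub>\<mu>|\<^sup>2 = |\<beta>|\<^sup>2 f0\<close>, and splitting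
  the product of \<open>A\<close> and \<open>\<Phi>\<^sub>\<mu>\<close> into its analytic part \<open>r\<close> and its antianalytic part shows that
  \<open>h0 = A - r/\<Phi>\<^sub>\<mu>\<close> is optimal for \<open>f0\<close>: the error \<open>r \<beta>/\<Phi>\<^sub>\<mu>\<close> is orthogonal to the past
  (\<open>remainder_orthogonal\<close>), and \<open>h0 \<beta>\<close> is approximated by the past in \<open>L\<^sub>2(f)\<close> for every density
  \<open>f\<close> at once (\<open>predictor_spectral_char\<close>). Moreover
  \<open>\<Delta>(h0;f) = 1/(2\<pi>) \<integral> (|r|\<^sup>2/f0) f\<close> (\<open>mse_predictor_density\<close>).

  Hence all three parts are about the inequality \<open>\<Delta>(h0;f) \<le> \<Delta>(h0;f0)\<close> for \<open>f\<close> in the class, that is,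
  about \<open>(h0, f0)\<close> being a saddle point: it makes \<open>f0\<close> least favorable
  (\<open>saddle_least_favorable\<close>) and \<open>h0\<close> minimax-robust (\<open>saddle_minimax\<close>).

  The equation \<open>D\<^sup>\<mu> A W\<^sup>\<mu> \<phi> = \<alpha> cnj \<phi>\<close> says that \<open>r\<close> is \<open>\<alpha>\<close> times the conjugate of \<open>\<Phi>\<close>. Then \<open>|r|\<^sup>2/f0 = |\<alpha>|\<^sup>2\<close> is constant,
  \<open>\<Delta>(h0;f)\<close> is a multiple of the power \<open>\<integral> f\<close>, and \<open>f0\<close> has the maximal power (\<open>eigen_saddle\<close>).
  For a density \<open>f0\<close> obtained by clipping \<open>|c r|\<^sup>2\<close> at \<open>v\<close> and \<open>u\<close>, with \<open>c \<noteq> 0\<close>, one has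
  \<open>(|r|\<^sup>2/f0 - 1/|c|\<^sup>2) (f - f0) \<le> 0\<close> pointwise: where \<open>f0\<close> differs from \<open>|c r|\<^sup>2\<close> it sits on the bound
  \<open>v\<close> or \<open>u\<close> that fixes the sign of \<open>f - f0\<close>. Integration and the power constraint give the
  saddle point; for \<open>c = 0\<close> the density equals \<open>v\<close> and has full power, so it is the only member of
  the class up to null sets (\<open>clipped_saddle\<close>).

  Conversely, let \<open>f0\<close> be least favorable in a convex class, and let \<open>h\<^sub>\<epsilon>\<close> be optimal for
  \<open>f\<^sub>\<epsilon> = (1 - \<epsilon>) f0 + \<epsilon> f\<close>. From \<open>\<Delta>(h\<^sub>\<epsilon>;f\<^sub>\<epsilon>) \<le> \<Delta>(h0;f0)\<close> and the optimality of \<open>h0\<close> one gets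
  \<open>\<Delta>(h\<^sub>\<epsilon>;f) \<le> \<Delta>(h0;f0)\<close> as well as \<open>h\<^sub>\<epsilon> \<beta> \<rightarrow> h0 \<beta>\<close> in \<open>L\<^sub>2(f0)\<close>; Fatou's lemma turns this into
  \<open>\<Delta>(h0;f) \<le> \<Delta>(h0;f0)\<close> (\<open>least_favorable_saddle\<close>).

  The analytic input is the boundary behavior of \<open>w\<^sub>\<mu>\<close>. Separating the zeros of \<open>1 - z\<^sup>\<mu>\<close> from the
  remaining factor gives \<open>w\<^sub>\<mu>(z) = ((1 - z\<^sup>\<mu>)/(1 - z))\<^sup>n exp(n g(z))\<close>, where \<open>Re g\<close> has the boundary
  values \<open>ln (sin(t/2)/(t/2))\<close>. This function is even and twice continuously differentiable on
  \<open>[-\<pi>,\<pi>]\<close>, so the coefficients of \<open>g\<close> are absolutely summable (\<open>l1_lnsinc_fourier\<close>,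
  \<open>Re_lnsinc_outer\<close>). Consequently all power series in question converge absolutely on the
  closed disc (\<open>wcoeff_outer\<close>), and \<open>1/w\<^sub>\<mu>\<close> has the bounded approximations needed to see that
  \<open>\<beta>/\<Phi>\<^sub>\<mu>\<close> lies in the span of the past (\<open>wcoeff_approx_inverse\<close>, \<open>in_past\<close>). The same function
  \<open>\<beta>/\<Phi>\<^sub>\<mu>\<close> is the spectral characteristic of the innovations, which yields the moving average
  representation (\<open>moving_average\<close>).
\<close>

section \<open>Square integrable functions\<close>

definition l2ip :: "'w measure \<Rightarrow> ('w \<Rightarrow> complex) \<Rightarrow> ('w \<Rightarrow> complex) \<Rightarrow> complex" where
  "l2ip M X Y = (LINT \<omega>|M. X \<omega> * cnj (Y \<omega>))"

definition l2sq :: "'w measure \<Rightarrow> ('w \<Rightarrow> complex) \<Rightarrow> real" where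
  "l2sq M X = (LINT \<omega>|M. (cmod (X \<omega>))\<^sup>2)"

lemma cmod_sum_sq_le: "(cmod (x + y))\<^sup>2 \<le> 2 * (cmod x)\<^sup>2 + 2 * (cmod y)\<^sup>2"
proof -
  have "(cmod (x + y))\<^sup>2 \<le> (cmod x + cmod y)\<^sup>2"
    by (intro power_mono norm_triangle_ineq) auto
  also have "\<dots> \<le> 2 * (cmod x)\<^sup>2 + 2 * (cmod y)\<^sup>2"
    using sum_squares_bound[of "cmod x" "cmod y"] by (simp add: power2_sum)
  finally show ?thesis .
qed

lemma sq_integrable_measurable [measurable_dest]:
  "sq_integrable M X \<Longrightarrow> X \<in> borel_measurable M"
  by (simp add: sq_integrable_def)

lemma sq_integrable_integrable: "sq_integrable M X \<Longrightarrow> integrable M (\<lambda>\<omega>. (cmod (X \<omega>))\<^sup>2)"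
  by (simp add: sq_integrable_def)

lemma borel_measurable_cnj [measurable (raw)]:
  "f \<in> borel_measurable M \<Longrightarrow> (\<lambda>x. cnj (f x)) \<in> borel_measurable M"
  by (rule borel_measurable_continuous_on[of cnj]) (auto intro: continuous_intros)

lemma sq_integrable_mult:
  assumes "sq_integrable M X" "sq_integrable M Y"
  shows "integrable M (\<lambda>\<omega>. X \<omega> * cnj (Y \<omega>))"
proof (rule Bochner_Integration.integrable_bound)
  show "integrable M (\<lambda>\<omega>. (cmod (X \<omega>))\<^sup>2 + (cmod (Y \<omega>))\<^sup>2)"
    using assms by (auto simp: sq_integrable_def)
  show "(\<lambda>\<omega>. X \<omega> * cnj (Y \<omega>)) \<in> borel_measurable M"
    using assms[THEN sq_integrable_measurable] by measurable
  have "cmod (x * cnj y) \<le> (cmod x)\<^sup>2 + (cmod y)\<^sup>2" for x y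
    using sum_squares_bound[of "cmod x" "cmod y"] mult_nonneg_nonneg[OF norm_ge_zero norm_ge_zero, of x y]
    unfolding norm_mult complex_mod_cnj by linarith
  then show "AE \<omega> in M. norm (X \<omega> * cnj (Y \<omega>)) \<le> norm ((cmod (X \<omega>))\<^sup>2 + (cmod (Y \<omega>))\<^sup>2)"
    by (auto intro!: AE_I2)
qed

lemma sq_integrable_bound:
  assumes "sq_integrable M Y" "X \<in> borel_measurable M" "AE \<omega> in M. cmod (X \<omega>) \<le> cmod (Y \<omega>)"
  shows "sq_integrable M X"
  unfolding sq_integrable_def
proof
  note [measurable] = assms(2)
  show "integrable M (\<lambda>\<omega>. (cmod (X \<omega>))\<^sup>2)"
    by (rule Bochner_Integration.integrable_bound[OF sq_integrable_integrable[OF assms(1)]])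
       (use assms(3) in \<open>auto elim!: eventually_mono intro!: power_mono\<close>)
qed fact

lemma sq_integrable_cmult:
  "sq_integrable M X \<Longrightarrow> sq_integrable M (\<lambda>\<omega>. c * X \<omega>)"
  by (auto simp: sq_integrable_def norm_mult power_mult_distrib)

lemma sq_integrable_add:
  assumes "sq_integrable M X" "sq_integrable M Y"
  shows "sq_integrable M (\<lambda>\<omega>. X \<omega> + Y \<omega>)"
  unfolding sq_integrable_def
proof
  note [measurable] = assms[THEN sq_integrable_measurable]
  show "(\<lambda>\<omega>. X \<omega> + Y \<omega>) \<in> borel_measurable M" by measurable
  show "integrable M (\<lambda>\<omega>. (cmod (X \<omega> + Y \<omega>))\<^sup>2)"
  proof (rule Bochner_Integration.integrable_bound)
    show "integrable M (\<lambda>\<omega>. 2 * (cmod (X \<omega>))\<^sup>2 + 2 * (cmod (Y \<omega>))\<^sup>2)"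
      using assms by (auto simp: sq_integrable_def)
  qed (use cmod_sum_sq_le in \<open>auto intro!: AE_I2\<close>)
qed

lemma sq_integrable_diff:
  assumes "sq_integrable M X" "sq_integrable M Y"
  shows "sq_integrable M (\<lambda>\<omega>. X \<omega> - Y \<omega>)"
  using sq_integrable_add[OF assms(1) sq_integrable_cmult[OF assms(2), of "-1"]] by simp

lemma sq_integrable_sum:
  "(\<And>i. i \<in> I \<Longrightarrow> sq_integrable M (X i)) \<Longrightarrow> sq_integrable M (\<lambda>\<omega>. \<Sum>i\<in>I. X i \<omega>)"
proof (induction I rule: infinite_finite_induct)
  case (insert x F)
  then show ?case by (auto intro!: sq_integrable_add)
qed (auto simp: sq_integrable_def)

lemma l2sq_nonneg [simp]: "0 \<le> l2sq M X"
  by (simp add: l2sq_def)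

lemma l2sq_eq_l2ip: "complex_of_real (l2sq M X) = l2ip M X X"
  unfolding l2sq_def l2ip_def complex_norm_square[symmetric]
  by (simp flip: of_real_power)

lemma l2sq_minus_commute: "l2sq M (\<lambda>\<omega>. X \<omega> - Y \<omega>) = l2sq M (\<lambda>\<omega>. Y \<omega> - X \<omega>)"
  by (simp add: l2sq_def norm_minus_commute)

lemma l2sq_cmult: "l2sq M (\<lambda>\<omega>. c * X \<omega>) = (cmod c)\<^sup>2 * l2sq M X"
  by (simp add: l2sq_def norm_mult power_mult_distrib)

lemma l2ip_cmult_left: "l2ip M (\<lambda>\<omega>. c * X \<omega>) Y = c * l2ip M X Y"
  by (simp add: l2ip_def mult.assoc)

lemma l2ip_add_left:
  "sq_integrable M X \<Longrightarrow> sq_integrable M Y \<Longrightarrow> sq_integrable M Z \<Longrightarrow>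
     l2ip M (\<lambda>\<omega>. X \<omega> + Y \<omega>) Z = l2ip M X Z + l2ip M Y Z"
  by (simp add: l2ip_def ring_distribs sq_integrable_mult)

lemma l2ip_diff_left:
  "sq_integrable M X \<Longrightarrow> sq_integrable M Y \<Longrightarrow> sq_integrable M Z \<Longrightarrow>
     l2ip M (\<lambda>\<omega>. X \<omega> - Y \<omega>) Z = l2ip M X Z - l2ip M Y Z"
  by (simp add: l2ip_def ring_distribs left_diff_distrib sq_integrable_mult)

lemma l2ip_commute: "l2ip M Y X = cnj (l2ip M X Y)"
proof -
  have "cnj (l2ip M X Y) = (LINT \<omega>|M. cnj (X \<omega> * cnj (Y \<omega>)))"
    by (simp only: l2ip_def Bochner_Integration.integral_cnj)
  then show ?thesis by (simp add: l2ip_def mult.commute)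
qed

lemma l2ip_diff_right:
  "sq_integrable M X \<Longrightarrow> sq_integrable M Y \<Longrightarrow> sq_integrable M Z \<Longrightarrow>
     l2ip M Z (\<lambda>\<omega>. X \<omega> - Y \<omega>) = l2ip M Z X - l2ip M Z Y"
  by (simp add: l2ip_commute[of M Z] l2ip_diff_left)

lemma l2ip_add_right:
  "sq_integrable M X \<Longrightarrow> sq_integrable M Y \<Longrightarrow> sq_integrable M Z \<Longrightarrow>
     l2ip M Z (\<lambda>\<omega>. X \<omega> + Y \<omega>) = l2ip M Z X + l2ip M Z Y"
  by (simp add: l2ip_commute[of M Z] l2ip_add_left)

lemma l2ip_sum_sum:
  assumes "finite I" "finite J" "\<And>i. i \<in> I \<Longrightarrow> sq_integrable M (X i)"
    "\<And>j. j \<in> J \<Longrightarrow> sq_integrable M (Y j)"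
  shows "l2ip M (\<lambda>\<omega>. \<Sum>i\<in>I. c i * X i \<omega>) (\<lambda>\<omega>. \<Sum>j\<in>J. d j * Y j \<omega>) =
         (\<Sum>i\<in>I. \<Sum>j\<in>J. c i * cnj (d j) * l2ip M (X i) (Y j))"
proof -
  have "l2ip M (\<lambda>\<omega>. \<Sum>i\<in>I. c i * X i \<omega>) (\<lambda>\<omega>. \<Sum>j\<in>J. d j * Y j \<omega>) =
     (LINT \<omega>|M. (\<Sum>i\<in>I. \<Sum>j\<in>J. c i * cnj (d j) * (X i \<omega> * cnj (Y j \<omega>))))"
    by (simp add: l2ip_def sum_product mult_ac)
  also have "\<dots> = (\<Sum>i\<in>I. LINT \<omega>|M. (\<Sum>j\<in>J. c i * cnj (d j) * (X i \<omega> * cnj (Y j \<omega>))))"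
    by (intro Bochner_Integration.integral_sum Bochner_Integration.integrable_sum
        integrable_mult_right sq_integrable_mult assms)
  also have "\<dots> = (\<Sum>i\<in>I. \<Sum>j\<in>J. c i * cnj (d j) * l2ip M (X i) (Y j))"
    unfolding l2ip_def
    by (intro sum.cong refl, subst Bochner_Integration.integral_sum)
       (auto intro!: integrable_mult_right sq_integrable_mult assms)
  finally show ?thesis .
qed

lemma l2sq_add_le:
  assumes "sq_integrable M X" "sq_integrable M Y"
  shows "l2sq M (\<lambda>\<omega>. X \<omega> + Y \<omega>) \<le> 2 * l2sq M X + 2 * l2sq M Y"
proof -
  have "l2sq M (\<lambda>\<omega>. X \<omega> + Y \<omega>) \<le> (LINT \<omega>|M. 2 * (cmod (X \<omega>))\<^sup>2 + 2 * (cmod (Y \<omega>))\<^sup>2)"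
    unfolding l2sq_def
    by (intro integral_mono cmod_sum_sq_le)
       (use assms sq_integrable_add[OF assms] in \<open>auto simp: sq_integrable_def\<close>)
  also have "\<dots> = 2 * l2sq M X + 2 * l2sq M Y"
    unfolding l2sq_def using assms[THEN sq_integrable_integrable] by simp
  finally show ?thesis .
qed

lemma l2sq_triangle:
  assumes "sq_integrable M X" "sq_integrable M Y" "sq_integrable M Z"
  shows "l2sq M (\<lambda>\<omega>. X \<omega> - Z \<omega>) \<le> 2 * l2sq M (\<lambda>\<omega>. X \<omega> - Y \<omega>) + 2 * l2sq M (\<lambda>\<omega>. Y \<omega> - Z \<omega>)"
  using l2sq_add_le[OF sq_integrable_diff[OF assms(1,2)] sq_integrable_diff[OF assms(2,3)]] by simp

lemma l2sq_add_expand: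
  assumes "sq_integrable M X" "sq_integrable M Y"
  shows "l2sq M (\<lambda>\<omega>. X \<omega> + Y \<omega>) = l2sq M X + l2sq M Y + 2 * Re (l2ip M X Y)"
proof -
  have "l2sq M (\<lambda>\<omega>. X \<omega> + Y \<omega>) =
      (LINT \<omega>|M. (cmod (X \<omega>))\<^sup>2 + (cmod (Y \<omega>))\<^sup>2 + 2 * Re (X \<omega> * cnj (Y \<omega>)))"
    unfolding l2sq_def by (intro Bochner_Integration.integral_cong refl)
       (simp only: cmod_power2, simp add: power2_eq_square algebra_simps)
  also have "\<dots> = l2sq M X + l2sq M Y + 2 * Re (l2ip M X Y)"
    using assms[THEN sq_integrable_integrable] sq_integrable_mult[OF assms]
    by (simp add: l2sq_def l2ip_def del: times_complex.sel)
  finally show ?thesis .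
qed

lemma parallelogram:
  assumes "sq_integrable M X" "sq_integrable M Y"
  shows "l2sq M (\<lambda>\<omega>. X \<omega> + Y \<omega>) + l2sq M (\<lambda>\<omega>. X \<omega> - Y \<omega>) = 2 * l2sq M X + 2 * l2sq M Y"
  using l2sq_add_expand[OF assms] l2sq_add_expand[OF assms(1) sq_integrable_cmult[OF assms(2), of "-1"]]
    l2ip_commute[of M X Y]
  by (simp add: l2ip_def l2sq_def)

text \<open>
  The quadratic polynomial \<open>s \<mapsto> \<parallel>X - s p Y\<parallel>\<^sup>2\<close>, with \<open>p\<close> the inner product of \<open>X\<close> and \<open>Y\<close>, is
  nonnegative for all real \<open>s\<close>.
\<close>

lemma l2ip_Cauchy_Schwarz:
  assumes "sq_integrable M X" "sq_integrable M Y"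
  shows "(cmod (l2ip M X Y))\<^sup>2 \<le> l2sq M X * l2sq M Y"
proof -
  define p where "p = l2ip M X Y"
  have *: "0 \<le> l2sq M X + s\<^sup>2 * (cmod p)\<^sup>2 * l2sq M Y - 2 * s * (cmod p)\<^sup>2" for s :: real
  proof -
    have "0 \<le> l2sq M (\<lambda>\<omega>. X \<omega> + (- s * p) * Y \<omega>)" by simp
    also have "\<dots> = l2sq M X + l2sq M (\<lambda>\<omega>. (- s * p) * Y \<omega>) + 2 * Re (l2ip M X (\<lambda>\<omega>. (- s * p) * Y \<omega>))"
      by (rule l2sq_add_expand[OF assms(1) sq_integrable_cmult[OF assms(2)]])
    also have "l2ip M X (\<lambda>\<omega>. (- s * p) * Y \<omega>) = cnj (- s * p) * p"
      by (subst l2ip_commute, subst l2ip_cmult_left) (simp add: p_def l2ip_commute[of M Y X])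
    also have "\<dots> = - of_real (s * (cmod p)\<^sup>2)"
      using complex_norm_square[of p] by (simp add: mult_ac)
    finally show ?thesis
      by (simp only: l2sq_cmult) (simp add: norm_mult power_mult_distrib mult_ac)
  qed
  show ?thesis
  proof (cases "l2sq M Y = 0")
    case True
    have "p = 0"
    proof (rule ccontr)
      assume "p \<noteq> 0"
      \<comment> \<open>For \<open>\<parallel>Y\<parallel> = 0\<close> the polynomial is affine in \<open>s\<close>, hence negative for this large \<open>s\<close>.\<close>
      with *[of "(l2sq M X + 1) / (cmod p)\<^sup>2"] True l2sq_nonneg[of M X] show False
        by simp
    qed
    then show ?thesis using True by (simp add: p_def)
  next
    case False
    then have pos: "l2sq M Y > 0" using l2sq_nonneg[of M Y] by linarith
    from *[of "1 / l2sq M Y"] pos have "0 \<le> l2sq M X - (cmod p)\<^sup>2 / l2sq M Y"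
      by (simp add: power2_eq_square field_simps)
    then show ?thesis using pos by (simp add: p_def field_simps)
  qed
qed

lemma l2ip_tendsto:
  assumes X: "\<And>k. sq_integrable M (X k)" "sq_integrable M X'"
    and Y: "\<And>k. sq_integrable M (Y k)" "sq_integrable M Y'"
    and lim: "(\<lambda>k. l2sq M (\<lambda>\<omega>. X k \<omega> - X' \<omega>)) \<longlonglongrightarrow> 0" "(\<lambda>k. l2sq M (\<lambda>\<omega>. Y k \<omega> - Y' \<omega>)) \<longlonglongrightarrow> 0"
  shows "(\<lambda>k. l2ip M (X k) (Y k)) \<longlonglongrightarrow> l2ip M X' Y'"
proof -
  define a b where "a k = l2sq M (\<lambda>\<omega>. X k \<omega> - X' \<omega>)" and "b k = l2sq M (\<lambda>\<omega>. Y k \<omega> - Y' \<omega>)" for k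
  have bound: "cmod (l2ip M (X k) (Y k) - l2ip M X' Y') \<le>
      sqrt (a k * (2 * b k + 2 * l2sq M Y')) + sqrt (l2sq M X' * b k)" for k
  proof -
    have eq: "l2ip M (X k) (Y k) - l2ip M X' Y' =
        l2ip M (\<lambda>\<omega>. X k \<omega> - X' \<omega>) (Y k) + l2ip M X' (\<lambda>\<omega>. Y k \<omega> - Y' \<omega>)"
      using X Y by (simp add: l2ip_diff_left l2ip_diff_right)
    moreover have "cmod (l2ip M (\<lambda>\<omega>. X k \<omega> - X' \<omega>) (Y k)) \<le> sqrt (a k * (2 * b k + 2 * l2sq M Y'))"
    proof (rule real_le_rsqrt)
      have "(cmod (l2ip M (\<lambda>\<omega>. X k \<omega> - X' \<omega>) (Y k)))\<^sup>2 \<le> a k * l2sq M (Y k)"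
        unfolding a_def by (intro l2ip_Cauchy_Schwarz sq_integrable_diff X Y)
      also have "l2sq M (Y k) \<le> 2 * b k + 2 * l2sq M Y'"
        using l2sq_add_le[OF sq_integrable_diff[OF Y(1)[of k] Y(2)] Y(2)] by (simp add: b_def)
      finally show "(cmod (l2ip M (\<lambda>\<omega>. X k \<omega> - X' \<omega>) (Y k)))\<^sup>2 \<le> a k * (2 * b k + 2 * l2sq M Y')"
        by (simp add: a_def mult_left_mono)
    qed
    moreover have "cmod (l2ip M X' (\<lambda>\<omega>. Y k \<omega> - Y' \<omega>)) \<le> sqrt (l2sq M X' * b k)"
      unfolding b_def by (intro real_le_rsqrt l2ip_Cauchy_Schwarz sq_integrable_diff X Y)
    ultimately show ?thesis
      using norm_triangle_ineq[of "l2ip M (\<lambda>\<omega>. X k \<omega> - X' \<omega>) (Y k)" "l2ip M X' (\<lambda>\<omega>. Y k \<omega> - Y' \<omega>)"]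
      unfolding eq by linarith
  qed
  have "(\<lambda>k. sqrt (a k * (2 * b k + 2 * l2sq M Y')) + sqrt (l2sq M X' * b k)) \<longlonglongrightarrow>
      sqrt (0 * (2 * 0 + 2 * l2sq M Y')) + sqrt (l2sq M X' * 0)"
    by (intro tendsto_intros) (use lim in \<open>simp_all add: a_def b_def\<close>)
  then have "(\<lambda>k. sqrt (a k * (2 * b k + 2 * l2sq M Y')) + sqrt (l2sq M X' * b k)) \<longlonglongrightarrow> 0" by simp
  then have "(\<lambda>k. l2ip M (X k) (Y k) - l2ip M X' Y') \<longlonglongrightarrow> 0"
    by (rule Lim_null_comparison[rotated]) (use bound in auto)
  then show ?thesis by (rule LIM_zero_cancel)
qed

lemma l2sq_tendsto:
  assumes X: "\<And>k. sq_integrable M (X k)" "sq_integrable M X'"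
    and lim: "(\<lambda>k. l2sq M (\<lambda>\<omega>. X k \<omega> - X' \<omega>)) \<longlonglongrightarrow> 0"
  shows "(\<lambda>k. l2sq M (X k)) \<longlonglongrightarrow> l2sq M X'"
  using l2ip_tendsto[OF X X lim lim] by (simp only: l2sq_eq_l2ip[symmetric] tendsto_of_real_iff)

text \<open>
  Fatou's lemma for mean squares. It gives completeness below, and later passes from almost
  optimal characteristics to the limiting one, whose error is controlled only pointwise.
\<close>

lemma l2sq_fatou:
  assumes X: "\<And>k. sq_integrable M (X k)" and [measurable]: "X' \<in> borel_measurable M"
    and lim: "AE \<omega> in M. (\<lambda>k. X k \<omega>) \<longlonglongrightarrow> X' \<omega>"
    and bound: "eventually (\<lambda>k. l2sq M (X k) \<le> C) sequentially"
  shows "sq_integrable M X'" "l2sq M X' \<le> C"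
proof -
  note [measurable] = X[THEN sq_integrable_measurable]
  have C: "0 \<le> C"
  proof -
    from bound obtain k where "l2sq M (X k) \<le> C" by (auto simp: eventually_sequentially)
    then show ?thesis using l2sq_nonneg[of M "X k"] by linarith
  qed
  have "(\<integral>\<^sup>+ \<omega>. ennreal ((cmod (X' \<omega>))\<^sup>2) \<partial>M) = (\<integral>\<^sup>+ \<omega>. liminf (\<lambda>k. ennreal ((cmod (X k \<omega>))\<^sup>2)) \<partial>M)"
  proof (intro nn_integral_cong_AE)
    show "AE \<omega> in M. ennreal ((cmod (X' \<omega>))\<^sup>2) = liminf (\<lambda>k. ennreal ((cmod (X k \<omega>))\<^sup>2))"
      using lim
    proof eventually_elim
      case (elim \<omega>)
      then have "(\<lambda>k. ennreal ((cmod (X k \<omega>))\<^sup>2)) \<longlonglongrightarrow> ennreal ((cmod (X' \<omega>))\<^sup>2)"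
        by (intro tendsto_intros tendsto_ennrealI)
      then show ?case by (rule lim_imp_Liminf[OF trivial_limit_sequentially, symmetric])
    qed
  qed
  also have "\<dots> \<le> liminf (\<lambda>k. \<integral>\<^sup>+ \<omega>. ennreal ((cmod (X k \<omega>))\<^sup>2) \<partial>M)"
    by (intro nn_integral_liminf) auto
  also have "\<dots> \<le> liminf (\<lambda>k. ennreal C)"
  proof (intro Liminf_mono)
    show "\<forall>\<^sub>F k in sequentially. (\<integral>\<^sup>+ \<omega>. ennreal ((cmod (X k \<omega>))\<^sup>2) \<partial>M) \<le> ennreal C"
      using bound
    proof eventually_elim
      case (elim k)
      have "(\<integral>\<^sup>+ \<omega>. ennreal ((cmod (X k \<omega>))\<^sup>2) \<partial>M) = ennreal (l2sq M (X k))"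
        unfolding l2sq_def by (intro nn_integral_eq_integral sq_integrable_integrable X) auto
      then show ?case using elim C by (simp add: ennreal_leI)
    qed
  qed
  also have "\<dots> = ennreal C" by (simp add: Liminf_const)
  finally have fin: "(\<integral>\<^sup>+ \<omega>. ennreal ((cmod (X' \<omega>))\<^sup>2) \<partial>M) \<le> ennreal C" .
  show sq: "sq_integrable M X'"
    unfolding sq_integrable_def
    using fin by (auto intro!: integrableI_bounded simp: order_le_less_trans ennreal_less_top)
  have "ennreal (l2sq M X') \<le> ennreal C"
    using fin unfolding l2sq_def
    by (subst nn_integral_eq_integral[symmetric]) (use sq in \<open>auto simp: sq_integrable_def\<close>)
  then show "l2sq M X' \<le> C" using C by simp
qed

lemma l2sq_AE_subseq:
  assumes X: "\<And>k. sq_integrable M (X k)" and lim: "(\<lambda>k. l2sq M (X k)) \<longlonglongrightarrow> 0"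
  obtains r :: "nat \<Rightarrow> nat" where "strict_mono r" "AE \<omega> in M. (\<lambda>k. X (r k) \<omega>) \<longlonglongrightarrow> 0"
proof -
  obtain r where r: "strict_mono r" "AE \<omega> in M. (\<lambda>k. (cmod (X (r k) \<omega>))\<^sup>2) \<longlonglongrightarrow> 0"
    using tendsto_L1_AE_subseq[of M "\<lambda>k \<omega>. (cmod (X k \<omega>))\<^sup>2"] X lim
    by (auto simp: sq_integrable_def l2sq_def)
  have "AE \<omega> in M. (\<lambda>k. X (r k) \<omega>) \<longlonglongrightarrow> 0"
    using r(2)
  proof eventually_elim
    case (elim \<omega>)
    then have "(\<lambda>k. sqrt ((cmod (X (r k) \<omega>))\<^sup>2)) \<longlonglongrightarrow> sqrt 0" by (intro tendsto_intros)
    then show ?case by (simp add: tendsto_norm_zero_cancel)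
  qed
  with r(1) that show ?thesis by blast
qed

text \<open>
  Along a subsequence with \<open>\<parallel>X(r (k + 1)) - X(r k)\<parallel>\<^sup>2 \<le> 1/4\<^sup>k\<close> the weighted squared increments
  \<open>2\<^sup>k |X(r (k + 1)) - X(r k)|\<^sup>2\<close> have finite total integral, so almost everywhere the increments are
  dominated by a geometric sequence and the subsequence converges pointwise; Fatou's lemma identifies the limit.
\<close>

lemma l2sq_complete:
  assumes X: "\<And>k. sq_integrable M (X k)"
    and cauchy: "\<And>e. e > 0 \<Longrightarrow> \<exists>N. \<forall>j\<ge>N. \<forall>k\<ge>N. l2sq M (\<lambda>\<omega>. X j \<omega> - X k \<omega>) < e"
  obtains X' where "sq_integrable M X'" "(\<lambda>k. l2sq M (\<lambda>\<omega>. X k \<omega> - X' \<omega>)) \<longlonglongrightarrow> 0"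
proof -
  note [measurable] = X[THEN sq_integrable_measurable]
  have "\<exists>N. \<forall>k. \<forall>i\<ge>N k. \<forall>j\<ge>N k. l2sq M (\<lambda>\<omega>. X i \<omega> - X j \<omega>) < (1/4) ^ k"
    by (intro choice allI cauchy) auto
  then obtain N where N: "\<And>k i j. i \<ge> N k \<Longrightarrow> j \<ge> N k \<Longrightarrow> l2sq M (\<lambda>\<omega>. X i \<omega> - X j \<omega>) < (1/4) ^ k"
    by blast
  \<comment> \<open>The partial sums make \<open>r\<close> increasing and dominate both \<open>N\<close> and the identity.\<close>
  define r where "r k = (\<Sum>i\<le>k. N i + 1)" for k
  have r_ge: "r k \<ge> N k" for k
    unfolding r_def by (cases k) auto
  have r_mono: "r k \<le> r (Suc k)" for k by (simp add: r_def)
  have r_ge_k: "r k \<ge> k" for k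
  proof -
    have "(\<Sum>i\<le>k. 1) \<le> (\<Sum>i\<le>k. N i + 1)" by (intro sum_mono) auto
    then show ?thesis by (simp add: r_def)
  qed
  define D where "D k \<omega> = X (r (Suc k)) \<omega> - X (r k) \<omega>" for k \<omega>
  have D: "l2sq M (D k) \<le> (1/4) ^ k" for k
    unfolding D_def using N[of k "r (Suc k)" "r k"] r_ge[of k] r_mono[of k] by force
  have sqD: "sq_integrable M (D k)" for k
    unfolding D_def by (intro sq_integrable_diff X)
  note [measurable] = sqD[THEN sq_integrable_measurable]
  have "(\<integral>\<^sup>+ \<omega>. (\<Sum>k. ennreal (2 ^ k * (cmod (D k \<omega>))\<^sup>2)) \<partial>M) =
        (\<Sum>k. \<integral>\<^sup>+ \<omega>. ennreal (2 ^ k * (cmod (D k \<omega>))\<^sup>2) \<partial>M)"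
    by (intro nn_integral_suminf) measurable
  also have "\<dots> \<le> (\<Sum>k. ennreal ((1/2) ^ k))"
  proof (intro suminf_le allI)
    fix k
    have "(\<integral>\<^sup>+ \<omega>. ennreal (2 ^ k * (cmod (D k \<omega>))\<^sup>2) \<partial>M) = ennreal (LINT \<omega>|M. 2 ^ k * (cmod (D k \<omega>))\<^sup>2)"
      by (intro nn_integral_eq_integral) (use sqD in \<open>auto simp: sq_integrable_def\<close>)
    also have "(LINT \<omega>|M. 2 ^ k * (cmod (D k \<omega>))\<^sup>2) = 2 ^ k * l2sq M (D k)"
      by (simp add: l2sq_def)
    also have "\<dots> \<le> 2 ^ k * (1/4) ^ k"
      by (intro mult_left_mono D) auto
    also have "\<dots> = (1/2) ^ k" by (simp flip: power_mult_distrib)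
    finally show "(\<integral>\<^sup>+ \<omega>. ennreal (2 ^ k * (cmod (D k \<omega>))\<^sup>2) \<partial>M) \<le> ennreal ((1/2) ^ k)"
      by (simp add: ennreal_leI)
  qed auto
  also have "\<dots> = ennreal (\<Sum>k. (1/2) ^ k)"
    by (intro suminf_ennreal2) (auto intro: summable_geometric)
  also have "\<dots> < \<infinity>" by simp
  finally have "(\<integral>\<^sup>+ \<omega>. (\<Sum>k. ennreal (2 ^ k * (cmod (D k \<omega>))\<^sup>2)) \<partial>M) \<noteq> \<infinity>" by simp
  then have "AE \<omega> in M. (\<Sum>k. ennreal (2 ^ k * (cmod (D k \<omega>))\<^sup>2)) \<noteq> \<infinity>"
    by (intro nn_integral_PInf_AE) auto
  then have conv: "AE \<omega> in M. convergent (\<lambda>k. X (r k) \<omega>)"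
  proof eventually_elim
    case (elim \<omega>)
    define s where "s k = 2 ^ k * (cmod (D k \<omega>))\<^sup>2" for k
    have "summable s"
      by (rule summable_suminf_not_top) (use elim in \<open>auto simp: s_def\<close>)
    then have "s \<longlonglongrightarrow> 0" by (rule summable_LIMSEQ_zero)
    then obtain K where K: "\<And>k. norm (s k) \<le> K"
      by (meson Bseq_def convergentI convergent_imp_Bseq)
    have bd: "cmod (D k \<omega>) \<le> sqrt K * (sqrt (1/2)) ^ k" for k
    proof -
      have "(cmod (D k \<omega>))\<^sup>2 = s k * (1/2) ^ k"
        by (simp add: s_def power_one_over)
      also have "\<dots> \<le> K * (1/2) ^ k"
        using K[of k] by (intro mult_right_mono) auto
      finally have "cmod (D k \<omega>) \<le> sqrt (K * (1/2) ^ k)" by (rule real_le_rsqrt)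
      then show ?thesis by (simp add: real_sqrt_mult real_sqrt_power)
    qed
    have "summable (\<lambda>k. sqrt K * (sqrt (1/2)) ^ k)"
      by (intro summable_mult summable_geometric) (auto simp: real_sqrt_lt_1_iff)
    then have "summable (\<lambda>k. D k \<omega>)"
      by (rule summable_comparison_test'[where N=0]) (use bd in auto)
    then have "convergent (\<lambda>n. \<Sum>k<n. D k \<omega>)" by (simp add: summable_iff_convergent)
    then have "convergent (\<lambda>n. X (r 0) \<omega> + (\<Sum>k<n. D k \<omega>))" by (intro convergent_add convergent_const)
    moreover have "X (r 0) \<omega> + (\<Sum>k<n. D k \<omega>) = X (r n) \<omega>" for n
      unfolding D_def by (subst sum_lessThan_telescope) auto
    ultimately show ?case by simp
  qed
  define X' where "X' \<omega> = lim (\<lambda>k. X (r k) \<omega>)" for \<omega>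
  have lim: "AE \<omega> in M. (\<lambda>k. X (r k) \<omega>) \<longlonglongrightarrow> X' \<omega>"
    using conv by eventually_elim (simp add: X'_def convergent_LIMSEQ_iff)
  have "(\<lambda>\<omega>. lim (\<lambda>k. X (r k) \<omega>)) \<in> borel_measurable M"
    by (rule borel_measurable_lim_metric) (simp add: X[THEN sq_integrable_measurable])
  moreover have "X' = (\<lambda>\<omega>. lim (\<lambda>k. X (r k) \<omega>))" by (rule ext) (rule X'_def)
  ultimately have X'_measurable: "X' \<in> borel_measurable M" by (simp only:)
  have main: "sq_integrable M (\<lambda>\<omega>. X j \<omega> - X' \<omega>) \<and> l2sq M (\<lambda>\<omega>. X j \<omega> - X' \<omega>) \<le> e"
    if e: "e > 0" and K: "\<forall>i\<ge>K. \<forall>k\<ge>K. l2sq M (\<lambda>\<omega>. X i \<omega> - X k \<omega>) < e" and "j \<ge> K" for e K j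
  proof -
    have sq: "sq_integrable M (\<lambda>\<omega>. X j \<omega> - X (r k) \<omega>)" for k
      by (intro sq_integrable_diff X)
    have ae: "AE \<omega> in M. (\<lambda>k. X j \<omega> - X (r k) \<omega>) \<longlonglongrightarrow> X j \<omega> - X' \<omega>"
      using lim by eventually_elim (intro tendsto_intros)
    have ev: "\<forall>\<^sub>F k in sequentially. l2sq M (\<lambda>\<omega>. X j \<omega> - X (r k) \<omega>) \<le> e"
      using eventually_ge_at_top[of K]
    proof eventually_elim
      case (elim k)
      then have "r k \<ge> K" using r_ge_k[of k] by linarith
      then show ?case using K \<open>j \<ge> K\<close> by (intro less_imp_le) blast
    qed
    have meas: "(\<lambda>\<omega>. X j \<omega> - X' \<omega>) \<in> borel_measurable M"
      by (intro borel_measurable_diff X'_measurable sq_integrable_measurable X)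
    show ?thesis
      using l2sq_fatou[OF sq meas ae ev] by blast
  qed
  obtain K where "\<forall>i\<ge>K. \<forall>k\<ge>K. l2sq M (\<lambda>\<omega>. X i \<omega> - X k \<omega>) < 1"
    using cauchy[of 1] by auto
  then have "sq_integrable M (\<lambda>\<omega>. X K \<omega> - X' \<omega>)"
    using main[of 1 K K] by simp
  then have "sq_integrable M X'"
    using sq_integrable_diff[OF X[of K]] by fastforce
  moreover have "(\<lambda>k. l2sq M (\<lambda>\<omega>. X k \<omega> - X' \<omega>)) \<longlonglongrightarrow> 0"
  proof (rule LIMSEQ_I)
    fix e :: real assume "e > 0"
    then obtain K where K: "\<forall>i\<ge>K. \<forall>k\<ge>K. l2sq M (\<lambda>\<omega>. X i \<omega> - X k \<omega>) < e / 2"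
      using cauchy[of "e/2"] by auto
    show "\<exists>K. \<forall>k\<ge>K. norm (l2sq M (\<lambda>\<omega>. X k \<omega> - X' \<omega>) - 0) < e"
      by (rule exI[of _ K]) (use main[OF _ K] \<open>e > 0\<close> in fastforce)
  qed
  ultimately show ?thesis by (rule that)
qed

definition l2_closure :: "'w measure \<Rightarrow> ('w \<Rightarrow> complex) set \<Rightarrow> ('w \<Rightarrow> complex) set" where
  "l2_closure M V = {X. sq_integrable M X \<and> (\<forall>e>0. \<exists>Y\<in>V. l2sq M (\<lambda>\<omega>. X \<omega> - Y \<omega>) < e)}"

lemma l2_closure_limit:
  assumes V: "\<And>Y. Y \<in> V \<Longrightarrow> sq_integrable M Y"
    and "\<And>k. X k \<in> l2_closure M V" "sq_integrable M X'"
    and "(\<lambda>k. l2sq M (\<lambda>\<omega>. X k \<omega> - X' \<omega>)) \<longlonglongrightarrow> 0"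
  shows "X' \<in> l2_closure M V"
  unfolding l2_closure_def
proof (intro CollectI conjI allI impI assms(3))
  fix e :: real assume "e > 0"
  then have "\<forall>\<^sub>F k in sequentially. l2sq M (\<lambda>\<omega>. X k \<omega> - X' \<omega>) < e / 4"
    using assms(4) by (intro order_tendstoD(2)) auto
  then obtain k where k: "l2sq M (\<lambda>\<omega>. X k \<omega> - X' \<omega>) < e / 4"
    by (meson eventually_sequentially order_refl)
  obtain Y where Y: "Y \<in> V" "l2sq M (\<lambda>\<omega>. X k \<omega> - Y \<omega>) < e / 4"
  proof -
    have "e / 4 > 0" using \<open>e > 0\<close> by simp
    then show ?thesis using assms(2)[of k] that unfolding l2_closure_def by blast
  qed
  have "l2sq M (\<lambda>\<omega>. X' \<omega> - Y \<omega>) \<le> 2 * l2sq M (\<lambda>\<omega>. X' \<omega> - X k \<omega>) + 2 * l2sq M (\<lambda>\<omega>. X k \<omega> - Y \<omega>)"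
  proof (rule l2sq_triangle[OF assms(3) _ V[OF Y(1)]])
    show "sq_integrable M (X k)" using assms(2)[of k] by (simp add: l2_closure_def)
  qed
  also have "\<dots> < e" using k Y by (simp add: l2sq_minus_commute[of M X'])
  finally show "\<exists>Y\<in>V. l2sq M (\<lambda>\<omega>. X' \<omega> - Y \<omega>) < e" using Y by blast
qed

lemma l2_closure_combine:
  assumes V: "\<And>Y. Y \<in> V \<Longrightarrow> sq_integrable M Y"
    and lin: "\<And>Y Z c d. Y \<in> V \<Longrightarrow> Z \<in> V \<Longrightarrow> (\<lambda>\<omega>. c * Y \<omega> + d * Z \<omega>) \<in> V"
    and X: "X \<in> l2_closure M V" "X' \<in> l2_closure M V"
  shows "(\<lambda>\<omega>. c * X \<omega> + d * X' \<omega>) \<in> l2_closure M V"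
  unfolding l2_closure_def
proof (intro CollectI conjI allI impI)
  have sq: "sq_integrable M X" "sq_integrable M X'" using X by (auto simp: l2_closure_def)
  then show "sq_integrable M (\<lambda>\<omega>. c * X \<omega> + d * X' \<omega>)"
    by (intro sq_integrable_add sq_integrable_cmult)
  fix e :: real assume e: "e > 0"
  \<comment> \<open>This makes \<open>2|c|\<^sup>2 s + 2|d|\<^sup>2 s = e - 2s\<close>.\<close>
  define s where "s = e / (2 * ((cmod c)\<^sup>2 + (cmod d)\<^sup>2 + 1))"
  have pos: "(cmod c)\<^sup>2 + (cmod d)\<^sup>2 + 1 > 0" by (simp add: add_nonneg_pos)
  then have s: "s > 0" using e by (simp add: s_def)
  obtain Y Y' where Y: "Y \<in> V" "l2sq M (\<lambda>\<omega>. X \<omega> - Y \<omega>) < s" "Y' \<in> V" "l2sq M (\<lambda>\<omega>. X' \<omega> - Y' \<omega>) < s"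
    using X s unfolding l2_closure_def by blast
  have "l2sq M (\<lambda>\<omega>. (c * X \<omega> + d * X' \<omega>) - (c * Y \<omega> + d * Y' \<omega>)) =
        l2sq M (\<lambda>\<omega>. c * (X \<omega> - Y \<omega>) + d * (X' \<omega> - Y' \<omega>))"
    by (simp add: algebra_simps)
  also have "\<dots> \<le> 2 * l2sq M (\<lambda>\<omega>. c * (X \<omega> - Y \<omega>)) + 2 * l2sq M (\<lambda>\<omega>. d * (X' \<omega> - Y' \<omega>))"
    by (intro l2sq_add_le sq_integrable_cmult sq_integrable_diff sq V Y)
  also have "\<dots> = 2 * ((cmod c)\<^sup>2 * l2sq M (\<lambda>\<omega>. X \<omega> - Y \<omega>)) + 2 * ((cmod d)\<^sup>2 * l2sq M (\<lambda>\<omega>. X' \<omega> - Y' \<omega>))"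
    by (simp add: l2sq_cmult)
  also have "\<dots> \<le> 2 * ((cmod c)\<^sup>2 * s) + 2 * ((cmod d)\<^sup>2 * s)"
    using Y by (intro add_mono mult_left_mono) auto
  also have "\<dots> = e - 2 * s"
  proof -
    have "e = 2 * s * ((cmod c)\<^sup>2 + (cmod d)\<^sup>2 + 1)" using pos unfolding s_def by (metis (no_types, lifting) less_irrefl mult.commute mult_pos_pos nonzero_eq_divide_eq times_divide_eq_right zero_less_numeral mult.assoc)
    then show ?thesis by (simp only:) (simp add: algebra_simps)
  qed
  also have "\<dots> < e" using s by simp
  finally show "\<exists>Z\<in>V. l2sq M (\<lambda>\<omega>. (c * X \<omega> + d * X' \<omega>) - Z \<omega>) < e"
    using lin[OF Y(1,3), of c d] by (intro bexI[of _ "\<lambda>\<omega>. c * Y \<omega> + d * Y' \<omega>"])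
qed

lemma l2_closure_orthogonal:
  assumes "sq_integrable M U" "\<And>Y. Y \<in> V \<Longrightarrow> sq_integrable M Y" "\<And>Y. Y \<in> V \<Longrightarrow> l2ip M U Y = 0"
    and X: "X \<in> l2_closure M V"
  shows "l2ip M U X = 0"
proof (rule ccontr)
  assume nz: "l2ip M U X \<noteq> 0"
  define e where "e = (cmod (l2ip M U X))\<^sup>2 / (l2sq M U + 1)"
  have pos: "l2sq M U + 1 > 0" using l2sq_nonneg[of M U] by linarith
  then have "e > 0" using nz by (simp add: e_def)
  then obtain Y where Y: "Y \<in> V" "l2sq M (\<lambda>\<omega>. X \<omega> - Y \<omega>) < e"
    using X by (auto simp: l2_closure_def)
  have X': "sq_integrable M X" using X by (simp add: l2_closure_def)
  have "l2ip M U X = l2ip M U (\<lambda>\<omega>. X \<omega> - Y \<omega>)"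
    using assms Y X' by (simp add: l2ip_diff_right)
  then have "(cmod (l2ip M U X))\<^sup>2 \<le> l2sq M U * l2sq M (\<lambda>\<omega>. X \<omega> - Y \<omega>)"
    using l2ip_Cauchy_Schwarz[OF assms(1) sq_integrable_diff[OF X' assms(2)[OF Y(1)]]] by simp
  also have "\<dots> \<le> l2sq M U * e" using Y by (intro mult_left_mono) auto
  also have "\<dots> < (l2sq M U + 1) * e" using \<open>e > 0\<close> by simp
  also have "\<dots> = (cmod (l2ip M U X))\<^sup>2" using pos by (simp add: e_def)
  finally show False by simp
qed

text \<open>
  Best approximations exist: by the parallelogram law a minimizing sequence is Cauchy, because the
  midpoint of two of its members is no better than the infimum.
\<close>

lemma l2_closure_minimizer:
  assumes V: "\<And>Y. Y \<in> V \<Longrightarrow> sq_integrable M Y"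
    and lin: "\<And>Y Z c d. Y \<in> V \<Longrightarrow> Z \<in> V \<Longrightarrow> (\<lambda>\<omega>. c * Y \<omega> + d * Z \<omega>) \<in> V"
    and "V \<noteq> {}" and U: "sq_integrable M U"
  obtains X where "X \<in> l2_closure M V"
    "\<And>Y. Y \<in> l2_closure M V \<Longrightarrow> l2sq M (\<lambda>\<omega>. U \<omega> - X \<omega>) \<le> l2sq M (\<lambda>\<omega>. U \<omega> - Y \<omega>)"
proof -
  let ?C = "l2_closure M V"
  define d where "d = (INF Y\<in>?C. l2sq M (\<lambda>\<omega>. U \<omega> - Y \<omega>))"
  have sub: "V \<subseteq> ?C" using V by (force simp: l2_closure_def l2sq_def)
  then have ne: "?C \<noteq> {}" using \<open>V \<noteq> {}\<close> by auto
  have bdd: "bdd_below ((\<lambda>Y. l2sq M (\<lambda>\<omega>. U \<omega> - Y \<omega>)) ` ?C)"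
    by (rule bdd_belowI[of _ 0]) auto
  have d_le: "d \<le> l2sq M (\<lambda>\<omega>. U \<omega> - Y \<omega>)" if "Y \<in> ?C" for Y
    unfolding d_def by (intro cINF_lower bdd that)
  have "\<exists>Y\<in>?C. l2sq M (\<lambda>\<omega>. U \<omega> - Y \<omega>) < d + 1 / Suc k" for k
    using cINF_less_iff[OF ne bdd, of "d + 1 / Suc k"] by (simp add: d_def)
  then obtain X where X: "\<And>k. X k \<in> ?C" "\<And>k. l2sq M (\<lambda>\<omega>. U \<omega> - X k \<omega>) < d + 1 / Suc k"
    by metis
  have sqX: "sq_integrable M (X k)" for k using X(1)[of k] by (simp add: l2_closure_def)
  have close: "l2sq M (\<lambda>\<omega>. X j \<omega> - X k \<omega>) \<le> 2 / Suc j + 2 / Suc k" for j k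
  proof -
    define A B where "A \<omega> = U \<omega> - X k \<omega>" and "B \<omega> = U \<omega> - X j \<omega>" for \<omega>
    have sq: "sq_integrable M A" "sq_integrable M B"
      unfolding A_def B_def by (intro sq_integrable_diff U sqX)+
    have "(\<lambda>\<omega>. (1/2) * X j \<omega> + (1/2) * X k \<omega>) \<in> ?C"
      by (rule l2_closure_combine[OF V lin X(1) X(1)])
    from d_le[OF this] have "4 * d \<le> 4 * l2sq M (\<lambda>\<omega>. U \<omega> - ((1/2) * X j \<omega> + (1/2) * X k \<omega>))" by simp
    also have "\<dots> = l2sq M (\<lambda>\<omega>. 2 * (U \<omega> - ((1/2) * X j \<omega> + (1/2) * X k \<omega>)))"
      by (subst l2sq_cmult) simp
    also have "\<dots> = l2sq M (\<lambda>\<omega>. A \<omega> + B \<omega>)" by (simp add: A_def B_def algebra_simps)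
    finally have "4 * d \<le> l2sq M (\<lambda>\<omega>. A \<omega> + B \<omega>)" .
    moreover have "l2sq M (\<lambda>\<omega>. A \<omega> + B \<omega>) + l2sq M (\<lambda>\<omega>. A \<omega> - B \<omega>) = 2 * l2sq M A + 2 * l2sq M B"
      by (rule parallelogram[OF sq])
    moreover have "l2sq M A < d + 1 / Suc k" "l2sq M B < d + 1 / Suc j"
      unfolding A_def B_def by (rule X)+
    moreover have "l2sq M (\<lambda>\<omega>. A \<omega> - B \<omega>) = l2sq M (\<lambda>\<omega>. X j \<omega> - X k \<omega>)"
      by (simp add: A_def B_def)
    moreover have "2 / real (Suc j) = 2 * (1 / real (Suc j))" "2 / real (Suc k) = 2 * (1 / real (Suc k))" by simp_all
    ultimately show ?thesis by linarith
  qed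
  have cauchy: "\<exists>N. \<forall>j\<ge>N. \<forall>k\<ge>N. l2sq M (\<lambda>\<omega>. X j \<omega> - X k \<omega>) < e" if "e > 0" for e
  proof -
    obtain N where N: "inverse (of_nat (Suc N)) < e / 4"
      using reals_Archimedean[of "e/4"] \<open>e > 0\<close> by auto
    have "l2sq M (\<lambda>\<omega>. X j \<omega> - X k \<omega>) < e" if "j \<ge> N" "k \<ge> N" for j k
    proof -
      have le: "1 / real (Suc i) \<le> inverse (of_nat (Suc N))" if "i \<ge> N" for i
        using that by (simp add: field_simps)
      have "2 / Suc j + 2 / Suc k = 2 * (1 / real (Suc j)) + 2 * (1 / real (Suc k))" by simp
      also have "\<dots> < e" using N le[OF that(1)] le[OF that(2)] by linarith
      finally show ?thesis using close[of j k] by linarith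
    qed
    then show "\<exists>N. \<forall>j\<ge>N. \<forall>k\<ge>N. l2sq M (\<lambda>\<omega>. X j \<omega> - X k \<omega>) < e" by blast
  qed
  obtain X' where X': "sq_integrable M X'" "(\<lambda>k. l2sq M (\<lambda>\<omega>. X k \<omega> - X' \<omega>)) \<longlonglongrightarrow> 0"
    using l2sq_complete[where M=M and X=X, OF sqX cauchy] by blast
  have mem: "X' \<in> ?C" by (rule l2_closure_limit[OF V X(1) X'])
  have min: "l2sq M (\<lambda>\<omega>. U \<omega> - X' \<omega>) \<le> l2sq M (\<lambda>\<omega>. U \<omega> - Y \<omega>)" if "Y \<in> ?C" for Y
  proof -
    have "(\<lambda>k. l2sq M (\<lambda>\<omega>. U \<omega> - X k \<omega>)) \<longlonglongrightarrow> l2sq M (\<lambda>\<omega>. U \<omega> - X' \<omega>)"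
    proof (rule l2sq_tendsto)
      show "(\<lambda>k. l2sq M (\<lambda>\<omega>. U \<omega> - X k \<omega> - (U \<omega> - X' \<omega>))) \<longlonglongrightarrow> 0"
        using X'(2) by (simp add: l2sq_minus_commute[of M X'])
    qed (intro sq_integrable_diff U sqX X')+
    moreover have "(\<lambda>k. d + 1 / Suc k) \<longlonglongrightarrow> d + 0"
      using LIMSEQ_inverse_real_of_nat_add[of d] by (simp add: inverse_eq_divide)
    ultimately have "l2sq M (\<lambda>\<omega>. U \<omega> - X' \<omega>) \<le> d + 0"
      by (rule LIMSEQ_le) (use X(2) less_imp_le in blast)
    then show ?thesis using d_le[OF that] by simp
  qed
  show ?thesis using that[OF mem] min by blast
qed

section \<open>Absolutely convergent power series\<close>

definition l1 :: "(nat \<Rightarrow> complex) \<Rightarrow> bool" where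
  "l1 x \<longleftrightarrow> summable (\<lambda>k. cmod (x k))"

text \<open>
  The coefficients of a product of power series. Sequences with finite \<open>\<ell>\<^sub>1\<close> norm form an algebra
  under this product (the analytic part of the Wiener algebra), on which evaluation at each point
  of the closed disc is multiplicative.
\<close>

definition conv :: "(nat \<Rightarrow> complex) \<Rightarrow> (nat \<Rightarrow> complex) \<Rightarrow> nat \<Rightarrow> complex" where
  "conv x y k = (\<Sum>i\<le>k. x i * y (k - i))"

lemma l1_term_le: "cmod z \<le> 1 \<Longrightarrow> cmod (x k * z ^ k) \<le> cmod (x k)"
  by (simp add: norm_mult norm_power mult_left_le power_le_one)

lemma l1_norm_summable:
  assumes "l1 x" "cmod z \<le> 1"
  shows "summable (\<lambda>k. norm (x k * z ^ k))"
  by (rule summable_comparison_test'[where N=0 and g="\<lambda>k. cmod (x k)"])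
     (use assms l1_term_le in \<open>auto simp: l1_def\<close>)

lemma l1_sums: "l1 x \<Longrightarrow> cmod z \<le> 1 \<Longrightarrow> (\<lambda>k. x k * z ^ k) sums powser x z"
  unfolding powser_def by (rule summable_sums, rule summable_norm_cancel, rule l1_norm_summable)

lemma l1_summable_mult: "l1 x \<Longrightarrow> (\<And>k. cmod (y k) \<le> C) \<Longrightarrow> summable (\<lambda>k. x k * y k)"
  by (rule summable_norm_cancel, rule summable_comparison_test'[where N=0 and g="\<lambda>k. cmod (x k) * C"])
     (auto simp: l1_def norm_mult mult_left_mono intro: summable_mult2)

lemma powser_bound:
  assumes "l1 x" "cmod z \<le> 1"
  shows "cmod (powser x z) \<le> (\<Sum>k. cmod (x k))"
  unfolding powser_def
  by (rule order_trans[OF summable_norm[OF l1_norm_summable[OF assms]]])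
     (intro suminf_le l1_norm_summable assms l1_term_le, use assms in \<open>simp_all add: l1_def\<close>)

lemma powser_truncation:
  assumes "l1 x" "cmod z \<le> 1"
  shows "cmod (powser x z - (\<Sum>k<N. x k * z ^ k)) \<le> (\<Sum>k. cmod (x (k + N)))"
proof -
  have "powser x z - (\<Sum>k<N. x k * z ^ k) = (\<Sum>k. x (k + N) * z ^ (k + N))"
    unfolding powser_def
    by (subst suminf_minus_initial_segment) (use l1_norm_summable[OF assms] summable_norm_cancel in auto)
  also have "cmod \<dots> \<le> (\<Sum>k. norm (x (k + N) * z ^ (k + N)))"
    using l1_norm_summable[OF assms]
    by (intro summable_norm) (subst summable_iff_shift[where f="\<lambda>k. norm (x k * z ^ k)"], simp)
  also have "\<dots> \<le> (\<Sum>k. cmod (x (k + N)))"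
    using l1_norm_summable[OF assms] assms(1) unfolding l1_def
    by (intro suminf_le l1_term_le assms) (subst summable_iff_shift[where f="\<lambda>k. norm (x k * z ^ k)"]
        summable_iff_shift[where f="\<lambda>k. cmod (x k)"], simp)+
  finally show ?thesis .
qed

lemma l1_tail_tendsto:
  assumes "l1 x" shows "(\<lambda>N. \<Sum>k. cmod (x (k + N))) \<longlonglongrightarrow> 0"
  using suminf_exist_split2[of "\<lambda>k. cmod (x k)"] assms by (simp add: l1_def)

lemma powser_continuous: "l1 x \<Longrightarrow> continuous_on (cball 0 1) (powser x)"
proof (rule uniform_limit_theorem[OF _ _ trivial_limit_sequentially])
  assume x: "l1 x"
  show "\<forall>\<^sub>F N in sequentially. continuous_on (cball 0 1) (\<lambda>z. \<Sum>k<N. x k * z ^ k)"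
    by (intro always_eventually allI continuous_intros)
  show "uniform_limit (cball 0 1) (\<lambda>N z. \<Sum>k<N. x k * z ^ k) (powser x) sequentially"
    unfolding powser_def
    by (rule Weierstrass_m_test[where M="\<lambda>k. cmod (x k)"])
       (use x l1_term_le in \<open>auto simp: l1_def\<close>)
qed

lemma powser_cis_continuous:
  assumes "l1 x" "continuous_on S g"
  shows "continuous_on S (\<lambda>t. powser x (cis (g t)))"
  by (rule continuous_on_compose2[OF powser_continuous[OF assms(1)]])
     (use assms(2) in \<open>auto intro!: continuous_intros\<close>)

lemma powser_0: "powser x 0 = x 0"
  unfolding powser_def using powser_zero[of x] by simp

lemma l1_conv: "l1 x \<Longrightarrow> l1 y \<Longrightarrow> l1 (conv x y)"
  unfolding l1_def
proof (rule summable_comparison_test'[where N=0 and g="\<lambda>k. \<Sum>i\<le>k. cmod (x i) * cmod (y (k - i))"])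
  assume "summable (\<lambda>k. cmod (x k))" "summable (\<lambda>k. cmod (y k))"
  then show "summable (\<lambda>k. \<Sum>i\<le>k. cmod (x i) * cmod (y (k - i)))"
    using summable_Cauchy_product[of "\<lambda>k. cmod (x k)" "\<lambda>k. cmod (y k)"] by simp
  show "norm (cmod (conv x y k)) \<le> (\<Sum>i\<le>k. cmod (x i) * cmod (y (k - i)))" for k
    unfolding conv_def by (simp add: order_trans[OF norm_sum] norm_mult)
qed

lemma powser_conv:
  assumes "l1 x" "l1 y" "cmod z \<le> 1"
  shows "powser (conv x y) z = powser x z * powser y z"
proof -
  have "powser x z * powser y z = (\<Sum>k. \<Sum>i\<le>k. (x i * z ^ i) * (y (k - i) * z ^ (k - i)))"
    unfolding powser_def by (rule Cauchy_product) (intro l1_norm_summable assms)+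
  also have "(\<lambda>k. \<Sum>i\<le>k. (x i * z ^ i) * (y (k - i) * z ^ (k - i))) = (\<lambda>k. conv x y k * z ^ k)"
  proof
    fix k
    have "(x i * z ^ i) * (y (k - i) * z ^ (k - i)) = x i * y (k - i) * z ^ k" if "i \<le> k" for i
      using that power_add[of z i "k - i"] by (simp add: mult_ac)
    then show "(\<Sum>i\<le>k. (x i * z ^ i) * (y (k - i) * z ^ (k - i))) = conv x y k * z ^ k"
      unfolding conv_def sum_distrib_right by (intro sum.cong) auto
  qed
  finally show ?thesis by (simp add: powser_def)
qed

lemma l1_finite: "(\<And>k. k \<ge> N \<Longrightarrow> x k = 0) \<Longrightarrow> l1 x"
  unfolding l1_def by (rule summable_finite[of "{..<N}"]) (auto simp: not_less)

lemma powser_finite: "(\<And>k. k \<ge> N \<Longrightarrow> x k = 0) \<Longrightarrow> powser x z = (\<Sum>k<N. x k * z ^ k)"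
  unfolding powser_def by (rule suminf_finite) (auto simp: not_less)

definition l1_unit :: "nat \<Rightarrow> complex" where "l1_unit k = (if k = 0 then 1 else 0)"

lemma l1_unit: "l1 l1_unit" "powser l1_unit z = 1"
proof -
  have z: "l1_unit k = 0" if "k \<ge> 1" for k using that by (simp add: l1_unit_def)
  show "l1 l1_unit" by (rule l1_finite[OF z])
  show "powser l1_unit z = 1" by (subst powser_finite[OF z]) (auto simp: l1_unit_def)
qed

fun conv_pow :: "(nat \<Rightarrow> complex) \<Rightarrow> nat \<Rightarrow> nat \<Rightarrow> complex" where
  "conv_pow x 0 = l1_unit"
| "conv_pow x (Suc m) = conv x (conv_pow x m)"

lemma l1_conv_pow: "l1 x \<Longrightarrow> l1 (conv_pow x m)"
  by (induction m) (auto simp: l1_unit l1_conv)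

lemma powser_conv_pow: "l1 x \<Longrightarrow> cmod z \<le> 1 \<Longrightarrow> powser (conv_pow x m) z = powser x z ^ m"
  by (induction m) (auto simp: l1_unit powser_conv l1_conv_pow)

lemma l1_norm_conv_pow:
  assumes "l1 x"
  shows "(\<Sum>k. cmod (conv_pow x m k)) \<le> (\<Sum>k. cmod (x k)) ^ m"
proof (induction m)
  case 0
  have "(\<Sum>k. cmod (l1_unit k)) = (\<Sum>k<1. cmod (l1_unit k))"
    by (rule suminf_finite) (auto simp: l1_unit_def not_less)
  then show ?case by (simp add: l1_unit_def)
next
  case (Suc m)
  have s: "summable (\<lambda>k. norm (cmod (x k)))" "summable (\<lambda>k. norm (cmod (conv_pow x m k)))"
    using assms l1_conv_pow[OF assms] by (auto simp: l1_def)
  have "(\<Sum>k. cmod (conv_pow x (Suc m) k)) \<le> (\<Sum>k. \<Sum>i\<le>k. cmod (x i) * cmod (conv_pow x m (k - i)))"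
  proof (rule suminf_le)
    show "cmod (conv_pow x (Suc m) k) \<le> (\<Sum>i\<le>k. cmod (x i) * cmod (conv_pow x m (k - i)))" for k
      unfolding conv_pow.simps conv_def by (rule order_trans[OF norm_sum]) (simp add: norm_mult)
    show "summable (\<lambda>k. cmod (conv_pow x (Suc m) k))" using l1_conv_pow[OF assms] unfolding l1_def .
    show "summable (\<lambda>k. \<Sum>i\<le>k. cmod (x i) * cmod (conv_pow x m (k - i)))"
      using summable_Cauchy_product[OF s] .
  qed
  also have "\<dots> = (\<Sum>k. cmod (x k)) * (\<Sum>k. cmod (conv_pow x m k))"
    using Cauchy_product[OF s] by simp
  also have "\<dots> \<le> (\<Sum>k. cmod (x k)) ^ Suc m"
    using Suc assms by (auto intro!: mult_left_mono suminf_nonneg simp: l1_def)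
  finally show ?case .
qed

text \<open>
  The exponential of an absolutely convergent series is absolutely convergent on the closed disc:
  the \<open>m\<close>-th power has \<open>\<ell>\<^sub>1\<close> norm at most the \<open>m\<close>-th power of the norm, so the double series over
  powers and coefficients is absolutely summable and may be summed in either order.
\<close>

lemma l1_exp:
  assumes x: "l1 x"
  obtains e where "l1 e" "\<And>z. cmod z \<le> 1 \<Longrightarrow> powser e z = exp (powser x z)"
proof -
  define S where "S = (\<Sum>k. cmod (x k))"
  define F where "F = (\<lambda>(m, k). conv_pow x m k / fact m)"
  have hs: "((\<lambda>k. cmod (conv_pow x m k / fact m)) has_sum (\<Sum>k. cmod (conv_pow x m k)) / fact m) UNIV" for m
    using l1_conv_pow[OF x, of m] unfolding l1_def
    by (intro sums_nonneg_imp_has_sum)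
       (auto simp: norm_divide intro!: sums_divide summable_sums)
  have F: "(\<lambda>p. norm (F p)) summable_on (UNIV \<times> UNIV)"
    unfolding F_def
  proof (subst Infinite_Sum.abs_summable_on_Sigma_iff, intro conjI ballI)
    fix m :: nat
    show "(\<lambda>k. norm (case (m, k) of (m, k) \<Rightarrow> conv_pow x m k / fact m)) summable_on UNIV"
      using hs[of m] by (auto simp: summable_on_def)
  next
    have eq: "(\<Sum>\<^sub>\<infinity>k. norm (case (m, k) of (m, k) \<Rightarrow> conv_pow x m k / fact m)) =
        (\<Sum>k. cmod (conv_pow x m k)) / fact m" for m
      using hs[of m] by (simp add: infsumI)
    have "summable (\<lambda>m. (\<Sum>k. cmod (conv_pow x m k)) / fact m)"
    proof (rule summable_comparison_test'[where N=0])
      show "summable (\<lambda>m. S ^ m / fact m)"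
        using summable_exp_generic[of S] by (simp add: field_simps)
      show "norm ((\<Sum>k. cmod (conv_pow x m k)) / fact m) \<le> S ^ m / fact m" for m
        using l1_norm_conv_pow[OF x, of m] l1_conv_pow[OF x, of m] unfolding S_def l1_def
        by (subst real_norm_def, subst abs_of_nonneg) (auto intro!: divide_right_mono suminf_nonneg divide_nonneg_pos)
    qed
    then have "(\<lambda>m. (\<Sum>k. cmod (conv_pow x m k)) / fact m) summable_on UNIV"
      using l1_conv_pow[OF x] unfolding l1_def
      by (intro summable_nonneg_imp_summable_on) (auto intro!: divide_nonneg_pos suminf_nonneg)
    moreover have "0 \<le> (\<Sum>k. cmod (conv_pow x m k)) / fact m" for m
      using l1_conv_pow[OF x, of m] unfolding l1_def by (auto intro!: divide_nonneg_pos suminf_nonneg)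
    ultimately show "(\<lambda>m. norm (\<Sum>\<^sub>\<infinity>k. norm (case (m, k) of (m, k) \<Rightarrow> conv_pow x m k / fact m))) summable_on UNIV"
      unfolding eq real_norm_def by (subst abs_of_nonneg)
  qed
  have F': "(\<lambda>p. norm (case p of (k, m) \<Rightarrow> F (m, k))) summable_on (UNIV \<times> UNIV)"
  proof -
    have "(\<lambda>y. norm (F (prod.swap y))) summable_on UNIV \<times> UNIV"
      by (subst summable_on_reindex_bij_betw[where A="UNIV \<times> UNIV" and g=prod.swap and B="UNIV\<times>UNIV"])
         (use F in \<open>auto intro!: bij_swap simp: UNIV_Times_UNIV\<close>)
    then show ?thesis by (simp add: prod.swap_def case_prod_unfold)
  qed
  define e where "e k = (\<Sum>\<^sub>\<infinity>m. F (m, k))" for k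
  have colsum: "(\<lambda>m. norm (F (m, k))) summable_on UNIV" for k
    using F' by (subst (asm) Infinite_Sum.abs_summable_on_Sigma_iff) auto
  have e_abs: "(\<lambda>k. norm (e k)) summable_on UNIV"
  proof (rule summable_on_comparison_test)
    have "(\<lambda>k. norm (\<Sum>\<^sub>\<infinity>m. norm (F (m, k)))) summable_on UNIV"
      using F' by (subst (asm) Infinite_Sum.abs_summable_on_Sigma_iff) simp
    then show "(\<lambda>k. \<Sum>\<^sub>\<infinity>m. norm (F (m, k))) summable_on UNIV"
      by (rule abs_summable_summable)
    show "norm (e k) \<le> (\<Sum>\<^sub>\<infinity>m. norm (F (m, k)))" if "k \<in> UNIV" for k
      unfolding e_def by (rule norm_infsum_bound[OF colsum])
  qed auto
  have "l1 e" unfolding l1_def using e_abs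
    by (meson summable_on_UNIV_nonneg_real_iff norm_ge_zero)
  moreover have "powser e z = exp (powser x z)" if z: "cmod z \<le> 1" for z
  proof -
    define G where "G = (\<lambda>(m, k). F (m, k) * z ^ k)"
    have G: "(\<lambda>p. norm (G p)) summable_on (UNIV \<times> UNIV)"
      unfolding G_def
      by (rule summable_on_comparison_test[OF F])
         (auto simp: norm_mult norm_power intro!: mult_left_le power_le_one z)
    then have G': "G summable_on (UNIV \<times> UNIV)" by (rule abs_summable_summable)
    have "powser e z = (\<Sum>\<^sub>\<infinity>k. e k * z ^ k)"
    proof -
      have "((\<lambda>k. e k * z ^ k) has_sum powser e z) UNIV"
        by (rule norm_summable_imp_has_sum[OF l1_norm_summable[OF \<open>l1 e\<close> z] l1_sums[OF \<open>l1 e\<close> z]])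
      then show ?thesis by (simp add: infsumI)
    qed
    also have "\<dots> = (\<Sum>\<^sub>\<infinity>k. \<Sum>\<^sub>\<infinity>m. G (m, k))"
      unfolding e_def G_def
      by (intro infsum_cong) (simp only: prod.case infsum_cmult_left')
    also have "\<dots> = (\<Sum>\<^sub>\<infinity>m. \<Sum>\<^sub>\<infinity>k. G (m, k))"
      using infsum_swap_banach[of "\<lambda>m k. G (m, k)" UNIV UNIV] G' by simp
    also have "\<dots> = (\<Sum>\<^sub>\<infinity>m. powser x z ^ m / fact m)"
    proof (intro infsum_cong)
      fix m
      have "((\<lambda>k. conv_pow x m k * z ^ k) has_sum powser (conv_pow x m) z) UNIV"
        by (rule norm_summable_imp_has_sum[OF l1_norm_summable l1_sums]) (simp_all add: l1_conv_pow x z)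
      then have "((\<lambda>k. conv_pow x m k * z ^ k / fact m) has_sum powser (conv_pow x m) z / fact m) UNIV"
        using has_sum_cmult_left[of _ _ _ "inverse (fact m)"] unfolding divide_inverse by blast
      then have "(\<Sum>\<^sub>\<infinity>k. conv_pow x m k * z ^ k / fact m) = powser (conv_pow x m) z / fact m"
        by (rule infsumI)
      then show "(\<Sum>\<^sub>\<infinity>k. G (m, k)) = powser x z ^ m / fact m"
        by (simp add: G_def F_def powser_conv_pow[OF x z])
    qed
    also have "\<dots> = exp (powser x z)"
    proof (rule infsumI, rule norm_summable_imp_has_sum)
      show "summable (\<lambda>m. norm (powser x z ^ m / fact m))"
        using summable_norm_exp[of "powser x z"] by (simp add: field_simps scaleR_conv_of_real)
      show "(\<lambda>m. powser x z ^ m / fact m) sums exp (powser x z)"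
        using exp_converges[of "powser x z"] by (simp add: field_simps scaleR_conv_of_real)
    qed
    finally show ?thesis .
  qed
  ultimately show ?thesis by (rule that)
qed

text \<open>
  The reciprocals used below come from this lemma and from \<open>l1_holomorphic\<close>.
\<close>

lemma l1_geometric:
  assumes "cmod c < 1" "m > 0"
  obtains x where "l1 x" "\<And>z. cmod z \<le> 1 \<Longrightarrow> powser x z = inverse (1 - c * z ^ m)"
proof -
  define x where "x k = (if m dvd k then c ^ (k div m) else 0)" for k
  have inj: "inj (\<lambda>k. m * k)" using assms(2) by (auto simp: inj_on_def)
  have mono: "strict_mono (\<lambda>k. m * k)" using assms(2) by (auto simp: strict_mono_def)
  have zero: "n \<notin> range (\<lambda>k. m * k) \<Longrightarrow> x n = 0" for n by (auto simp: x_def elim!: dvdE)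
  have "summable (\<lambda>k. cmod (x (m * k)))"
    using assms by (simp add: x_def norm_power summable_geometric)
  then have "summable (\<lambda>k. cmod (x k))"
    by (subst (asm) summable_mono_reindex[OF mono]) (auto simp: zero)
  then have l1: "l1 x" by (simp add: l1_def)
  have "powser x z = inverse (1 - c * z ^ m)" if z: "cmod z \<le> 1" for z
  proof -
    have lt: "cmod (c * z ^ m) < 1"
      using assms z by (simp add: norm_mult norm_power)
         (meson mult_left_le norm_ge_zero order_le_less_trans power_le_one)
    have "powser x z = (\<Sum>k. x (m * k) * z ^ (m * k))"
      unfolding powser_def by (rule suminf_mono_reindex[OF mono, symmetric]) (auto simp: zero)
    also have "\<dots> = (\<Sum>k. (c * z ^ m) ^ k)"
      using assms(2) by (simp add: x_def power_mult_distrib power_mult)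
    also have "\<dots> = inverse (1 - c * z ^ m)"
      using suminf_geometric[OF lt] by (simp add: inverse_eq_divide)
    finally show ?thesis .
  qed
  with l1 show ?thesis by (rule that)
qed

lemma conv_radius_l1: "conv_radius x > 1 \<Longrightarrow> l1 x"
  unfolding l1_def
  using abs_summable_in_conv_radius[of 1 x] by (simp add: one_ereal_def)

lemma l1_holomorphic:
  assumes "f holomorphic_on ball 0 R" "R > 1"
  obtains x where "l1 x" "\<And>z. cmod z \<le> 1 \<Longrightarrow> powser x z = f z"
proof -
  define x where "x k = (deriv ^^ k) f 0 / fact k" for k
  have "(\<lambda>k. x k * (z - 0) ^ k) sums f z" if "cmod z < R" for z
    unfolding x_def by (rule holomorphic_power_series[OF assms(1)]) (use that in auto)
  then have s: "(\<lambda>k. x k * z ^ k) sums f z" if "cmod z < R" for z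
    using that by simp
  have n: "norm (complex_of_real ((1 + R) / 2)) = (1 + R) / 2"
    using assms(2) by (simp only: norm_of_real) simp
  have "conv_radius x \<ge> norm (complex_of_real ((1 + R) / 2))"
    by (rule conv_radius_geI, rule sums_summable, rule s) (subst n, use assms(2) in simp)
  moreover have "1 < ereal (norm (complex_of_real ((1 + R) / 2)))"
    using assms(2) unfolding n by (simp add: one_ereal_def)
  ultimately have "l1 x" by (intro conv_radius_l1) (rule less_le_trans)
  moreover have "powser x z = f z" if "cmod z \<le> 1" for z
    using s[of z] that assms(2) by (simp add: powser_def sums_iff)
  ultimately show ?thesis by (rule that)
qed

section \<open>Integrals over the circle\<close>

lemma circ_integrable_continuous:
  "continuous_on {-pi..pi} g \<Longrightarrow> integrable circ (g :: real \<Rightarrow> 'a::euclidean_space)"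
  using absolutely_integrable_continuous_real[of "-pi" pi g]
  by (simp add: set_integrable_def integrable_restrict_space[symmetric] absolutely_integrable_on_def)

lemma integral_cis:
  "(LINT t|circ. cis (real_of_int j * t)) = (if j = 0 then complex_of_real (2 * pi) else 0)"
proof (cases "j = 0")
  case True
  then show ?thesis by (simp add: measure_restrict_space scaleR_conv_of_real)
next
  case False
  have "((\<lambda>t. cis (real_of_int j * t)) has_integral
      (cis (real_of_int j * pi) / (\<i> * j) - cis (real_of_int j * (-pi)) / (\<i> * j))) {-pi..pi}"
  proof (rule fundamental_theorem_of_calculus)
    fix t assume "t \<in> {-pi..pi}"
    show "((\<lambda>t. cis (real_of_int j * t) / (\<i> * j)) has_vector_derivative cis (real_of_int j * t))
        (at t within {-pi..pi})"
    proof -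
      have "((\<lambda>z. exp (\<i> * (of_int j * z)) / (\<i> * j)) has_field_derivative
          exp (\<i> * (of_int j * of_real t))) (at (of_real t))"
        using False by (auto intro!: derivative_eq_intros simp: mult.left_commute[of _ \<i>] mult.commute[of _ \<i>])
      then show ?thesis
        using has_vector_derivative_real_field[of "\<lambda>z. exp (\<i> * (of_int j * z)) / (\<i> * j)" _ t]
        by (simp add: cis_conv_exp)
    qed
  qed auto
  moreover have "cis (real_of_int j * pi) = cis (real_of_int j * (-pi))"
  proof -
    have "cis (real_of_int j * pi) = cis (real_of_int j * (-pi)) * cis (2 * pi * real_of_int j)"
      by (simp add: cis_mult algebra_simps)
    then show ?thesis by simp
  qed
  ultimately have "((\<lambda>t. cis (real_of_int j * t)) has_integral 0) {-pi..pi}" by simp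
  moreover have "(LINT t|circ. cis (real_of_int j * t)) = integral {-pi..pi} (\<lambda>t. cis (real_of_int j * t))"
    by (intro lebesgue_integral_eq_integral circ_integrable_continuous continuous_intros) auto
  ultimately show ?thesis using False by (simp add: integral_unique)
qed

lemma integral_series:
  assumes x: "l1 x" and g: "continuous_on {-pi..pi} g" and h: "continuous_on {-pi..pi} h"
  shows "(\<lambda>k. x k * (LINT t|circ. cis (h t) ^ k * g t)) sums (LINT t|circ. powser x (cis (h t)) * g t)"
proof -
  have int: "integrable circ (\<lambda>t. x k * cis (h t) ^ k * g t)" for k
    by (intro circ_integrable_continuous continuous_intros g h)
  have "(\<lambda>k. LINT t|circ. x k * cis (h t) ^ k * g t) sums (LINT t|circ. (\<Sum>k. x k * cis (h t) ^ k * g t))"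
  proof (rule sums_integral[OF int])
    show "AE t in circ. summable (\<lambda>k. norm (x k * cis (h t) ^ k * g t))"
      using x by (auto simp: norm_mult norm_power l1_def intro!: summable_mult2)
    show "summable (\<lambda>k. LINT t|circ. norm (x k * cis (h t) ^ k * g t))"
    proof (rule summable_comparison_test'[where N=0])
      show "summable (\<lambda>k. cmod (x k) * (LINT t|circ. norm (g t)))"
        using x by (auto simp: l1_def intro: summable_mult2)
      show "norm (LINT t|circ. norm (x k * cis (h t) ^ k * g t)) \<le> cmod (x k) * (LINT t|circ. norm (g t))" for k
        by (simp add: norm_mult norm_power abs_mult)
    qed
  qed
  also have "(LINT t|circ. (\<Sum>k. x k * cis (h t) ^ k * g t)) = (LINT t|circ. powser x (cis (h t)) * g t)"
    unfolding powser_def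
    using l1_norm_summable[OF x]
    by (intro Bochner_Integration.integral_cong refl)
       (simp add: suminf_mult2 summable_norm_cancel)
  finally show ?thesis by (simp add: mult.assoc)
qed

text \<open>
  Fourier coefficients of a boundary function; those of negative index vanish, which is what makes
  the prediction error orthogonal to the past.
\<close>

lemma fourier_coeff_powser:
  assumes x: "l1 x"
  shows "(LINT t|circ. cis (- (real_of_int j * t)) * powser x (cis t)) =
         (if j \<ge> 0 then complex_of_real (2 * pi) * x (nat j) else 0)"
proof -
  have "(\<lambda>k. x k * (LINT t|circ. cis t ^ k * cis (- (real_of_int j * t)))) sums
      (LINT t|circ. powser x (cis t) * cis (- (real_of_int j * t)))"
    by (rule integral_series[OF x]) (auto intro!: continuous_intros)
  moreover have "(LINT t|circ. cis t ^ k * cis (- (real_of_int j * t))) = (if int k = j then complex_of_real (2 * pi) else 0)" for k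
  proof -
    have "cis t ^ k * cis (- (real_of_int j * t)) = cis (real_of_int (int k - j) * t)" for t
      by (simp add: Complex.DeMoivre cis_mult left_diff_distrib)
    then show ?thesis by (simp only: integral_cis) auto
  qed
  ultimately have "(\<lambda>k. x k * (if int k = j then complex_of_real (2 * pi) else 0)) sums
      (LINT t|circ. powser x (cis t) * cis (- (real_of_int j * t)))" by simp
  moreover have "(\<lambda>k. x k * (if int k = j then complex_of_real (2 * pi) else 0)) =
      (\<lambda>k. if k = nat j then (if j \<ge> 0 then complex_of_real (2 * pi) * x (nat j) else 0) else 0)"
    by (auto simp: fun_eq_iff)
  ultimately show ?thesis
    using sums_unique2[OF _ sums_single[of "nat j" "\<lambda>_. if j \<ge> 0 then complex_of_real (2 * pi) * x (nat j) else 0"]]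
    by (simp add: mult.commute)
qed

lemma l1_cnj: "l1 x \<Longrightarrow> l1 (\<lambda>k. cnj (x k))"
  by (simp add: l1_def)

lemma powser_cnj:
  assumes "l1 x" "cmod z \<le> 1"
  shows "powser (\<lambda>k. cnj (x k)) (cnj z) = cnj (powser x z)"
proof -
  have "(\<lambda>k. cnj (x k * z ^ k)) sums cnj (powser x z)"
    using l1_sums[OF assms] by (simp only: sums_cnj)
  then show ?thesis by (simp add: powser_def sums_iff)
qed

lemma l1_imp_l2: "l1 x \<Longrightarrow> l2 x"
proof -
  assume x: "l1 x"
  then have "x \<longlonglongrightarrow> 0" unfolding l1_def by (rule summable_LIMSEQ_zero[OF summable_norm_cancel])
  then have "Bseq x" by (rule convergent_imp_Bseq[OF convergentI])
  then obtain K where K: "\<And>k. cmod (x k) \<le> K" by (auto simp: Bseq_def)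
  have "summable (\<lambda>k. cmod (x k) * K)" using x by (auto simp: l1_def intro: summable_mult2)
  then show "l2 x" unfolding l2_def
    by (rule summable_comparison_test'[where N=0])
       (use K in \<open>auto simp: power2_eq_square intro!: mult_left_mono\<close>)
qed

lemma parseval_l1:
  assumes x: "l1 x"
  shows "(LINT t|circ. (cmod (powser x (cis (- t))))\<^sup>2) = 2 * pi * (l2norm x)\<^sup>2"
proof -
  define y where "y = (\<lambda>k. cnj (x k))"
  have y: "l1 y" unfolding y_def by (rule l1_cnj[OF x])
  have "(\<lambda>k. x k * (LINT t|circ. cis (- t) ^ k * powser y (cis t))) sums
      (LINT t|circ. powser x (cis (- t)) * powser y (cis t))"
    by (rule integral_series[OF x]) (auto intro!: continuous_intros powser_cis_continuous y)
  moreover have "(LINT t|circ. cis (- t) ^ k * powser y (cis t)) = complex_of_real (2 * pi) * cnj (x k)" for k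
    using fourier_coeff_powser[OF y, of "int k"] by (simp add: Complex.DeMoivre y_def)
  moreover have "powser x (cis (- t)) * powser y (cis t) = complex_of_real ((cmod (powser x (cis (- t))))\<^sup>2)" for t
    using powser_cnj[OF x, of "cis (- t)"] by (simp only: complex_norm_square) (simp add: y_def cis_cnj)
  moreover have "x k * (complex_of_real (2 * pi) * cnj (x k)) = complex_of_real (2 * pi * (cmod (x k))\<^sup>2)" for k
    by (simp add: complex_norm_square[unfolded of_real_power] mult_ac)
  ultimately have "(\<lambda>k. complex_of_real (2 * pi * (cmod (x k))\<^sup>2)) sums
      complex_of_real (LINT t|circ. (cmod (powser x (cis (- t))))\<^sup>2)"
    by (simp only: integral_complex_of_real)
  then have "(\<lambda>k. 2 * pi * (cmod (x k))\<^sup>2) sums (LINT t|circ. (cmod (powser x (cis (- t))))\<^sup>2)"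
    by (simp only: sums_of_real_iff)
  then have "(LINT t|circ. (cmod (powser x (cis (- t))))\<^sup>2) = (\<Sum>k. 2 * pi * (cmod (x k))\<^sup>2)"
    by (simp add: sums_iff)
  also have "\<dots> = 2 * pi * (\<Sum>k. (cmod (x k))\<^sup>2)"
    using l1_imp_l2[OF x] by (intro suminf_mult) (simp add: l2_def)
  also have "\<dots> = 2 * pi * (l2norm x)\<^sup>2"
    unfolding l2norm_def using l1_imp_l2[OF x] by (simp add: l2_def suminf_nonneg)
  finally show ?thesis .
qed

section \<open>The logarithm of the cardinal sine\<close>

text \<open>
  \<open>|1 - exp(it)| = |t| exp(lnsinc t)\<close> on \<open>[-\<pi>,\<pi>]\<close>. The two functions after it are its first and second
  derivative, extended continuously to \<open>0\<close>.
\<close>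

definition lnsinc :: "real \<Rightarrow> real" where "lnsinc t = ln (sinc (t / 2))"

definition lnsinc' :: "real \<Rightarrow> real" where
  "lnsinc' t = (if t = 0 then 0 else cos (t / 2) / (2 * sin (t / 2)) - 1 / t)"

definition lnsinc'' :: "real \<Rightarrow> real" where
  "lnsinc'' t = (if t = 0 then - 1 / 12 else 1 / t\<^sup>2 - 1 / (4 * (sin (t / 2))\<^sup>2))"

lemma sin_half_nz:
  assumes "t \<in> {-pi..pi}" "t \<noteq> 0" shows "sin (t / 2) \<noteq> 0"
proof (cases "t > 0")
  case True
  then have "sin (t / 2) > 0" using assms by (intro sin_gt_zero) auto
  then show ?thesis by simp
next
  case False
  then have "sin (- t / 2) > 0" using assms by (intro sin_gt_zero) auto
  then show ?thesis by simp
qed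

lemma sinc_half_pos:
  assumes "t \<in> {-pi..pi}" shows "sinc (t / 2) > 0"
proof (cases "t > 0")
  case True
  then have "sin (t / 2) > 0" using assms by (intro sin_gt_zero) auto
  then show ?thesis using True by simp
next
  case False
  show ?thesis
  proof (cases "t = 0")
    case False
    with \<open>\<not> t > 0\<close> have "sin (- t / 2) > 0" using assms by (intro sin_gt_zero) auto
    then show ?thesis using False \<open>\<not> t > 0\<close> by (simp add: divide_neg_neg)
  qed auto
qed

lemma continuous_lnsinc: "continuous_on {-pi..pi} lnsinc"
proof -
  have "sinc (t / 2) \<noteq> 0" if "t \<in> {-pi..pi}" for t using sinc_half_pos[OF that] by simp
  then show ?thesis unfolding lnsinc_def
    by (intro continuous_intros continuous_on_compose2[OF continuous_on_sinc[of UNIV "\<lambda>x. x"]])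
       (auto intro!: continuous_intros)
qed

lemma continuous_lnsinc': "continuous_on {-pi..pi} lnsinc'"
  unfolding continuous_on_eq_continuous_within
proof
  fix t :: real assume t: "t \<in> {-pi..pi}"
  show "continuous (at t within {-pi..pi}) lnsinc'"
  proof (cases "t = 0")
    case True
    have "((\<lambda>t::real. cos (t / 2) / (2 * sin (t / 2)) - 1 / t) \<longlongrightarrow> 0) (at 0)" by real_asymp
    then have "(lnsinc' \<longlongrightarrow> 0) (at 0)"
      by (rule Lim_transform_eventually) (auto simp: eventually_at_filter lnsinc'_def)
    then have "isCont lnsinc' 0" by (simp add: isCont_def lnsinc'_def)
    then show ?thesis using True by (simp add: continuous_at_imp_continuous_within)
  next
    case False
    have "isCont (\<lambda>t. cos (t / 2) / (2 * sin (t / 2)) - 1 / t) t"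
      using sin_half_nz[OF t False] False by (intro continuous_intros) auto
    moreover have "\<forall>\<^sub>F s in nhds t. lnsinc' s = cos (s / 2) / (2 * sin (s / 2)) - 1 / s"
      using t1_space_nhds[OF False] by eventually_elim (simp add: lnsinc'_def)
    ultimately have "isCont lnsinc' t" by (subst isCont_cong) auto
    then show ?thesis by (simp add: continuous_at_imp_continuous_within)
  qed
qed

text \<open>
  The expansion \<open>(2 sin(t/2))\<^sup>2 = t\<^sup>2 (1 - t\<^sup>2/12 + ...)\<close> explains the value \<open>-1/12\<close> at the origin.
\<close>

lemma continuous_lnsinc'': "continuous_on {-pi..pi} lnsinc''"
  unfolding continuous_on_eq_continuous_within
proof
  fix t :: real assume t: "t \<in> {-pi..pi}"
  show "continuous (at t within {-pi..pi}) lnsinc''"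
  proof (cases "t = 0")
    case True
    have "((\<lambda>t::real. (2 * sin (t / 2) - t) / t ^ 3 * ((2 * sin (t / 2) + t) / t) / (2 * sin (t / 2) / t)\<^sup>2)
        \<longlongrightarrow> - 1 / 12) (at 0)" by real_asymp
    moreover have "\<forall>\<^sub>F t in at (0::real). (2 * sin (t / 2) - t) / t ^ 3 * ((2 * sin (t / 2) + t) / t) / (2 * sin (t / 2) / t)\<^sup>2 =
        1 / t\<^sup>2 - 1 / (4 * (sin (t / 2))\<^sup>2)"
    proof -
      have "\<forall>\<^sub>F t in at (0::real). t \<in> {-pi<..<pi} - {0}"
        by (rule eventually_at_in_open) auto
      then show ?thesis
      proof eventually_elim
        case (elim t)
        then show ?case using sin_half_nz[of t]
          by (simp add: divide_simps) (simp add: algebra_simps power2_eq_square power3_eq_cube power4_eq_xxxx)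
      qed
    qed
    ultimately have "((\<lambda>t::real. 1 / t\<^sup>2 - 1 / (4 * (sin (t / 2))\<^sup>2)) \<longlongrightarrow> - 1 / 12) (at 0)"
      by (rule Lim_transform_eventually)
    then have "(lnsinc'' \<longlongrightarrow> - 1 / 12) (at 0)"
      by (rule Lim_transform_eventually) (auto simp: eventually_at_filter lnsinc''_def)
    then have "isCont lnsinc'' 0" by (simp add: isCont_def lnsinc''_def)
    then show ?thesis using True by (simp add: continuous_at_imp_continuous_within)
  next
    case False
    have "isCont (\<lambda>t. 1 / t\<^sup>2 - 1 / (4 * (sin (t / 2))\<^sup>2)) t"
      using sin_half_nz[OF t False] False by (intro continuous_intros) auto
    moreover have "\<forall>\<^sub>F s in nhds t. lnsinc'' s = 1 / s\<^sup>2 - 1 / (4 * (sin (s / 2))\<^sup>2)"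
      using t1_space_nhds[OF False] by eventually_elim (simp add: lnsinc''_def)
    ultimately have "isCont lnsinc'' t" by (subst isCont_cong) auto
    then show ?thesis by (simp add: continuous_at_imp_continuous_within)
  qed
qed

lemma DERIV_lnsinc:
  assumes "t \<in> {-pi..pi}" "t \<noteq> 0"
  shows "(lnsinc has_real_derivative lnsinc' t) (at t)"
proof -
  have "\<forall>\<^sub>F s in nhds t. lnsinc s = ln (sin (s / 2) / (s / 2))"
    using t1_space_nhds[OF assms(2)] by eventually_elim (simp add: lnsinc_def)
  moreover have "sin (t / 2) / (t / 2) > 0"
    using sinc_half_pos[OF assms(1)] assms(2) by simp
  then have "((\<lambda>s. ln (sin (s / 2) / (s / 2))) has_real_derivative lnsinc' t) (at t)"
    using assms(2) sin_half_nz[OF assms]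
    by (auto intro!: derivative_eq_intros simp: lnsinc'_def)
       (simp add: field_simps)
  ultimately show ?thesis by (subst DERIV_cong_ev) auto
qed

lemma DERIV_lnsinc':
  assumes "t \<in> {-pi..pi}" "t \<noteq> 0"
  shows "(lnsinc' has_real_derivative lnsinc'' t) (at t)"
proof -
  define s c where "s = sin (t / 2)" and "c = cos (t / 2)"
  have sc: "c\<^sup>2 = 1 - s\<^sup>2" by (simp add: s_def c_def cos_squared_eq)
  have "\<forall>\<^sub>F s in nhds t. lnsinc' s = cos (s / 2) / (2 * sin (s / 2)) - 1 / s"
    using t1_space_nhds[OF assms(2)] by eventually_elim (simp add: lnsinc'_def)
  moreover have "((\<lambda>s. cos (s / 2) / (2 * sin (s / 2)) - 1 / s) has_real_derivative
     (- s * (1/2) * (2 * s) - c * (2 * (c * (1/2)))) / (2 * s * (2 * s)) + 1 / t\<^sup>2) (at t)"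
    using assms(2) sin_half_nz[OF assms]
    by (auto intro!: derivative_eq_intros simp: s_def c_def power2_eq_square)
  moreover have "(- s * (1/2) * (2 * s) - c * (2 * (c * (1/2)))) / (2 * s * (2 * s)) + 1 / t\<^sup>2 = lnsinc'' t"
  proof -
    have "- s * (1/2) * (2 * s) - c * (2 * (c * (1/2))) = - 1"
      using sc by (simp add: power2_eq_square)
    then show ?thesis using assms(2) by (simp add: lnsinc''_def s_def power2_eq_square)
  qed
  ultimately show ?thesis by (subst DERIV_cong_ev) auto
qed

text \<open>
  Integration by parts against \<open>exp(-ijt)\<close>, with one exceptional point so that removable
  singularities at \<open>0\<close> do not need derivatives there. Since \<open>exp(ij\<pi>) = exp(-ij\<pi>)\<close> the boundary term
  is the jump of \<open>f\<close> from \<open>-\<pi>\<close> to \<open>\<pi>\<close>.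
\<close>

lemma by_parts_cis:
  fixes f f' :: "real \<Rightarrow> real"
  assumes f: "continuous_on {-pi..pi} f" and f': "continuous_on {-pi..pi} f'"
    and D: "\<And>t. t \<in> {-pi..pi} \<Longrightarrow> t \<noteq> 0 \<Longrightarrow> (f has_real_derivative f' t) (at t)"
  shows "\<i> * of_int j * (LINT t|circ. cis (- (real_of_int j * t)) * of_real (f t)) =
     (LINT t|circ. cis (- (real_of_int j * t)) * of_real (f' t)) - cis (real_of_int j * pi) * of_real (f pi - f (- pi))"
proof -
  define F where "F t = cis (- (real_of_int j * t)) * complex_of_real (f t)" for t
  define F' where "F' t = cis (- (real_of_int j * t)) * complex_of_real (f' t) -
      \<i> * of_int j * (cis (- (real_of_int j * t)) * complex_of_real (f t))" for t
  have cis': "((\<lambda>t. cis (- (real_of_int j * t))) has_vector_derivative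
        - \<i> * of_int j * cis (- (real_of_int j * t))) (at t)" for t
  proof -
    have "((\<lambda>z. exp (- (\<i> * (of_int j * z)))) has_field_derivative
        - \<i> * of_int j * exp (- (\<i> * (of_int j * of_real t)))) (at (of_real t))"
      by (auto intro!: derivative_eq_intros)
    from has_vector_derivative_real_field[OF this] show ?thesis
      by (simp add: cis_conv_exp)
  qed
  have "(F' has_integral (F pi - F (- pi))) {-pi..pi}"
  proof (rule fundamental_theorem_of_calculus_strong[of "{0}"])
    fix t :: real assume t: "t \<in> {-pi..pi} - {0}"
    have "((\<lambda>t. complex_of_real (f t)) has_vector_derivative of_real (f' t)) (at t)"
      using D[of t] t by (intro has_vector_derivative_of_real) (auto simp: has_real_derivative_iff_has_vector_derivative)
    from has_vector_derivative_mult[OF cis' this]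
    show "(F has_vector_derivative F' t) (at t)"
      unfolding F_def F'_def by (simp add: algebra_simps)
  qed (auto simp: F_def intro!: continuous_intros f)
  moreover have cF': "continuous_on {-pi..pi} F'"
    unfolding F'_def by (intro continuous_intros f f')
  ultimately have 1: "(LINT t|circ. F' t) = F pi - F (- pi)"
    using lebesgue_integral_eq_integral[of "{-pi..pi}" F'] circ_integrable_continuous[OF cF']
    by (simp add: integral_unique)
  have "integrable circ (\<lambda>t. cis (- (real_of_int j * t)) * complex_of_real (f t))"
    "integrable circ (\<lambda>t. cis (- (real_of_int j * t)) * complex_of_real (f' t))"
    by (intro circ_integrable_continuous continuous_intros f f')+
  then have 2: "(LINT t|circ. F' t) = (LINT t|circ. cis (- (real_of_int j * t)) * of_real (f' t)) -
      \<i> * of_int j * (LINT t|circ. cis (- (real_of_int j * t)) * of_real (f t))"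
    unfolding F'_def by (subst Bochner_Integration.integral_diff) auto
  have 3: "cis (- (real_of_int j * pi)) = cis (real_of_int j * pi)"
  proof -
    have "cis (real_of_int j * pi) = cis (- (real_of_int j * pi)) * cis (2 * pi * real_of_int j)"
      by (simp add: cis_mult algebra_simps)
    then show ?thesis by simp
  qed
  show ?thesis using 1 2 3 by (simp add: F_def algebra_simps)
qed

definition lnsinc_fourier :: "nat \<Rightarrow> complex" where
  "lnsinc_fourier k = (LINT t|circ. cis (- (real k * t)) * of_real (lnsinc t)) / (2 * pi)"

lemma norm_integral_le:
  fixes g :: "real \<Rightarrow> complex"
  assumes "continuous_on {-pi..pi} g" "\<And>t. t \<in> {-pi..pi} \<Longrightarrow> cmod (g t) \<le> B"
  shows "cmod (LINT t|circ. g t) \<le> 2 * pi * B"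
proof -
  have "cmod (LINT t|circ. g t) \<le> (LINT t|circ. cmod (g t))" by simp
  also have "\<dots> \<le> (LINT t|circ. B)"
    using assms by (intro integral_mono circ_integrable_continuous continuous_intros) auto
  also have "\<dots> = 2 * pi * B" by (simp add: measure_restrict_space)
  finally show ?thesis .
qed

lemma continuous_bounded:
  fixes f :: "real \<Rightarrow> real"
  assumes "continuous_on {-pi..pi} f"
  obtains B where "\<And>t. t \<in> {-pi..pi} \<Longrightarrow> \<bar>f t\<bar> \<le> B"
proof -
  have "bounded (f ` {-pi..pi})"
    by (intro compact_imp_bounded compact_continuous_image assms compact_Icc)
  then obtain B where "\<forall>x\<in>f ` {-pi..pi}. norm x \<le> B" unfolding bounded_iff by blast
  then show ?thesis using that[of B] by auto
qed

text \<open>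
  Two integrations by parts: the first boundary term vanishes as the function is even, the second
  one is bounded, so the coefficients are \<open>O(1/k\<^sup>2)\<close>.
\<close>

lemma l1_lnsinc_fourier: "l1 lnsinc_fourier"
proof -
  obtain B1 where B1: "\<And>t. t \<in> {-pi..pi} \<Longrightarrow> \<bar>lnsinc' t\<bar> \<le> B1"
    using continuous_bounded[OF continuous_lnsinc'] by blast
  obtain B2 where B2: "\<And>t. t \<in> {-pi..pi} \<Longrightarrow> \<bar>lnsinc'' t\<bar> \<le> B2"
    using continuous_bounded[OF continuous_lnsinc''] by blast
  define C where "C = 2 * pi * B2 + 2 * B1"
  have bd: "cmod (lnsinc_fourier k) \<le> C / (2 * pi) / real k ^ 2" if "k \<noteq> 0" for k
  proof -
    have even: "lnsinc pi - lnsinc (- pi) = 0" by (simp add: lnsinc_def)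
    define I0 I1 I2 where "I0 = (LINT t|circ. cis (- (real_of_int k * t)) * complex_of_real (lnsinc t))"
      and "I1 = (LINT t|circ. cis (- (real_of_int k * t)) * complex_of_real (lnsinc' t))"
      and "I2 = (LINT t|circ. cis (- (real_of_int k * t)) * complex_of_real (lnsinc'' t))"
    have "\<i> * of_int k * I0 = I1"
      unfolding I0_def I1_def
      by (subst by_parts_cis[OF continuous_lnsinc continuous_lnsinc' DERIV_lnsinc])
         (simp_all only: even of_real_0 mult_zero_right diff_zero not_False_eq_True)
    moreover have "\<i> * of_int k * I1 = I2 - cis (real_of_int k * pi) * of_real (lnsinc' pi - lnsinc' (- pi))"
      unfolding I1_def I2_def
      by (rule by_parts_cis[OF continuous_lnsinc' continuous_lnsinc'' DERIV_lnsinc'])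
    moreover have "cmod I2 \<le> 2 * pi * B2"
      unfolding I2_def using B2
      by (intro norm_integral_le continuous_intros continuous_lnsinc'') (simp add: norm_mult)
    moreover have "cmod (cis (real_of_int k * pi) * of_real (lnsinc' pi - lnsinc' (- pi))) \<le> 2 * B1"
      using B1[of pi] B1[of "-pi"] by (simp only: norm_mult norm_cis norm_of_real) simp
    ultimately have "cmod (\<i> * of_int k * (\<i> * of_int k * I0)) \<le> C"
      unfolding C_def by (smt (verit) norm_triangle_ineq4)
    then have "real k ^ 2 * cmod I0 \<le> C"
      by (simp add: norm_mult power2_eq_square)
    then have *: "cmod I0 \<le> C / real k ^ 2" using that by (simp add: field_simps)
    have "cmod (lnsinc_fourier k) = cmod I0 / (2 * pi)"
      by (simp add: lnsinc_fourier_def I0_def norm_divide norm_mult)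
    also have "\<dots> \<le> C / real k ^ 2 / (2 * pi)" by (intro divide_right_mono *) auto
    finally show ?thesis by (simp add: mult.commute)
  qed
  have "summable (\<lambda>k. C / (2 * pi) * inverse (real k ^ 2))"
    by (intro summable_mult inverse_power_summable) auto
  then show ?thesis unfolding l1_def
  proof (rule summable_comparison_test'[where N=1])
    fix k :: nat assume "k \<ge> 1"
    then show "norm (cmod (lnsinc_fourier k)) \<le> C / (2 * pi) * inverse (real k ^ 2)"
      using bd[of k] unfolding divide_inverse[of _ "real k ^ 2"] by simp
  qed
qed

section \<open>The Schwarz and Poisson kernels\<close>

definition schwarz :: "complex \<Rightarrow> real \<Rightarrow> complex" where
  "schwarz z t = (cis t + z) / (cis t - z)"

text \<open>
  The Schwarz kernel is the power series in \<open>exp(-it)\<close> with these coefficients. Integration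
  against the kernel thus turns Fourier coefficients into power series coefficients.
\<close>

definition schwarz_coeff :: "complex \<Rightarrow> nat \<Rightarrow> complex" where
  "schwarz_coeff z k = (if k = 0 then 1 else 2 * z ^ k)"

lemma l1_schwarz_coeff: "cmod z < 1 \<Longrightarrow> l1 (schwarz_coeff z)"
  unfolding l1_def
  by (rule summable_comparison_test'[where N=0 and g="\<lambda>k. 2 * cmod z ^ k"])
     (auto intro!: summable_mult summable_geometric simp: schwarz_coeff_def norm_mult norm_power)

lemma cis_minus_nz: "cmod z < 1 \<Longrightarrow> cis t - z \<noteq> 0"
  by (metis eq_iff_diff_eq_0 norm_cis less_irrefl)

lemma schwarz_series:
  assumes z: "cmod z < 1"
  shows "powser (schwarz_coeff z) (cis (- t)) = schwarz z t"
proof -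
  define w where "w = cis (- t)"
  have w: "w * cis t = 1" by (simp add: w_def cis_mult)
  have lt: "cmod (z * w) < 1" using z by (simp add: norm_mult w_def)
  have nz: "1 - z * w \<noteq> 0" using lt by (metis eq_iff_diff_eq_0 norm_one less_irrefl)
  have "(\<lambda>k. 2 * (z * w) ^ k - (if k = 0 then 1 else 0)) sums (2 * (1 / (1 - z * w)) - 1)"
    by (intro sums_diff sums_mult geometric_sums[OF lt] sums_single[of 0 "\<lambda>_. 1::complex"])
  moreover have "2 * (z * w) ^ k - (if k = 0 then 1 else 0) = schwarz_coeff z k * w ^ k" for k
    by (simp add: schwarz_coeff_def power_mult_distrib)
  ultimately have "powser (schwarz_coeff z) w = 2 * (1 / (1 - z * w)) - 1"
    by (simp add: powser_def sums_iff)
  also have "\<dots> = (1 + z * w) / (1 - z * w)" using nz by (simp add: field_simps)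
  also have "\<dots> = ((1 + z * w) * cis t) / ((1 - z * w) * cis t)" by simp
  also have "(1 + z * w) * cis t = cis t + z" using w by (simp add: algebra_simps)
  also have "(1 - z * w) * cis t = cis t - z" using w by (simp add: algebra_simps)
  finally show ?thesis by (simp add: w_def schwarz_def)
qed

lemma continuous_schwarz: "cmod z < 1 \<Longrightarrow> continuous_on {-pi..pi} (schwarz z)"
  unfolding schwarz_def using cis_minus_nz by (intro continuous_intros) auto

lemma integral_schwarz_series:
  assumes z: "cmod z < 1" and g: "continuous_on {-pi..pi} g"
  shows "(\<lambda>k. schwarz_coeff z k * (LINT t|circ. cis (- (real k * t)) * g t)) sums (LINT t|circ. schwarz z t * g t)"
  using integral_series[OF l1_schwarz_coeff[OF z] g, of "\<lambda>t. - t"]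
  by (simp add: Complex.DeMoivre schwarz_series[OF z] continuous_intros)

lemma integral_schwarz: "cmod z < 1 \<Longrightarrow> (LINT t|circ. schwarz z t) = 2 * pi"
proof -
  assume z: "cmod z < 1"
  have "(LINT t|circ. cis (- (real k * t))) = (if k = 0 then complex_of_real (2 * pi) else 0)" for k
    using integral_cis[of "- int k"] by simp
  then have "(\<lambda>k. schwarz_coeff z k * (if k = 0 then complex_of_real (2 * pi) else 0)) sums (LINT t|circ. schwarz z t)"
    using integral_schwarz_series[OF z, of "\<lambda>_. 1"] by simp
  moreover have "(\<lambda>k. schwarz_coeff z k * (if k = 0 then complex_of_real (2 * pi) else 0)) =
      (\<lambda>k. if k = 0 then complex_of_real (2 * pi) else 0)"
    by (auto simp: schwarz_coeff_def)
  ultimately show ?thesis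
    using sums_unique2[OF _ sums_single[of 0 "\<lambda>_. complex_of_real (2 * pi)"]] by simp
qed

text \<open>
  The real part is the Poisson kernel.
\<close>

lemma Re_schwarz: "cmod z < 1 \<Longrightarrow> Re (schwarz z t) = (1 - (cmod z)\<^sup>2) / (cmod (cis t - z))\<^sup>2"
proof -
  have "Re (schwarz z t) =
      (Re (cis t + z) * Re (cis t - z) + Im (cis t + z) * Im (cis t - z)) / (cmod (cis t - z))\<^sup>2"
    unfolding schwarz_def Re_divide' ..
  also have "Re (cis t + z) * Re (cis t - z) + Im (cis t + z) * Im (cis t - z) = (cmod (cis t))\<^sup>2 - (cmod z)\<^sup>2"
    unfolding cmod_power2 by (simp add: power2_eq_square algebra_simps)
  finally show ?thesis by simp
qed

text \<open>
  The power series whose real part is the harmonic extension of \<open>lnsinc\<close>: nonconstant modes are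
  doubled because \<open>lnsinc\<close> contributes its coefficients of index \<open>k\<close> and \<open>-k\<close>.
\<close>

definition lnsinc_outer :: "nat \<Rightarrow> complex" where
  "lnsinc_outer k = (if k = 0 then 1 else 2) * lnsinc_fourier k"

lemma l1_lnsinc_outer: "l1 lnsinc_outer"
  unfolding l1_def
proof (rule summable_comparison_test'[where N=0 and g="\<lambda>k. 2 * cmod (lnsinc_fourier k)"])
  show "summable (\<lambda>k. 2 * cmod (lnsinc_fourier k))"
    using l1_lnsinc_fourier unfolding l1_def by (rule summable_mult)
qed (simp add: lnsinc_outer_def norm_mult)

lemma schwarz_lnsinc:
  assumes z: "cmod z < 1"
  shows "(LINT t|circ. schwarz z t * of_real (lnsinc t)) = 2 * pi * powser lnsinc_outer z"
proof -
  have 1: "(\<lambda>k. schwarz_coeff z k * (LINT t|circ. cis (- (real k * t)) * of_real (lnsinc t))) sums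
      (LINT t|circ. schwarz z t * of_real (lnsinc t))"
    by (intro integral_schwarz_series z continuous_intros continuous_lnsinc)
  have 2: "schwarz_coeff z k * (LINT t|circ. cis (- (real k * t)) * of_real (lnsinc t)) =
      2 * pi * (lnsinc_outer k * z ^ k)" for k
    by (simp add: schwarz_coeff_def lnsinc_outer_def lnsinc_fourier_def)
  have "(\<lambda>k. 2 * pi * (lnsinc_outer k * z ^ k)) sums (2 * pi * powser lnsinc_outer z)"
    by (intro sums_mult l1_sums l1_lnsinc_outer) (use z in simp)
  then show ?thesis using sums_unique2[OF 1[unfolded 2]] by blast
qed

text \<open>
  Evenness of \<open>lnsinc\<close> makes it a function of \<open>|t|\<close>, and \<open>||s| - |t||\<close> is comparable to the chord
  between the points \<open>exp(is)\<close> and \<open>exp(it)\<close>; so \<open>lnsinc\<close> is Lipschitz on the circle, across the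
  point \<open>\<pi>\<close> included.
\<close>

lemma chord_bound: obtains m where "m > 0"
  "\<And>s t. s \<in> {-pi..pi} \<Longrightarrow> t \<in> {-pi..pi} \<Longrightarrow> m * \<bar>\<bar>s\<bar> - \<bar>t\<bar>\<bar> \<le> cmod (cis s - cis t)"
proof -
  have "continuous_on {-pi..pi} (\<lambda>t. sinc (t / 2))"
    by (rule continuous_on_sinc) (intro continuous_intros, auto)
  then have "\<exists>t0\<in>{-pi..pi}. \<forall>t\<in>{-pi..pi}. sinc (t0 / 2) \<le> sinc (t / 2)"
    by (rule continuous_attains_inf[OF compact_Icc, rotated]) simp
  then obtain t0 where t0: "t0 \<in> {-pi..pi}" "\<And>t. t \<in> {-pi..pi} \<Longrightarrow> sinc (t0 / 2) \<le> sinc (t / 2)"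
    by blast
  define m where "m = sinc (t0 / 2)"
  have m: "m > 0" unfolding m_def by (rule sinc_half_pos[OF t0(1)])
  have "m * \<bar>\<bar>s\<bar> - \<bar>t\<bar>\<bar> \<le> cmod (cis s - cis t)" if st: "s \<in> {-pi..pi}" "t \<in> {-pi..pi}" for s t
  proof -
    define d where "d = \<bar>\<bar>s\<bar> - \<bar>t\<bar>\<bar>"
    have d: "d \<in> {-pi..pi}" "d \<ge> 0" using st by (auto simp: d_def)
    have "m * d \<le> 2 * sin (d / 2)"
    proof (cases "d = 0")
      case False
      then have "m \<le> sin (d / 2) / (d / 2)" using t0(2)[OF d(1)] by (simp add: m_def)
      then show ?thesis using False d by (simp add: field_simps)
    qed auto
    moreover have "m * d \<ge> 0" using m d by simp
    ultimately have "(m * d)\<^sup>2 \<le> (2 * sin (d / 2))\<^sup>2" by (rule power_mono)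
    also have "\<dots> = 2 - 2 * cos d"
      using cos_double_sin[of "d / 2"] by (simp add: power_mult_distrib)
    also have "cos d = cos (\<bar>s\<bar> - \<bar>t\<bar>)" by (simp add: d_def)
    also have "\<dots> = cos s * cos t + \<bar>sin s\<bar> * \<bar>sin t\<bar>"
    proof -
      have "sin \<bar>x\<bar> = \<bar>sin x\<bar>" if "x \<in> {-pi..pi}" for x
      proof (cases "x \<ge> 0")
        case True
        then show ?thesis using that sin_ge_zero[of x] by simp
      next
        case False
        then show ?thesis using that sin_ge_zero[of "-x"] by simp
      qed
      then show ?thesis using st by (simp add: cos_diff)
    qed
    also have "2 - 2 * (cos s * cos t + \<bar>sin s\<bar> * \<bar>sin t\<bar>) \<le> 2 - 2 * (cos s * cos t + sin s * sin t)"
      by (simp add: flip: abs_mult)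
    also have "\<dots> = (cmod (cis s - cis t))\<^sup>2"
      by (simp add: cmod_power2 power2_diff cos_squared_eq)
    finally show ?thesis unfolding d_def by (rule power2_le_imp_le) simp
  qed
  with m that show ?thesis by blast
qed

lemma lnsinc_even: "lnsinc (- t) = lnsinc t"
  by (simp add: lnsinc_def)

lemma lnsinc_chord_Lipschitz:
  obtains C where "\<And>s t. s \<in> {-pi..pi} \<Longrightarrow> t \<in> {-pi..pi} \<Longrightarrow>
    \<bar>lnsinc s - lnsinc t\<bar> \<le> C * cmod (cis s - cis t)"
proof -
  obtain m where m: "m > 0" "\<And>s t. s \<in> {-pi..pi} \<Longrightarrow> t \<in> {-pi..pi} \<Longrightarrow> m * \<bar>\<bar>s\<bar> - \<bar>t\<bar>\<bar> \<le> cmod (cis s - cis t)"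
    using chord_bound by blast
  obtain B where B: "\<And>t. t \<in> {-pi..pi} \<Longrightarrow> \<bar>lnsinc' t\<bar> \<le> B"
    using continuous_bounded[OF continuous_lnsinc'] by blast
  have B0: "B \<ge> 0" using B[of 0] by (simp add: lnsinc'_def)
  have mvt: "\<bar>lnsinc b - lnsinc a\<bar> \<le> B * \<bar>b - a\<bar>" if ab: "0 \<le> a" "a < b" "b \<le> pi" for a b
  proof -
    have "\<exists>l z. a < z \<and> z < b \<and> (lnsinc has_real_derivative l) (at z) \<and> lnsinc b - lnsinc a = (b - a) * l"
    proof (rule MVT)
      show "continuous_on {a..b} lnsinc" by (rule continuous_on_subset[OF continuous_lnsinc]) (use ab in auto)
      fix x assume "a < x" "x < b"
      then show "lnsinc differentiable (at x)" using DERIV_lnsinc[of x] ab real_differentiable_def by auto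
    qed (use ab in auto)
    then obtain l z where z: "a < z" "z < b" "(lnsinc has_real_derivative l) (at z)" "lnsinc b - lnsinc a = (b - a) * l"
      by blast
    have "(lnsinc has_real_derivative lnsinc' z) (at z)" using z ab by (intro DERIV_lnsinc) auto
    then have "l = lnsinc' z" using z(3) DERIV_unique by blast
    then have "\<bar>l\<bar> \<le> B" using B[of z] z ab by auto
    then show ?thesis using ab unfolding z(4) abs_mult by (simp add: mult.commute mult_left_mono)
  qed
  have lip: "\<bar>lnsinc b - lnsinc a\<bar> \<le> B * \<bar>b - a\<bar>" if "a \<in> {0..pi}" "b \<in> {0..pi}" for a b
    using mvt[of a b] mvt[of b a] that by (cases a b rule: linorder_cases) (auto simp: abs_minus_commute)
  have "\<bar>lnsinc s - lnsinc t\<bar> \<le> B / m * cmod (cis s - cis t)" if st: "s \<in> {-pi..pi}" "t \<in> {-pi..pi}" for s t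
  proof -
    have "\<bar>lnsinc s - lnsinc t\<bar> = \<bar>lnsinc \<bar>s\<bar> - lnsinc \<bar>t\<bar>\<bar>"
      by (simp add: abs_if lnsinc_even)
    also have "\<dots> \<le> B * \<bar>\<bar>s\<bar> - \<bar>t\<bar>\<bar>" using st by (intro lip) auto
    also have "\<dots> = B / m * (m * \<bar>\<bar>s\<bar> - \<bar>t\<bar>\<bar>)" using m by simp
    also have "\<dots> \<le> B / m * cmod (cis s - cis t)"
      using m(2)[OF st] m(1) B0 by (intro mult_left_mono) auto
    finally show ?thesis .
  qed
  then show ?thesis using that by blast
qed

text \<open>
  The Poisson integral of a Lipschitz function recovers its boundary values at the rate
  \<open>\<delta> = sqrt(1 - r\<^sup>2)\<close>. With \<open>D = |exp(it) - r exp(i\<theta>)|\<close> the kernel is \<open>P = \<delta>\<^sup>2/D\<^sup>2\<close>, the chord from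
  \<open>exp(it)\<close> to \<open>exp(i\<theta>)\<close> is at most \<open>2D\<close>, and \<open>P \<cdot> 2D = 2\<delta>\<^sup>2/D \<le> \<delta> + \<delta> P\<close>, whose integral is
  \<open>4\<pi>\<delta>\<close>. Since the series converges absolutely, its values at \<open>r exp(i\<theta>)\<close> tend to the one on the
  circle.
\<close>

lemma Re_lnsinc_outer:
  assumes \<theta>: "\<theta> \<in> {-pi..pi}"
  shows "Re (powser lnsinc_outer (cis \<theta>)) = lnsinc \<theta>"
proof -
  obtain C where C: "\<And>s t. s \<in> {-pi..pi} \<Longrightarrow> t \<in> {-pi..pi} \<Longrightarrow>
    \<bar>lnsinc s - lnsinc t\<bar> \<le> C * cmod (cis s - cis t)" using lnsinc_chord_Lipschitz by blast
  have C0: "C \<ge> 0"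
    using C[of pi 0] by (simp add: zero_le_mult_iff)
  have est: "\<bar>Re (powser lnsinc_outer (of_real r * cis \<theta>)) - lnsinc \<theta>\<bar> \<le> 2 * C * sqrt (1 - r\<^sup>2)"
    if r: "0 < r" "r < 1" for r
  proof -
    define z where "z = of_real r * cis \<theta>"
    have z: "cmod z < 1" "cmod z = r" using r by (auto simp: z_def norm_mult)
    define P where "P t = Re (schwarz z t)" for t
    define \<delta> where "\<delta> = sqrt (1 - r\<^sup>2)"
    have "r\<^sup>2 < 1" using r by (simp add: power_less_one_iff abs_square_less_1)
    then have \<delta>: "\<delta> > 0" "\<delta>\<^sup>2 = 1 - r\<^sup>2" by (auto simp: \<delta>_def)
    have P: "P t = \<delta>\<^sup>2 / (cmod (cis t - z))\<^sup>2" for t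
      unfolding P_def using Re_schwarz[OF z(1)] z(2) \<delta> by simp
    have cP: "continuous_on {-pi..pi} P"
      unfolding P_def by (intro continuous_intros continuous_schwarz z)
    have iS: "integrable circ (schwarz z)" by (intro circ_integrable_continuous continuous_schwarz z)
    have iSq: "integrable circ (\<lambda>t. schwarz z t * of_real (lnsinc t))"
      by (intro circ_integrable_continuous continuous_intros continuous_schwarz continuous_lnsinc z)
    have intP: "(LINT t|circ. P t) = 2 * pi"
      unfolding P_def using integral_schwarz[OF z(1)] iS by simp
    have intPq: "(LINT t|circ. P t * lnsinc t) = 2 * pi * Re (powser lnsinc_outer z)"
    proof -
      have "(LINT t|circ. P t * lnsinc t) = (LINT t|circ. Re (schwarz z t * of_real (lnsinc t)))"
        by (simp add: P_def)
      also have "\<dots> = Re (LINT t|circ. schwarz z t * of_real (lnsinc t))"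
        using iSq by (rule integral_Re)
      finally show ?thesis unfolding schwarz_lnsinc[OF z(1)] by simp
    qed
    have pt: "\<bar>P t * (lnsinc t - lnsinc \<theta>)\<bar> \<le> C * (\<delta> + \<delta> * P t)" if t: "t \<in> {-pi..pi}" for t
    proof -
      define D where "D = cmod (cis t - z)"
      have D: "D > 0" using cis_minus_nz[OF z(1)] by (simp add: D_def)
      have "1 - r \<le> D" unfolding D_def using norm_triangle_ineq2[of "cis t" z] z by simp
      moreover have "cmod (cis t - cis \<theta>) \<le> D + (1 - r)"
      proof -
        have "cmod (cis t - cis \<theta>) \<le> cmod (cis t - z) + cmod (z - cis \<theta>)"
          using norm_triangle_ineq[of "cis t - z" "z - cis \<theta>"] by simp
        moreover have "z - cis \<theta> = of_real (r - 1) * cis \<theta>" by (simp add: z_def algebra_simps)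
        then have "cmod (z - cis \<theta>) = 1 - r" using r by (simp only: norm_mult norm_of_real norm_cis) simp
        ultimately show ?thesis by (simp add: D_def)
      qed
      ultimately have ch: "cmod (cis t - cis \<theta>) \<le> 2 * D" by linarith
      have P0: "P t \<ge> 0" by (simp add: P)
      have "\<bar>P t * (lnsinc t - lnsinc \<theta>)\<bar> = P t * \<bar>lnsinc t - lnsinc \<theta>\<bar>"
        using P0 by (simp add: abs_mult)
      also have "\<dots> \<le> P t * (C * cmod (cis t - cis \<theta>))"
        by (intro mult_left_mono C t \<theta> P0)
      also have "\<dots> \<le> P t * (C * (2 * D))"
        by (intro mult_left_mono ch P0 C0)
      also have "\<dots> = C * (2 * (\<delta>\<^sup>2 / D))"
        using D by (simp add: P D_def[symmetric] power2_eq_square)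
      also have "\<dots> \<le> C * (\<delta> + \<delta> * P t)"
      proof (intro mult_left_mono C0)
        \<comment> \<open>Expanding this square gives the claim.\<close>
        have "0 \<le> \<delta> * (1 - \<delta> / D)\<^sup>2" using \<delta> by simp
        then show "2 * (\<delta>\<^sup>2 / D) \<le> \<delta> + \<delta> * P t"
          using D by (simp add: P D_def[symmetric] power2_eq_square algebra_simps)
      qed
      finally show ?thesis .
    qed
    have "2 * pi * \<bar>Re (powser lnsinc_outer z) - lnsinc \<theta>\<bar> = \<bar>LINT t|circ. P t * (lnsinc t - lnsinc \<theta>)\<bar>"
    proof -
      have "integrable circ P" "integrable circ (\<lambda>t. P t * lnsinc t)"
        by (intro circ_integrable_continuous continuous_intros cP continuous_lnsinc)+
      then have "(LINT t|circ. P t * (lnsinc t - lnsinc \<theta>)) = 2 * pi * (Re (powser lnsinc_outer z) - lnsinc \<theta>)"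
        by (simp add: right_diff_distrib intPq intP)
      then show ?thesis by (simp add: abs_mult)
    qed
    also have "\<dots> \<le> (LINT t|circ. \<bar>P t * (lnsinc t - lnsinc \<theta>)\<bar>)"
      by (rule integral_abs_bound)
    also have "\<dots> \<le> (LINT t|circ. C * (\<delta> + \<delta> * P t))"
      by (intro integral_mono circ_integrable_continuous continuous_intros cP continuous_lnsinc) (use pt in auto)
    also have "\<dots> = C * (\<delta> * (2 * pi) + \<delta> * (2 * pi))"
    proof -
      have "integrable circ P" "integrable circ (\<lambda>t. \<delta>)"
        by (intro circ_integrable_continuous continuous_intros cP)+
      then have "(LINT t|circ. C * (\<delta> + \<delta> * P t)) = C * ((LINT t|circ. \<delta>) + \<delta> * (LINT t|circ. P t))"
        by (simp only: integral_mult_right_zero Bochner_Integration.integral_add integrable_mult_right)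
      then show ?thesis by (simp add: intP measure_restrict_space mult.commute)
    qed
    finally have "2 * pi * \<bar>Re (powser lnsinc_outer z) - lnsinc \<theta>\<bar> \<le> 2 * pi * (2 * C * \<delta>)"
      by (simp add: algebra_simps)
    then show ?thesis by (simp add: z_def \<delta>_def)
  qed
  define r where "r j = 1 - 1 / (real j + 2)" for j
  have r: "0 < r j" "r j < 1" for j by (auto simp: r_def field_simps)
  have r_lim: "r \<longlonglongrightarrow> 1" unfolding r_def by real_asymp
  have "(\<lambda>j. \<bar>Re (powser lnsinc_outer (of_real (r j) * cis \<theta>)) - lnsinc \<theta>\<bar>) \<longlonglongrightarrow> 0"
  proof (rule tendsto_sandwich[OF _ _ tendsto_const])
    show "(\<lambda>j. 2 * C * sqrt (1 - (r j)\<^sup>2)) \<longlonglongrightarrow> 0"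
      using tendsto_mult[OF tendsto_const[of "2 * C"] tendsto_real_sqrt[OF tendsto_diff[OF tendsto_const[of 1] tendsto_power[OF r_lim, of 2]]]]
      by simp
  qed (use est r in \<open>auto intro!: always_eventually\<close>)
  then have "(\<lambda>j. Re (powser lnsinc_outer (of_real (r j) * cis \<theta>)) - lnsinc \<theta>) \<longlonglongrightarrow> 0"
    by (simp add: tendsto_rabs_zero_iff)
  moreover have "(\<lambda>j. powser lnsinc_outer (of_real (r j) * cis \<theta>)) \<longlonglongrightarrow> powser lnsinc_outer (cis \<theta>)"
  proof (rule continuous_on_tendsto_compose[OF powser_continuous[OF l1_lnsinc_outer]])
    have "(\<lambda>j. of_real (r j) * cis \<theta>) \<longlonglongrightarrow> of_real 1 * cis \<theta>"
      by (intro tendsto_intros r_lim)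
    then show "(\<lambda>j. of_real (r j) * cis \<theta>) \<longlonglongrightarrow> cis \<theta>" by simp
    show "\<forall>\<^sub>F j in sequentially. of_real (r j) * cis \<theta> \<in> cball 0 1"
    proof (intro always_eventually allI)
      fix j
      have "\<bar>r j\<bar> \<le> 1" using r[of j] by auto
      then show "of_real (r j) * cis \<theta> \<in> cball 0 1" by (simp add: norm_mult)
    qed
  qed auto
  then have "(\<lambda>j. Re (powser lnsinc_outer (of_real (r j) * cis \<theta>)) - lnsinc \<theta>) \<longlonglongrightarrow> Re (powser lnsinc_outer (cis \<theta>)) - lnsinc \<theta>"
    by (intro tendsto_intros)
  ultimately have "Re (powser lnsinc_outer (cis \<theta>)) - lnsinc \<theta> = 0"
    by (rule LIMSEQ_unique[symmetric])
  then show ?thesis by simp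
qed

section \<open>Logarithmic singularities on the circle\<close>

lemma AE_circ_not_countable:
  assumes "countable S" shows "AE t in circ. t \<notin> S"
proof -
  have "AE t in lebesgue. t \<notin> S"
    using AE_completion[OF AE_not_in[OF countable_imp_null_set_lborel[OF assms]]] by simp
  then show ?thesis by (subst AE_restrict_space_iff) auto
qed

lemma countable_cis_eq_1:
  assumes "m > 0" shows "countable {t. cis (real m * t) = 1}"
proof -
  have "{t. cis (real m * t) = 1} \<subseteq> range (\<lambda>k::int. 2 * pi * real_of_int k / real m)"
  proof
    fix t assume "t \<in> {t. cis (real m * t) = 1}"
    then have "cos (real m * t) = 1" using cis.sel(1)[of "real m * t"] by simp
    then obtain k :: int where "real m * t = of_int k * 2 * pi"
      using cos_one_2pi_int by auto
    then have "t = 2 * pi * real_of_int k / real m" using assms by (simp add: field_simps)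
    then show "t \<in> range (\<lambda>k::int. 2 * pi * real_of_int k / real m)" by blast
  qed
  then show ?thesis by (rule countable_subset) auto
qed

lemma AE_circ_generic:
  assumes "m > 0" shows "AE t in circ. t \<noteq> 0 \<and> t \<in> {-pi..pi} \<and> cis t \<noteq> 1 \<and> cis (real m * t) \<noteq> 1"
proof -
  have "AE t in circ. t \<notin> {t. cis (real m * t) = 1}" "AE t in circ. t \<notin> {t. cis (real 1 * t) = 1}"
    "AE t in circ. t \<notin> {0}"
    by (intro AE_circ_not_countable countable_cis_eq_1 assms; simp)+
  with AE_space[of circ] show ?thesis by eventually_elim auto
qed

text \<open>
  The Schwarz formula: a power series with vanishing constant term is recovered from the boundary
  values of its real part. The conjugate half of \<open>2 Re X = X + cnj X\<close> consists, like the kernel,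
  of modes \<open>exp(-ikt)\<close> with \<open>k \<ge> 0\<close>, so only the product of the constant terms could contribute.
\<close>

lemma schwarz_Re_powser:
  assumes x: "l1 x" "x 0 = 0" and z: "cmod z < 1"
  shows "(LINT t|circ. schwarz z t * of_real (Re (powser x (cis t)))) = 2 * pi * powser x z"
proof -
  let ?X = "\<lambda>t. powser x (cis t)"
  have cX: "continuous_on {-pi..pi} ?X" by (intro powser_cis_continuous x continuous_intros)
  have A: "(LINT t|circ. schwarz z t * ?X t) = 2 * pi * (2 * powser x z)"
  proof -
    have "(\<lambda>k. schwarz_coeff z k * (LINT t|circ. cis (- (real k * t)) * ?X t)) sums (LINT t|circ. schwarz z t * ?X t)"
      by (rule integral_schwarz_series[OF z cX])
    moreover have "schwarz_coeff z k * (LINT t|circ. cis (- (real k * t)) * ?X t) = 2 * pi * (2 * (x k * z ^ k))" for k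
      using fourier_coeff_powser[OF x(1), of "int k"] x(2) by (simp add: schwarz_coeff_def)
    moreover have "(\<lambda>k. 2 * pi * (2 * (x k * z ^ k))) sums (2 * pi * (2 * powser x z))"
      by (intro sums_mult l1_sums x) (use z in simp)
    ultimately show ?thesis by (simp only: sums_unique2)
  qed
  have B: "(LINT t|circ. schwarz z t * cnj (?X t)) = 0"
  proof -
    have "(\<lambda>k. schwarz_coeff z k * (LINT t|circ. cis (- (real k * t)) * cnj (?X t))) sums (LINT t|circ. schwarz z t * cnj (?X t))"
      by (intro integral_schwarz_series z continuous_intros cX)
    moreover have "(LINT t|circ. cis (- (real k * t)) * cnj (?X t)) = 0" for k
    proof -
      have "(LINT t|circ. cis (- (real k * t)) * cnj (?X t)) = (LINT t|circ. cnj (cis (real k * t) * ?X t))"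
        by (simp add: cis_cnj)
      also have "\<dots> = cnj (LINT t|circ. cis (real k * t) * ?X t)"
        by (rule Bochner_Integration.integral_cnj)
      also have "(LINT t|circ. cis (real k * t) * ?X t) = 0"
        using fourier_coeff_powser[OF x(1), of "- int k"] x(2) by (cases "k = 0") auto
      finally show ?thesis by simp
    qed
    ultimately show ?thesis by (simp add: sums_iff)
  qed
  have "integrable circ (\<lambda>t. schwarz z t * ?X t)" "integrable circ (\<lambda>t. schwarz z t * cnj (?X t))"
    by (intro circ_integrable_continuous continuous_intros continuous_schwarz z cX)+
  then have "(LINT t|circ. schwarz z t * ?X t + schwarz z t * cnj (?X t)) = 2 * pi * (2 * powser x z)"
    by (simp add: A B)
  moreover have "(\<lambda>t. schwarz z t * ?X t + schwarz z t * cnj (?X t)) = (\<lambda>t. 2 * (schwarz z t * of_real (Re (?X t))))"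
    by (simp add: fun_eq_iff complex_add_cnj flip: distrib_left)
  ultimately have "2 * (LINT t|circ. schwarz z t * of_real (Re (?X t))) = 2 * (2 * pi * powser x z)"
    by simp
  then show ?thesis by simp
qed

text \<open>
  The damping factor \<open>c < 1\<close> moves the zeros of \<open>1 - c z\<^sup>m\<close> off the closed disc, where the principal
  logarithm is then holomorphic.
\<close>

lemma schwarz_log_damped:
  assumes c: "0 < c" "c < 1" and m: "m > 0" and z: "cmod z < 1"
  shows "(LINT t|circ. schwarz z t * of_real (ln (cmod (1 - of_real c * cis (real m * t))))) =
         2 * pi * Ln (1 - of_real c * z ^ m)"
proof -
  define R where "R = root m (1 / c)"
  have R: "R > 1" using c m by (simp add: R_def)
  have Rm: "c * R ^ m = 1" using c m by (simp add: R_def)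
  have small: "cmod (of_real c * w ^ m) < 1" if "cmod w < R" for w
  proof -
    have "cmod w ^ m < R ^ m" using that m by (intro power_strict_mono) auto
    then have "c * cmod w ^ m < c * R ^ m" using c by simp
    then show ?thesis using Rm c by (simp add: norm_mult norm_power)
  qed
  have Re: "Re (1 - of_real c * w ^ m) > 0" if "cmod w < R" for w
    using small[OF that] complex_Re_le_cmod[of "of_real c * w ^ m"] by simp
  have "(\<lambda>w. Ln (1 - of_real c * w ^ m)) holomorphic_on ball 0 R"
    using Re by (intro holomorphic_intros) (force simp: complex_nonpos_Reals_iff)
  then obtain x where x: "l1 x" "\<And>w. cmod w \<le> 1 \<Longrightarrow> powser x w = Ln (1 - of_real c * w ^ m)"
    using l1_holomorphic[OF _ R] by blast
  have x0: "x 0 = 0" using x(2)[of 0] m by (simp add: powser_0 power_0_left)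
  have "of_real (Re (powser x (cis t))) = complex_of_real (ln (cmod (1 - of_real c * cis (real m * t))))" for t
  proof -
    have "1 - of_real c * cis t ^ m \<noteq> 0" using Re[of "cis t"] R by force
    then show ?thesis by (simp add: x(2) Complex.DeMoivre)
  qed
  then show ?thesis using schwarz_Re_powser[OF x(1) x0 z] z by (simp add: x(2))
qed

text \<open>
  Damping lowers the distance of a unimodular number from \<open>1\<close> at most by the factor \<open>2\<close>. This gives
  an integrable majorant for the damped logarithms.
\<close>

lemma damped_le: "cmod e = 1 \<Longrightarrow> 0 \<le> c \<Longrightarrow> c \<le> 1 \<Longrightarrow> cmod (1 - e) \<le> 2 * cmod (1 - of_real c * e)"
proof -
  assume e: "cmod e = 1" and c: "0 \<le> c" "c \<le> 1"
  have "cmod (1 - e) \<le> cmod (1 - of_real c * e) + cmod (of_real c * e - e)"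
    using norm_triangle_ineq[of "1 - of_real c * e" "of_real c * e - e"] by simp
  also have "of_real c * e - e = of_real (c - 1) * e" by (simp add: algebra_simps)
  also have "cmod (of_real (c - 1) * e) = 1 - c" using e c by (simp only: norm_mult norm_of_real) simp
  also have "1 - c \<le> cmod (1 - of_real c * e)"
    using norm_triangle_ineq2[of 1 "of_real c * e"] e c by (simp add: norm_mult)
  finally show ?thesis by simp
qed

definition logdist :: "nat \<Rightarrow> real \<Rightarrow> real" where
  "logdist m t = ln (cmod (1 - cis (real m * t)))"

lemma logdist_measurable [measurable]: "logdist m \<in> borel_measurable circ"
proof -
  have "(\<lambda>t. ln (cmod (1 - cis (real m * t)))) \<in> borel_measurable borel"
    by (intro borel_measurable_ln borel_measurable_continuous_onI continuous_intros)
  then have "logdist m \<in> borel_measurable borel" by (simp add: logdist_def[abs_def])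
  then have "logdist m \<in> borel_measurable lebesgue" by (intro measurable_completion) simp
  then show ?thesis by (intro measurable_restrict_space1)
qed

definition damping :: "nat \<Rightarrow> real" where "damping j = 1 - 1 / (real j + 2)"

lemma damping: "0 < damping j" "damping j < 1" "damping \<longlonglongrightarrow> 1"
proof -
  show "0 < damping j" "damping j < 1" by (auto simp: damping_def field_simps)
  show "damping \<longlonglongrightarrow> 1" unfolding damping_def by real_asymp
qed

definition logdamp :: "nat \<Rightarrow> nat \<Rightarrow> real \<Rightarrow> real" where
  "logdamp m j t = ln (cmod (1 - of_real (damping j) * cis (real m * t)))"

lemma damped_pos: "0 < cmod (1 - of_real (damping j) * cis s)"
proof -
  have "of_real (damping j) * cis s \<noteq> 1"
    using damping(1,2)[of j] by (metis abs_of_pos less_irrefl mult.right_neutral norm_cis norm_mult norm_of_real norm_one)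
  then show ?thesis by auto
qed

lemma continuous_logdamp: "continuous_on {-pi..pi} (logdamp m j)"
  unfolding logdamp_def using damped_pos
  by (intro continuous_intros) (metis less_irrefl)

lemma logdamp_le: "logdamp m j t \<le> ln 2"
proof -
  have "cmod (1 - of_real (damping j) * cis (real m * t)) \<le> 2"
    using norm_triangle_ineq4[of 1 "of_real (damping j) * cis (real m * t)"] damping(1,2)[of j]
    by (simp add: norm_mult)
  then show ?thesis unfolding logdamp_def using damped_pos by (subst ln_le_cancel_iff) auto
qed

lemma logdamp_bound:
  assumes "cis (real m * t) \<noteq> 1"
  shows "\<bar>logdamp m j t\<bar> \<le> \<bar>logdist m t\<bar> + ln 2"
proof -
  have "ln (cmod (1 - cis (real m * t))) \<le> ln (2 * cmod (1 - of_real (damping j) * cis (real m * t)))"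
    using assms damped_le[of "cis (real m * t)" "damping j"] damping(1,2)[of j] damped_pos
    by (subst ln_le_cancel_iff) auto
  also have "\<dots> = ln 2 + logdamp m j t"
    unfolding logdamp_def using damped_pos[of j "real m * t"] by (subst ln_mult) auto
  finally show ?thesis using logdamp_le[of m j t] ln_gt_zero[of 2] by (simp add: logdist_def abs_if)
qed

lemma logdamp_tendsto:
  assumes "cis (real m * t) \<noteq> 1"
  shows "(\<lambda>j. logdamp m j t) \<longlonglongrightarrow> logdist m t"
proof -
  have "(\<lambda>j. ln (cmod (1 - of_real (damping j) * cis (real m * t)))) \<longlonglongrightarrow> ln (cmod (1 - of_real 1 * cis (real m * t)))"
    using assms by (intro tendsto_intros damping(3)) auto
  then show ?thesis by (simp add: logdamp_def logdist_def)
qed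

lemma integral_logdamp: "m > 0 \<Longrightarrow> (LINT t|circ. logdamp m j t) = 0"
proof -
  assume m: "m > 0"
  have "(LINT t|circ. complex_of_real (logdamp m j t)) = 0"
    using schwarz_log_damped[OF damping(1,2)[of j] m, of 0] m
    by (simp add: schwarz_def logdamp_def power_0_left)
  then show ?thesis by (simp only: integral_complex_of_real of_real_eq_0_iff)
qed

text \<open>
  The singularities of \<open>ln |1 - exp(imt)|\<close> are integrable: the damped logarithms have integral \<open>0\<close>
  (the mean value property) and are bounded above by \<open>ln 2\<close>, so Fatou's lemma bounds the integral of
  \<open>ln 2 - ln |1 - exp(imt)|\<close> by \<open>2\<pi> ln 2\<close>.
\<close>

lemma integrable_logdist:
  assumes m: "m > 0"
  shows "integrable circ (logdist m)"
proof -
  define h where "h t = ln 2 - logdist m t" for t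
  have ae: "AE t in circ. cis (real m * t) \<noteq> 1" using AE_circ_generic[OF m] by eventually_elim simp
  have [measurable]: "h \<in> borel_measurable circ" unfolding h_def by measurable
  have [measurable]: "logdamp m j \<in> borel_measurable circ" for j
    using circ_integrable_continuous[OF continuous_logdamp] by auto
  have "(\<integral>\<^sup>+ t. ennreal (h t) \<partial>circ) = (\<integral>\<^sup>+ t. liminf (\<lambda>j. ennreal (ln 2 - logdamp m j t)) \<partial>circ)"
  proof (rule nn_integral_cong_AE)
    show "AE t in circ. ennreal (h t) = liminf (\<lambda>j. ennreal (ln 2 - logdamp m j t))"
      using ae
    proof eventually_elim
      case (elim t)
      have "(\<lambda>j. ennreal (ln 2 - logdamp m j t)) \<longlonglongrightarrow> ennreal (h t)"
        unfolding h_def by (intro tendsto_intros tendsto_ennrealI logdamp_tendsto elim)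
      then show ?case by (rule lim_imp_Liminf[OF trivial_limit_sequentially, symmetric])
    qed
  qed
  also have "\<dots> \<le> liminf (\<lambda>j. \<integral>\<^sup>+ t. ennreal (ln 2 - logdamp m j t) \<partial>circ)"
    by (intro nn_integral_liminf) measurable
  also have "(\<lambda>j. \<integral>\<^sup>+ t. ennreal (ln 2 - logdamp m j t) \<partial>circ) = (\<lambda>j. ennreal (2 * pi * ln 2))"
  proof
    fix j
    have i: "integrable circ (logdamp m j)" "integrable circ (\<lambda>t. ln 2 :: real)"
      by (intro circ_integrable_continuous continuous_logdamp continuous_intros)+
    have "(\<integral>\<^sup>+ t. ennreal (ln 2 - logdamp m j t) \<partial>circ) = ennreal (LINT t|circ. ln 2 - logdamp m j t)"
      using logdamp_le i by (intro nn_integral_eq_integral) auto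
    also have "(LINT t|circ. ln 2 - logdamp m j t) = 2 * pi * ln 2"
      using i integral_logdamp[OF m] by (simp add: measure_restrict_space)
    finally show "(\<integral>\<^sup>+ t. ennreal (ln 2 - logdamp m j t) \<partial>circ) = ennreal (2 * pi * ln 2)" .
  qed
  also have "liminf (\<lambda>j. ennreal (2 * pi * ln 2)) = ennreal (2 * pi * ln 2)" by (simp add: Liminf_const)
  also have "\<dots> < \<infinity>" by simp
  finally have fin: "(\<integral>\<^sup>+ t. ennreal (h t) \<partial>circ) < \<infinity>" .
  have "AE t in circ. h t \<ge> 0" using ae
  proof eventually_elim
    case (elim t)
    have "cmod (1 - cis (real m * t)) \<le> 2" using norm_triangle_ineq4[of 1 "cis (real m * t)"] by simp
    then show ?case unfolding h_def logdist_def using elim by (simp add: ln_le_cancel_iff)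
  qed
  then have "integrable circ h" using fin by (intro integrableI_nonneg) auto
  moreover have "integrable circ (\<lambda>t. ln 2 :: real)"
    by (intro circ_integrable_continuous continuous_intros)
  ultimately have "integrable circ (\<lambda>t. ln 2 - h t)" by (intro Bochner_Integration.integrable_diff)
  then show ?thesis by (simp add: h_def)
qed

lemma integrable_schwarz_mult:
  assumes z: "cmod z < 1" and g: "integrable circ g"
  shows "integrable circ (\<lambda>t. schwarz z t * complex_of_real (g t))"
proof -
  have [measurable]: "schwarz z \<in> borel_measurable circ" "g \<in> borel_measurable circ"
    using circ_integrable_continuous[OF continuous_schwarz[OF z]] g by auto
  define B where "B = (\<Sum>k. cmod (schwarz_coeff z k))"
  have B: "cmod (schwarz z t) \<le> B" for t
    unfolding schwarz_series[OF z, symmetric] B_def by (rule powser_bound[OF l1_schwarz_coeff[OF z]]) simp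
  show ?thesis
  proof (rule Bochner_Integration.integrable_bound)
    show "integrable circ (\<lambda>t. B * g t)" using g by simp
    show "AE t in circ. norm (schwarz z t * complex_of_real (g t)) \<le> norm (B * g t)"
      using B order_trans[OF B abs_ge_self] by (auto simp: norm_mult abs_mult intro!: mult_right_mono AE_I2)
  qed measurable
qed

lemma schwarz_logdist:
  assumes m: "m > 0" and z: "cmod z < 1"
  shows "(LINT t|circ. schwarz z t * of_real (logdist m t)) = 2 * pi * Ln (1 - z ^ m)"
proof -
  define B where "B = (\<Sum>k. cmod (schwarz_coeff z k))"
  have B: "cmod (schwarz z t) \<le> B" for t
    unfolding schwarz_series[OF z, symmetric] B_def by (rule powser_bound[OF l1_schwarz_coeff[OF z]]) simp
  have B0: "B \<ge> 0" using order_trans[OF norm_ge_zero B] .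
  have ae: "AE t in circ. cis (real m * t) \<noteq> 1" using AE_circ_generic[OF m] by eventually_elim simp
  have "(\<lambda>j. LINT t|circ. schwarz z t * of_real (logdamp m j t)) \<longlonglongrightarrow> (LINT t|circ. schwarz z t * of_real (logdist m t))"
  proof (rule integral_dominated_convergence)
    show "integrable circ (\<lambda>t. B * (\<bar>logdist m t\<bar> + ln 2))"
      by (intro integrable_mult_right Bochner_Integration.integrable_add integrable_abs integrable_logdist m
           circ_integrable_continuous continuous_intros)
    show "AE t in circ. norm (schwarz z t * of_real (logdamp m j t)) \<le> B * (\<bar>logdist m t\<bar> + ln 2)" for j
      using ae by eventually_elim (use logdamp_bound B B0 in \<open>auto simp: norm_mult intro!: mult_mono\<close>)
    show "AE t in circ. (\<lambda>j. schwarz z t * of_real (logdamp m j t)) \<longlonglongrightarrow> schwarz z t * of_real (logdist m t)"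
      using ae by eventually_elim (intro tendsto_intros logdamp_tendsto)
    show "(\<lambda>t. schwarz z t * of_real (logdist m t)) \<in> borel_measurable circ"
      using integrable_schwarz_mult[OF z integrable_logdist[OF m]] by auto
    show "(\<lambda>t. schwarz z t * of_real (logdamp m j t)) \<in> borel_measurable circ" for j
      using integrable_schwarz_mult[OF z circ_integrable_continuous[OF continuous_logdamp]] by auto
  qed
  moreover have "(LINT t|circ. schwarz z t * of_real (logdamp m j t)) = 2 * pi * Ln (1 - of_real (damping j) * z ^ m)" for j
    unfolding logdamp_def by (rule schwarz_log_damped[OF damping(1,2) m z])
  moreover have "(\<lambda>j. 2 * pi * Ln (1 - of_real (damping j) * z ^ m)) \<longlonglongrightarrow> 2 * pi * Ln (1 - of_real 1 * z ^ m)"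
  proof (intro tendsto_intros damping(3))
    have "cmod (z ^ m) < 1" using z m by (simp add: norm_power power_less_one_iff)
    then have "Re (1 - z ^ m) > 0" using complex_Re_le_cmod[of "z ^ m"] by simp
    then show "1 - complex_of_real 1 * z ^ m \<notin> \<real>\<^sub>\<le>\<^sub>0" by (auto simp: complex_nonpos_Reals_iff)
  qed
  ultimately have "(\<lambda>j. 2 * pi * Ln (1 - of_real (damping j) * z ^ m)) \<longlonglongrightarrow> (LINT t|circ. schwarz z t * of_real (logdist m t))"
    "(\<lambda>j. 2 * pi * Ln (1 - of_real (damping j) * z ^ m)) \<longlonglongrightarrow> 2 * pi * Ln (1 - z ^ m)"
    by simp_all
  then show ?thesis by (rule LIMSEQ_unique)
qed

section \<open>The outer function of the increments\<close>

lemma cmod_one_minus_cis: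
  assumes "t \<in> {-pi..pi}" "t \<noteq> 0"
  shows "cmod (1 - cis t) = \<bar>t\<bar> * exp (lnsinc t)"
proof -
  have "exp (lnsinc t) = sin (t / 2) / (t / 2)"
    using sinc_half_pos[OF assms(1)] assms(2) by (simp add: lnsinc_def)
  moreover have "(cmod (1 - cis t))\<^sup>2 = 2 - 2 * cos t"
    by (simp add: cmod_power2 power2_diff cos_squared_eq)
  then have "(cmod (1 - cis t))\<^sup>2 = (2 * sin (t / 2))\<^sup>2"
    using cos_double_sin[of "t / 2"] by (simp add: power_mult_distrib)
  then have "sqrt ((cmod (1 - cis t))\<^sup>2) = sqrt ((2 * sin (t / 2))\<^sup>2)" by (simp only:)
  then have "cmod (1 - cis t) = \<bar>2 * sin (t / 2)\<bar>" by (simp only: real_sqrt_abs abs_norm_cancel)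
  moreover have "\<bar>2 * sin (t / 2)\<bar> = \<bar>t\<bar> * (sin (t / 2) / (t / 2))"
    using sinc_half_pos[OF assms(1)] assms(2)
    by (cases "t > 0") (auto simp: zero_less_divide_iff abs_if)
  ultimately show ?thesis by simp
qed

lemma cmod_beta:
  assumes "t \<in> {-pi..pi}" "t \<noteq> 0" "cis (real \<mu> * t) \<noteq> 1"
  shows "cmod (beta n (int \<mu>) t) = exp (real n * (logdist \<mu> t - logdist 1 t + lnsinc t))"
proof -
  have "cmod (1 - cis (- (real \<mu> * t))) = cmod (cnj (1 - cis (real \<mu> * t)))"
    by (simp add: cis_cnj)
  then have "cmod (1 - cis (- (real \<mu> * t))) = cmod (1 - cis (real \<mu> * t))"
    by (simp only: complex_mod_cnj)
  also have "\<dots> = exp (logdist \<mu> t)" using assms(3) by (simp add: logdist_def)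
  finally have 1: "cmod (1 - cis (- (real \<mu> * t))) = exp (logdist \<mu> t)" .
  have "exp (logdist 1 t) = \<bar>t\<bar> * exp (lnsinc t)"
    using cmod_one_minus_cis[OF assms(1,2)] assms(2) by (simp add: logdist_def)
  then have "\<bar>t\<bar> = exp (logdist 1 t - lnsinc t)" by (simp add: exp_diff)
  with 1 have "cmod (beta n (int \<mu>) t) = (exp (logdist \<mu> t) / exp (logdist 1 t - lnsinc t)) ^ n"
    by (simp add: beta_def norm_divide norm_power norm_mult power_divide)
  also have "\<dots> = exp (real n * (logdist \<mu> t - logdist 1 t + lnsinc t))"
    unfolding exp_of_nat_mult by (simp add: algebra_simps flip: exp_diff)
  finally show ?thesis .
qed

text \<open>
  By \<open>cmod_beta\<close> the logarithm in the definition of \<open>w\<^sub>\<mu>\<close> is \<open>2n\<close> times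
  \<open>ln |1 - exp(i\<mu>t)| - ln |1 - exp(it)| + lnsinc t\<close>, and the three Schwarz integrals are known.
\<close>

lemma wfun_eq:
  assumes "\<mu> > 0" and z: "cmod z < 1"
  shows "wfun n \<mu> z = (\<Sum>j<\<mu>. z ^ j) ^ n * exp (of_nat n * powser lnsinc_outer z)"
proof -
  define G where "G t = logdist \<mu> t - logdist 1 t + lnsinc t" for t
  have "AE t in circ. ln ((cmod (1 - cis (- (real \<mu> * t)))) ^ (2 * n) / t ^ (2 * n)) = 2 * real n * G t"
    using AE_circ_generic[OF assms(1)]
  proof eventually_elim
    case (elim t)
    have "(cmod (1 - cis (- (real \<mu> * t)))) ^ (2 * n) / t ^ (2 * n) = (cmod (beta n (int \<mu>) t))\<^sup>2"
    proof -
      have "t ^ (2 * n) = (\<bar>t\<bar> ^ n)\<^sup>2" by (simp only: mult.commute[of 2 n] power_mult power2_abs abs_power2 flip: power_abs)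
      then show ?thesis
        by (simp add: beta_def norm_divide norm_power norm_mult power_divide mult.commute[of 2 n] power_mult)
    qed
    then show ?case using elim by (simp add: cmod_beta G_def flip: exp_of_nat_mult)
  qed
  then have "(LINT t|circ. (cis t + z) / (cis t - z) *
        complex_of_real (ln ((cmod (1 - cis (- (real \<mu> * t)))) ^ (2 * n) / t ^ (2 * n)))) =
      (LINT t|circ. 2 * of_nat n * (schwarz z t * of_real (G t)))"
  proof (intro integral_cong_AE)
    show "AE t in circ. (cis t + z) / (cis t - z) *
        complex_of_real (ln ((cmod (1 - cis (- (real \<mu> * t)))) ^ (2 * n) / t ^ (2 * n))) =
        2 * of_nat n * (schwarz z t * of_real (G t))"
      if "AE t in circ. ln ((cmod (1 - cis (- (real \<mu> * t)))) ^ (2 * n) / t ^ (2 * n)) = 2 * real n * G t"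
      using that by eventually_elim (simp add: schwarz_def)
    have "(\<lambda>t. (cis t + z) / (cis t - z)) \<in> borel_measurable circ"
      using circ_integrable_continuous[OF continuous_schwarz[OF z]] by (auto simp: schwarz_def[abs_def])
    moreover have "(\<lambda>t. ln ((cmod (1 - cis (- (real \<mu> * t)))) ^ (2 * n) / t ^ (2 * n))) \<in> borel_measurable circ"
    proof -
      have "(\<lambda>t. cmod (1 - cis (- (real \<mu> * t)))) \<in> borel_measurable borel"
        by (intro borel_measurable_continuous_onI continuous_intros)
      then have "(\<lambda>t. ln ((cmod (1 - cis (- (real \<mu> * t)))) ^ (2 * n) / t ^ (2 * n))) \<in> borel_measurable borel"
        by measurable
      then show ?thesis by (intro measurable_restrict_space1 measurable_completion) simp
    qed
    ultimately show "(\<lambda>t. (cis t + z) / (cis t - z) *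
        complex_of_real (ln ((cmod (1 - cis (- (real \<mu> * t)))) ^ (2 * n) / t ^ (2 * n)))) \<in> borel_measurable circ"
      by measurable
    have "lnsinc \<in> borel_measurable circ" using circ_integrable_continuous[OF continuous_lnsinc] by auto
    then show "(\<lambda>t. 2 * of_nat n * (schwarz z t * of_real (G t))) \<in> borel_measurable circ"
      using circ_integrable_continuous[OF continuous_schwarz[OF z]] unfolding G_def by measurable
  qed
  also have "\<dots> = 2 * of_nat n * (LINT t|circ. schwarz z t * of_real (G t))" by simp
  also have "(LINT t|circ. schwarz z t * of_real (G t)) =
      (LINT t|circ. schwarz z t * of_real (logdist \<mu> t)) - (LINT t|circ. schwarz z t * of_real (logdist 1 t)) +
      (LINT t|circ. schwarz z t * of_real (lnsinc t))"
  proof -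
    have "integrable circ (\<lambda>t. schwarz z t * of_real (logdist \<mu> t))" "integrable circ (\<lambda>t. schwarz z t * of_real (logdist 1 t))"
      "integrable circ (\<lambda>t. schwarz z t * of_real (lnsinc t))"
      by (intro integrable_schwarz_mult z integrable_logdist assms circ_integrable_continuous continuous_lnsinc; simp)+
    then show ?thesis by (simp add: G_def ring_distribs left_diff_distrib right_diff_distrib)
  qed
  also have "\<dots> = 2 * pi * (Ln (1 - z ^ \<mu>) - Ln (1 - z) + powser lnsinc_outer z)"
    using schwarz_logdist[OF assms] schwarz_logdist[OF _ z, of 1]
    by (simp add: schwarz_lnsinc[OF z] ring_distribs right_diff_distrib)
  finally have "wfun n \<mu> z = exp (of_nat n * (Ln (1 - z ^ \<mu>) - Ln (1 - z) + powser lnsinc_outer z))"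
    by (simp add: wfun_def)
  also have "\<dots> = (exp (Ln (1 - z ^ \<mu>)) / exp (Ln (1 - z)) * exp (powser lnsinc_outer z)) ^ n"
    by (simp add: exp_of_nat_mult exp_add exp_diff)
  also have "\<dots> = ((1 - z ^ \<mu>) / (1 - z) * exp (powser lnsinc_outer z)) ^ n"
  proof -
    have "cmod (z ^ \<mu>) < 1" using assms by (simp add: norm_power power_less_one_iff)
    then have "1 - z ^ \<mu> \<noteq> 0" "1 - z \<noteq> 0" using z by force+
    then show ?thesis using exp_Ln by metis
  qed
  also have "(1 - z ^ \<mu>) / (1 - z) = (\<Sum>j<\<mu>. z ^ j)"
  proof -
    have "1 - z \<noteq> 0" using z by force
    then show ?thesis by (simp add: one_diff_power_eq[of z \<mu>])
  qed
  finally show ?thesis by (simp add: power_mult_distrib exp_of_nat_mult)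
qed

text \<open>
  The product on the right has absolutely summable coefficients; they are those of \<open>w\<^sub>\<mu>\<close>
  because both functions agree on the open disc.
\<close>

lemma wcoeff_outer:
  assumes "\<mu> > 0"
  shows "l1 (wcoeff n \<mu>)"
    and "\<And>z. cmod z \<le> 1 \<Longrightarrow> powser (wcoeff n \<mu>) z = (\<Sum>j<\<mu>. z ^ j) ^ n * exp (of_nat n * powser lnsinc_outer z)"
proof -
  define p where "p k = (if k < \<mu> then 1 else 0 :: complex)" for k
  have pz: "p k = 0" if "k \<ge> \<mu>" for k using that by (simp add: p_def)
  have p: "l1 p" "\<And>z. powser p z = (\<Sum>j<\<mu>. z ^ j)"
    using l1_finite[of \<mu> p] powser_finite[of \<mu> p] pz by (auto simp: p_def)
  obtain e where e: "l1 e" "\<And>z. cmod z \<le> 1 \<Longrightarrow> powser e z = exp (powser lnsinc_outer z)"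
    using l1_exp[OF l1_lnsinc_outer] by blast
  define W where "W = conv_pow (conv p e) n"
  have pe: "l1 (conv p e)" by (intro l1_conv p e)
  have W: "l1 W" "\<And>z. cmod z \<le> 1 \<Longrightarrow> powser W z = (\<Sum>j<\<mu>. z ^ j) ^ n * exp (of_nat n * powser lnsinc_outer z)"
    unfolding W_def using l1_conv_pow[OF pe] powser_conv_pow[OF pe]
    by (auto simp: powser_conv p e power_mult_distrib exp_of_nat_mult)
  have "wfun n \<mu> has_fps_expansion Abs_fps W"
    unfolding has_fps_expansion_def
  proof
    have "conv_radius W \<ge> norm (1 :: complex)"
      using l1_sums[OF W(1), of 1] by (intro conv_radius_geI) (auto simp: sums_iff)
    then show "0 < fps_conv_radius (Abs_fps W)"
      by (simp add: fps_conv_radius_def) (rule order_less_le_trans[of 0 "ereal 1"], simp_all)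
    have "\<forall>\<^sub>F z in nhds 0. z \<in> ball (0 :: complex) 1" by (rule eventually_nhds_in_open) auto
    then show "\<forall>\<^sub>F z in nhds 0. eval_fps (Abs_fps W) z = wfun n \<mu> z"
    proof eventually_elim
      case (elim z)
      then show ?case using W(2)[of z] wfun_eq[OF assms, of z n] by (simp add: eval_fps_def powser_def)
    qed
  qed
  then have "wcoeff n \<mu> = W"
    by (simp add: wcoeff_def[abs_def] fps_expansion_eqI fun_eq_iff)
  with W show "l1 (wcoeff n \<mu>)"
    "\<And>z. cmod z \<le> 1 \<Longrightarrow> powser (wcoeff n \<mu>) z = (\<Sum>j<\<mu>. z ^ j) ^ n * exp (of_nat n * powser lnsinc_outer z)"
    by auto
qed

lemma cmod_wcoeff_beta:
  assumes "\<mu> > 0"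
  shows "AE t in circ. cmod (powser (wcoeff n \<mu>) (cis (- t))) = cmod (beta n (int \<mu>) t)"
  using AE_circ_generic[OF assms]
proof eventually_elim
  case (elim t)
  define z where "z = cis (- t)"
  have cnj: "cmod (1 - cis (- s)) = cmod (1 - cis s)" for s
  proof -
    have "1 - cis (- s) = cnj (1 - cis s)" by (simp add: cis_cnj)
    then show ?thesis by (simp only: complex_mod_cnj)
  qed
  have zn: "z \<noteq> 1" using elim cnj[of t] unfolding z_def by (metis eq_iff_diff_eq_0 norm_eq_zero)
  have "cmod (\<Sum>j<\<mu>. z ^ j) = cmod (1 - z ^ \<mu>) / cmod (1 - z)"
    using one_diff_power_eq[of z \<mu>] zn by (simp add: norm_mult)
  also have "\<dots> = exp (logdist \<mu> t) / exp (logdist 1 t)"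
    using elim cnj[of t] cnj[of "real \<mu> * t"] by (simp add: z_def Complex.DeMoivre logdist_def)
  finally have 1: "cmod (\<Sum>j<\<mu>. z ^ j) = exp (logdist \<mu> t) / exp (logdist 1 t)" .
  have "Re (powser lnsinc_outer z) = lnsinc (- t)"
    unfolding z_def by (rule Re_lnsinc_outer) (use elim in auto)
  then have 2: "cmod (exp (powser lnsinc_outer z)) = exp (lnsinc t)" by (simp add: lnsinc_even)
  have "cmod (powser (wcoeff n \<mu>) z) = (cmod (\<Sum>j<\<mu>. z ^ j) * cmod (exp (powser lnsinc_outer z))) ^ n"
    using wcoeff_outer(2)[OF assms, of z n]
    by (simp add: z_def exp_of_nat_mult norm_mult norm_power power_mult_distrib)
  also have "\<dots> = exp (real n * (logdist \<mu> t - logdist 1 t + lnsinc t))"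
    unfolding 1 2 by (simp only: exp_of_nat_mult exp_add exp_diff)
  finally show ?case using cmod_beta[of t \<mu> n] elim by (simp add: z_def)
qed

text \<open>
  \<open>w\<^sub>\<mu>\<close> may vanish on the circle, so \<open>1/w\<^sub>\<mu>\<close> is only approximated, by
  \<open>((1 - z)/(1 - \<rho> z\<^sup>\<mu>))\<^sup>n exp(-n g(z))\<close>. Its product with \<open>w\<^sub>\<mu>\<close> is the \<open>n\<close>-th power of
  \<open>(1 - z\<^sup>\<mu>)/(1 - \<rho> z\<^sup>\<mu>)\<close>, which is bounded by \<open>2\<^sup>n\<close> and tends to \<open>1\<close> off the zeros as \<open>\<rho> \<rightarrow> 1\<close>.
\<close>

lemma wcoeff_approx_inverse:
  assumes "\<mu> > 0"
  obtains R :: "nat \<Rightarrow> nat \<Rightarrow> complex" where "\<And>j. l1 (R j)"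
    "\<And>j z. cmod z = 1 \<Longrightarrow> cmod (powser (R j) z * powser (wcoeff n \<mu>) z) \<le> 2 ^ n"
    "\<And>z. cmod z = 1 \<Longrightarrow> z ^ \<mu> \<noteq> 1 \<Longrightarrow> (\<lambda>j. powser (R j) z * powser (wcoeff n \<mu>) z) \<longlonglongrightarrow> 1"
proof -
  have "\<exists>x. l1 x \<and> (\<forall>z. cmod z \<le> 1 \<longrightarrow> powser x z = inverse (1 - of_real (damping j) * z ^ \<mu>))" for j
    using l1_geometric[of "of_real (damping j)" \<mu>] damping(1,2)[of j] assms by (metis abs_of_pos norm_of_real)
  then obtain g where g: "\<And>j. l1 (g j)" "\<And>j z. cmod z \<le> 1 \<Longrightarrow> powser (g j) z = inverse (1 - of_real (damping j) * z ^ \<mu>)"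
    by metis
  have l1m: "l1 (\<lambda>k. - lnsinc_outer k)" using l1_lnsinc_outer by (simp add: l1_def)
  have pm: "powser (\<lambda>k. - lnsinc_outer k) z = - powser lnsinc_outer z" if "cmod z \<le> 1" for z
    using sums_minus[OF l1_sums[OF l1_lnsinc_outer that]] by (simp add: powser_def sums_iff)
  obtain e where e: "l1 e" "\<And>z. cmod z \<le> 1 \<Longrightarrow> powser e z = exp (- powser lnsinc_outer z)"
    using l1_exp[OF l1m] pm by metis
  define q where "q k = (if k = 0 then 1 else if k = 1 then - 1 else 0 :: complex)" for k :: nat
  have qz: "q k = 0" if "k \<ge> 2" for k using that by (simp add: q_def)
  have q: "l1 q" "\<And>z. powser q z = 1 - z"
    using l1_finite[of 2 q] powser_finite[of 2 q] qz by (auto simp: q_def numeral_2_eq_2)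
  define R where "R j = conv_pow (conv (conv q (g j)) e) n" for j
  have l1R: "l1 (conv (conv q (g j)) e)" for j by (intro l1_conv q g e)
  have R: "l1 (R j)" for j unfolding R_def by (rule l1_conv_pow[OF l1R])
  have RW: "powser (R j) z * powser (wcoeff n \<mu>) z = ((1 - z ^ \<mu>) / (1 - of_real (damping j) * z ^ \<mu>)) ^ n"
    if "cmod z = 1" for j z
  proof -
    have le: "cmod z \<le> 1" using that by simp
    have "powser (R j) z = ((1 - z) * inverse (1 - of_real (damping j) * z ^ \<mu>) * exp (- powser lnsinc_outer z)) ^ n"
      unfolding R_def using le by (simp add: powser_conv_pow l1R powser_conv l1_conv q g e)
    then have "powser (R j) z * powser (wcoeff n \<mu>) z =
      (((1 - z) * (\<Sum>j<\<mu>. z ^ j)) * inverse (1 - of_real (damping j) * z ^ \<mu>) *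
       (exp (- powser lnsinc_outer z) * exp (powser lnsinc_outer z))) ^ n"
      using le by (simp add: wcoeff_outer(2)[OF assms] exp_of_nat_mult power_mult_distrib)
    also have "(1 - z) * (\<Sum>j<\<mu>. z ^ j) = 1 - z ^ \<mu>" by (simp add: one_diff_power_eq)
    also have "exp (- powser lnsinc_outer z) * exp (powser lnsinc_outer z) = 1"
      by (simp flip: exp_add)
    finally show ?thesis by (simp add: divide_inverse)
  qed
  show ?thesis
  proof (rule that[of R])
    show "l1 (R j)" for j by (rule R)
    fix z :: complex assume z: "cmod z = 1"
    then have zm: "cmod (z ^ \<mu>) = 1" by (simp add: norm_power)
    show "cmod (powser (R j) z * powser (wcoeff n \<mu>) z) \<le> 2 ^ n" for j
    proof -
      have "cmod (1 - z ^ \<mu>) / cmod (1 - of_real (damping j) * z ^ \<mu>) \<le> 2"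
      proof (cases "1 - of_real (damping j) * z ^ \<mu> = 0")
        case False
        then show ?thesis using damped_le[OF zm, of "damping j"] damping(1,2)[of j] by (simp add: divide_le_eq)
      qed simp
      then show ?thesis unfolding RW[OF z] norm_power norm_divide by (intro power_mono) auto
    qed
    assume nz: "z ^ \<mu> \<noteq> 1"
    have "(\<lambda>j. ((1 - z ^ \<mu>) / (1 - of_real (damping j) * z ^ \<mu>)) ^ n) \<longlonglongrightarrow> ((1 - z ^ \<mu>) / (1 - of_real 1 * z ^ \<mu>)) ^ n"
      using nz by (intro tendsto_intros damping(3)) auto
    then show "(\<lambda>j. powser (R j) z * powser (wcoeff n \<mu>) z) \<longlonglongrightarrow> 1"
      using nz by (simp add: RW[OF z])
  qed
qed

section \<open>The Hilbert space of a spectral density\<close>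

definition spectral_meas :: "(real \<Rightarrow> real) \<Rightarrow> real measure" where
  "spectral_meas f = density circ (\<lambda>t. ennreal (f t))"

lemma spectral_densityD:
  assumes "spectral_density f"
  shows "integrable circ f" "AE t in circ. 0 \<le> f t" "f \<in> borel_measurable circ"
  using assms by (auto simp: spectral_density_def)

lemma sets_spec [measurable_cong]: "sets (spectral_meas f) = sets circ"
  by (simp add: spectral_meas_def)

lemma space_spec [simp]: "space (spectral_meas f) = {-pi..pi}"
  by (simp add: spectral_meas_def)

lemma measurable_spec: "g \<in> borel_measurable (spectral_meas f) \<longleftrightarrow> g \<in> borel_measurable circ"
  using measurable_cong_sets[OF sets_spec[of f] refl] by blast

lemma integrable_spec:
  fixes g :: "real \<Rightarrow> 'b::{banach, second_countable_topology}"
  assumes f: "spectral_density f" and "g \<in> borel_measurable circ"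
  shows "integrable (spectral_meas f) g \<longleftrightarrow> integrable circ (\<lambda>t. f t *\<^sub>R g t)"
  unfolding spectral_meas_def using spectral_densityD[OF f] assms(2) by (intro integrable_density)

lemma integral_spec:
  fixes g :: "real \<Rightarrow> 'b::{banach, second_countable_topology}"
  assumes f: "spectral_density f" and "g \<in> borel_measurable circ"
  shows "integral\<^sup>L (spectral_meas f) g = (LINT t|circ. f t *\<^sub>R g t)"
  unfolding spectral_meas_def using spectral_densityD[OF f] assms(2) by (intro integral_density)

lemma AE_spec: "spectral_density f \<Longrightarrow> AE t in circ. P t \<Longrightarrow> AE t in spectral_meas f. P t"
  unfolding spectral_meas_def using spectral_densityD[of f] by (subst AE_density) auto

lemma finite_measure_spec: "spectral_density f \<Longrightarrow> finite_measure (spectral_meas f)"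
proof (rule finite_measureI)
  assume f: "spectral_density f"
  have "emeasure (spectral_meas f) (space (spectral_meas f)) = (\<integral>\<^sup>+t. ennreal (f t) * indicator {-pi..pi} t \<partial>circ)"
    unfolding spectral_meas_def using spectral_densityD(3)[OF f] by (subst emeasure_density) auto
  also have "\<dots> = (\<integral>\<^sup>+t. ennreal (f t) \<partial>circ)"
    by (intro nn_integral_cong) auto
  also have "\<dots> = ennreal (LINT t|circ. f t)"
    using spectral_densityD[OF f] by (intro nn_integral_eq_integral)
  finally show "emeasure (spectral_meas f) (space (spectral_meas f)) \<noteq> \<infinity>" by simp
qed

lemma measure_spec: "spectral_density f \<Longrightarrow> measure (spectral_meas f) (space (spectral_meas f)) = (LINT t|circ. f t)"
  using integral_spec[of f "\<lambda>_. 1::real"] by simp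

lemma L2_space_spec:
  assumes f: "spectral_density f"
  shows "g \<in> L2_space f \<longleftrightarrow> sq_integrable (spectral_meas f) g"
  unfolding L2_space_def sq_integrable_def measurable_spec
  using integrable_spec[OF f, of "\<lambda>t. (cmod (g t))\<^sup>2"] by (auto simp: mult.commute)

lemma l2sq_spec:
  assumes f: "spectral_density f" and "g \<in> borel_measurable circ"
  shows "l2sq (spectral_meas f) g = (LINT t|circ. (cmod (g t))\<^sup>2 * f t)"
  unfolding l2sq_def using integral_spec[OF f, of "\<lambda>t. (cmod (g t))\<^sup>2"] assms(2) by (simp add: mult.commute)

lemma (in finite_measure) sq_integrable_bounded:
  assumes "X \<in> borel_measurable M" "AE \<omega> in M. cmod (X \<omega>) \<le> C"
  shows "sq_integrable M X" "l2sq M X \<le> C\<^sup>2 * measure M (space M)"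
proof -
  show sq: "sq_integrable M X"
    by (rule sq_integrable_bound[of M "\<lambda>_. complex_of_real C"])
       (use assms in \<open>auto simp: sq_integrable_def elim!: eventually_mono\<close>)
  have "l2sq M X \<le> (LINT \<omega>|M. C\<^sup>2)"
    unfolding l2sq_def
    by (intro integral_mono_AE sq_integrable_integrable[OF sq])
       (use assms in \<open>auto elim!: eventually_mono intro!: power_mono\<close>)
  then show "l2sq M X \<le> C\<^sup>2 * measure M (space M)" by (simp add: mult.commute)
qed

lemma continuous_borel_circ: "continuous_on {-pi..pi} g \<Longrightarrow> (g :: real \<Rightarrow> complex) \<in> borel_measurable circ"
  using circ_integrable_continuous[of g] by auto

lemma beta_bound: "cmod (beta n \<mu> t) \<le> \<bar>real_of_int \<mu>\<bar> ^ n"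
proof -
  have "cmod (1 - cis (- (real_of_int \<mu> * t))) \<le> \<bar>real_of_int \<mu> * t\<bar>"
  proof -
    define x where "x = real_of_int \<mu> * t"
    have "(cmod (1 - cis (- x)))\<^sup>2 = 2 - 2 * cos x"
      by (simp add: cmod_power2 power2_diff cos_squared_eq)
    also have "\<dots> = (2 * sin (x / 2))\<^sup>2"
      using cos_double_sin[of "x / 2"] by (simp add: power_mult_distrib)
    also have "\<dots> \<le> \<bar>x\<bar>\<^sup>2"
      using abs_sin_x_le_abs_x[of "x / 2"] by (intro power2_le_iff_abs_le[THEN iffD2]) (auto simp: abs_mult)
    finally show ?thesis unfolding x_def by (rule power2_le_imp_le) simp
  qed
  then have "cmod (1 - cis (- (real_of_int \<mu> * t))) ^ n \<le> (\<bar>real_of_int \<mu>\<bar> * \<bar>t\<bar>) ^ n"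
    by (intro power_mono) (auto simp: abs_mult)
  then show ?thesis
    by (cases "t = 0")
       (cases n, auto simp: beta_def norm_divide norm_power norm_mult power_mult_distrib divide_le_eq)
qed

lemma beta_measurable [measurable]: "beta n \<mu> \<in> borel_measurable circ"
proof -
  have [measurable]: "(\<lambda>t. 1 - cis (- (real_of_int \<mu> * t))) \<in> borel_measurable borel"
    "(\<lambda>t. \<i> * complex_of_real t) \<in> borel_measurable borel"
    by (intro borel_measurable_continuous_onI continuous_intros)+
  have "beta n \<mu> \<in> borel_measurable borel" unfolding beta_def by measurable
  then show ?thesis by (intro measurable_restrict_space1 measurable_completion) simp
qed

lemma cis_measurable [measurable]: "(\<lambda>t. cis (c * t)) \<in> borel_measurable circ"
  by (intro continuous_borel_circ continuous_intros)

lemma sq_integrable_bounded_beta: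
  assumes f: "spectral_density f" and "g \<in> borel_measurable circ" "AE t in circ. cmod (g t) \<le> C" "C \<ge> 0"
  shows "sq_integrable (spectral_meas f) (\<lambda>t. g t * beta n \<mu> t)"
    and "l2sq (spectral_meas f) (\<lambda>t. g t * beta n \<mu> t) \<le> (C * \<bar>real_of_int \<mu>\<bar> ^ n)\<^sup>2 * (LINT t|circ. f t)"
proof -
  interpret finite_measure "spectral_meas f" by (rule finite_measure_spec[OF f])
  have m: "(\<lambda>t. g t * beta n \<mu> t) \<in> borel_measurable (spectral_meas f)"
    unfolding measurable_spec using assms(2) by measurable
  have b: "AE t in spectral_meas f. cmod (g t * beta n \<mu> t) \<le> C * \<bar>real_of_int \<mu>\<bar> ^ n"
    using AE_spec[OF f assms(3)]
    by eventually_elim (use assms(4) beta_bound in \<open>auto simp: norm_mult intro!: mult_mono\<close>)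
  show "sq_integrable (spectral_meas f) (\<lambda>t. g t * beta n \<mu> t)"
    "l2sq (spectral_meas f) (\<lambda>t. g t * beta n \<mu> t) \<le> (C * \<bar>real_of_int \<mu>\<bar> ^ n)\<^sup>2 * (LINT t|circ. f t)"
    using sq_integrable_bounded[OF m b] by (auto simp: measure_spec[OF f, simplified])
qed

section \<open>Stochastic integrals\<close>

lemma has_stoch_integral_alt:
  assumes f: "spectral_density f"
  shows "has_stoch_integral M Z f g X \<longleftrightarrow> sq_integrable (spectral_meas f) g \<and>
    (\<exists>s. (\<forall>N::nat. simple_function circ (s N)) \<and>
        (\<lambda>N. l2sq (spectral_meas f) (\<lambda>t. s N t - g t)) \<longlonglongrightarrow> 0 \<and>
        ms_tendsto M (\<lambda>N. simple_stoch_integral Z (s N)) X)"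
proof -
  have "(LINT t|circ. (cmod (s N t - g t))\<^sup>2 * f t) = l2sq (spectral_meas f) (\<lambda>t. s N t - g t)"
    if "simple_function circ (s N)" "sq_integrable (spectral_meas f) g" for s :: "nat \<Rightarrow> real \<Rightarrow> complex" and N
  proof -
    have [measurable]: "s N \<in> borel_measurable circ" "g \<in> borel_measurable circ"
      using that borel_measurable_simple_function sq_integrable_measurable[OF that(2)]
      by (auto simp: measurable_spec)
    show ?thesis by (rule l2sq_spec[OF f, symmetric]) measurable
  qed
  then show ?thesis
    unfolding has_stoch_integral_def L2_space_spec[OF f] by (auto cong: conj_cong)
qed

lemma sq_integrable_simple:
  assumes f: "spectral_density f" and s: "simple_function circ (s :: real \<Rightarrow> complex)"
  shows "sq_integrable (spectral_meas f) s"
proof -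
  interpret finite_measure "spectral_meas f" by (rule finite_measure_spec[OF f])
  have "finite (s ` {-pi..pi})" using s by (auto simp: simple_function_def)
  then have "bounded (s ` {-pi..pi})" by (rule finite_imp_bounded)
  then obtain C where C: "\<forall>x\<in>s ` {-pi..pi}. cmod x \<le> C" unfolding bounded_iff by blast
  have "s \<in> borel_measurable (spectral_meas f)"
    unfolding measurable_spec by (rule borel_measurable_simple_function[OF s])
  moreover have "AE t in spectral_meas f. cmod (s t) \<le> C" using C by (intro AE_I2) auto
  ultimately show ?thesis by (rule sq_integrable_bounded)
qed

lemma simple_dense:
  assumes f: "spectral_density f" and g: "sq_integrable (spectral_meas f) g"
  obtains s where "\<And>N::nat. simple_function circ (s N)" "(\<lambda>N. l2sq (spectral_meas f) (\<lambda>t. s N t - g t)) \<longlonglongrightarrow> 0"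
proof -
  have gm: "g \<in> borel_measurable circ" using sq_integrable_measurable[OF g] by (simp add: measurable_spec)
  obtain s where s: "\<And>i. simple_function circ (s i)" "\<And>t. t \<in> space circ \<Longrightarrow> (\<lambda>i. s i t) \<longlonglongrightarrow> g t"
      "\<And>i t. t \<in> space circ \<Longrightarrow> dist (s i t) 0 \<le> 2 * dist (g t) 0"
    using borel_measurable_implies_sequence_metric[OF gm, of 0] by blast
  have [measurable]: "s i \<in> borel_measurable (spectral_meas f)" for i
    unfolding measurable_spec by (rule borel_measurable_simple_function[OF s(1)])
  note [measurable] = sq_integrable_measurable[OF g]
  have "(\<lambda>i. LINT t|spectral_meas f. (cmod (s i t - g t))\<^sup>2) \<longlonglongrightarrow> (LINT t|spectral_meas f. 0)"
  proof (rule integral_dominated_convergence[where w="\<lambda>t. 10 * (cmod (g t))\<^sup>2"])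
    show "integrable (spectral_meas f) (\<lambda>t. 10 * (cmod (g t))\<^sup>2)"
      using sq_integrable_integrable[OF g] by simp
    show "AE t in spectral_meas f. (\<lambda>i. (cmod (s i t - g t))\<^sup>2) \<longlonglongrightarrow> 0"
    proof (rule AE_I2)
      fix t assume "t \<in> space (spectral_meas f)"
      then have "(\<lambda>i. (cmod (s i t - g t))\<^sup>2) \<longlonglongrightarrow> (cmod (g t - g t))\<^sup>2"
        by (intro tendsto_intros s) simp
      then show "(\<lambda>i. (cmod (s i t - g t))\<^sup>2) \<longlonglongrightarrow> 0" by simp
    qed
    show "AE t in spectral_meas f. norm ((cmod (s i t - g t))\<^sup>2) \<le> 10 * (cmod (g t))\<^sup>2" for i
    proof (rule AE_I2)
      fix t assume t: "t \<in> space (spectral_meas f)"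
      have "(cmod (s i t - g t))\<^sup>2 \<le> 2 * (cmod (s i t))\<^sup>2 + 2 * (cmod (g t))\<^sup>2"
        using cmod_sum_sq_le[of "s i t" "- g t"] by simp
      also have "(cmod (s i t))\<^sup>2 \<le> (2 * cmod (g t))\<^sup>2"
        using s(3)[of t i] t by (intro power_mono) auto
      finally show "norm ((cmod (s i t - g t))\<^sup>2) \<le> 10 * (cmod (g t))\<^sup>2" by simp
    qed
  qed measurable
  then show ?thesis using that[of s] s(1) by (simp add: l2sq_def)
qed

text \<open>
  Splitting both sets along their intersection reduces the covariance of the random measure to the
  variance on the intersection.
\<close>

lemma orthogonal_measure_l2ip:
  assumes Z: "orthogonal_measure M Z f" and S: "S \<in> sets circ" "T \<in> sets circ"
  shows "l2ip M (Z S) (Z T) = of_real (1 / (2 * pi) * (LINT t:S\<inter>T|circ. f t))"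
proof -
  have sq: "sq_integrable M (Z A)" if "A \<in> sets circ" for A using Z that by (auto simp: orthogonal_measure_def)
  have orth: "l2ip M (Z A) (Z B) = 0" if "A \<in> sets circ" "B \<in> sets circ" "A \<inter> B = {}" for A B
    using Z that by (auto simp: orthogonal_measure_def l2ip_def)
  have add: "AE \<omega> in M. Z (A \<union> B) \<omega> = Z A \<omega> + Z B \<omega>"
    if "A \<in> sets circ" "B \<in> sets circ" "A \<inter> B = {}" for A B
    using Z that by (auto simp: orthogonal_measure_def)
  define C where "C = S \<inter> T"
  have C: "C \<in> sets circ" "S - C \<in> sets circ" "T - C \<in> sets circ" using S by (auto simp: C_def)
  have "AE \<omega> in M. Z S \<omega> = Z C \<omega> + Z (S - C) \<omega>" "AE \<omega> in M. Z T \<omega> = Z C \<omega> + Z (T - C) \<omega>"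
    using add[OF C(1,2)] add[OF C(1,3)] by (auto simp: C_def Un_Diff_Int Int_commute Un_commute Un_absorb1)
  then have "l2ip M (Z S) (Z T) = l2ip M (\<lambda>\<omega>. Z C \<omega> + Z (S - C) \<omega>) (\<lambda>\<omega>. Z C \<omega> + Z (T - C) \<omega>)"
  proof -
    note [measurable] = sq[OF S(1), THEN sq_integrable_measurable] sq[OF S(2), THEN sq_integrable_measurable]
      sq[OF C(1), THEN sq_integrable_measurable] sq[OF C(2), THEN sq_integrable_measurable]
      sq[OF C(3), THEN sq_integrable_measurable]
    assume "AE \<omega> in M. Z S \<omega> = Z C \<omega> + Z (S - C) \<omega>" "AE \<omega> in M. Z T \<omega> = Z C \<omega> + Z (T - C) \<omega>"
    then have "AE \<omega> in M. Z S \<omega> * cnj (Z T \<omega>) = (Z C \<omega> + Z (S - C) \<omega>) * cnj (Z C \<omega> + Z (T - C) \<omega>)"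
      by eventually_elim simp
    then show ?thesis unfolding l2ip_def by (intro integral_cong_AE) measurable
  qed
  also have "\<dots> = l2ip M (Z C) (\<lambda>\<omega>. Z C \<omega> + Z (T - C) \<omega>) + l2ip M (Z (S - C)) (\<lambda>\<omega>. Z C \<omega> + Z (T - C) \<omega>)"
    by (intro l2ip_add_left sq_integrable_add sq C)
  also have "\<dots> = l2ip M (Z C) (Z C)"
  proof -
    have r: "l2ip M X (\<lambda>\<omega>. Z C \<omega> + Z (T - C) \<omega>) = l2ip M X (Z C) + l2ip M X (Z (T - C))" if "sq_integrable M X" for X
      by (intro l2ip_add_right sq C that)
    have "l2ip M (Z C) (Z (T - C)) = 0" "l2ip M (Z (S - C)) (Z C) = 0" "l2ip M (Z (S - C)) (Z (T - C)) = 0"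
      by (intro orth C; auto simp: C_def)+
    then show ?thesis by (simp add: r sq C)
  qed
  also have "\<dots> = of_real (1 / (2 * pi) * (LINT t:C|circ. f t))"
    using Z C by (simp add: l2sq_eq_l2ip[symmetric] orthogonal_measure_def l2sq_def)
  finally show ?thesis by (simp add: C_def)
qed

lemma simple_stoch_integral_l2ip:
  assumes f: "spectral_density f" and Z: "orthogonal_measure M Z f"
    and s: "simple_function circ s" "simple_function circ s'"
  shows "l2ip M (simple_stoch_integral Z s) (simple_stoch_integral Z s') = of_real (1 / (2 * pi)) * l2ip (spectral_meas f) s s'"
    and "sq_integrable M (simple_stoch_integral Z s)"
proof -
  define A where "A (r :: real \<Rightarrow> complex) y = {t\<in>{-pi..pi}. r t = y}" for r y
  have fin: "finite (r ` {-pi..pi})" and A: "A r y \<in> sets circ"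
    if "simple_function circ r" for r :: "real \<Rightarrow> complex" and y
  proof -
    show "finite (r ` {-pi..pi})" using that by (auto simp: simple_function_def)
    have "A r y = r -` {y} \<inter> space circ" by (auto simp: A_def)
    also have "\<dots> \<in> sets circ"
      using simple_functionD(2)[OF that] .
    finally show "A r y \<in> sets circ" .
  qed
  have sq: "sq_integrable M (Z B)" if "B \<in> sets circ" for B using Z that by (auto simp: orthogonal_measure_def)
  have eq: "simple_stoch_integral Z r = (\<lambda>\<omega>. \<Sum>y\<in>r ` {-pi..pi}. y * Z (A r y) \<omega>)" for r
    by (simp add: simple_stoch_integral_def[abs_def] A_def)
  show "sq_integrable M (simple_stoch_integral Z s)"
    unfolding eq by (intro sq_integrable_sum sq_integrable_cmult sq A s)
  have ind: "sq_integrable (spectral_meas f) (indicator B)" "(indicator B :: real \<Rightarrow> complex) \<in> borel_measurable circ" if "B \<in> sets circ" for B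
    using that by (auto intro!: sq_integrable_simple[OF f] simple_function_indicator)
  have ipind: "l2ip (spectral_meas f) (indicator B) (indicator C) = of_real (LINT t:B\<inter>C|circ. f t)"
    if BC: "B \<in> sets circ" "C \<in> sets circ" for B C
  proof -
    have "l2ip (spectral_meas f) (indicator B) (indicator C) = (LINT t|spectral_meas f. complex_of_real (indicator (B \<inter> C) t))"
      unfolding l2ip_def by (intro Bochner_Integration.integral_cong) (auto simp: indicator_def)
    also have "\<dots> = of_real (LINT t|spectral_meas f. indicator (B \<inter> C) t)" by (rule integral_complex_of_real)
    also have "(LINT t|spectral_meas f. indicator (B \<inter> C) t) = (LINT t:B\<inter>C|circ. f t)"
      using BC by (subst integral_spec[OF f]) (auto simp: set_lebesgue_integral_def mult.commute)
    finally show ?thesis .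
  qed
  have expand: "r t = (\<Sum>y\<in>r ` {-pi..pi}. y * indicator (A r y) t)"
    if "simple_function circ r" "t \<in> {-pi..pi}" for r t
  proof -
    have "(\<Sum>y\<in>r ` {-pi..pi}. y * indicator (A r y) t) = (\<Sum>y\<in>r ` {-pi..pi}. if y = r t then y else 0)"
      using that by (intro sum.cong) (auto simp: A_def indicator_def)
    also have "\<dots> = r t" using fin[OF that(1)] that(2) by (subst sum.delta) auto
    finally show ?thesis by simp
  qed
  have "l2ip (spectral_meas f) s s' = l2ip (spectral_meas f) (\<lambda>t. \<Sum>y\<in>s ` {-pi..pi}. y * indicator (A s y) t)
      (\<lambda>t. \<Sum>y\<in>s' ` {-pi..pi}. y * indicator (A s' y) t)"
    unfolding l2ip_def by (intro Bochner_Integration.integral_cong refl) (simp add: expand[OF s(1), symmetric] expand[OF s(2), symmetric])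
  also have "\<dots> = (\<Sum>y\<in>s ` {-pi..pi}. \<Sum>y'\<in>s' ` {-pi..pi}. y * cnj y' * l2ip (spectral_meas f) (indicator (A s y)) (indicator (A s' y')))"
    by (intro l2ip_sum_sum fin s ind A)
  also have "\<dots> = (\<Sum>y\<in>s ` {-pi..pi}. \<Sum>y'\<in>s' ` {-pi..pi}. y * cnj y' * of_real (LINT t:A s y \<inter> A s' y'|circ. f t))"
    by (simp add: ipind A s)
  finally have 1: "l2ip (spectral_meas f) s s' = \<dots>" .
  have "l2ip M (simple_stoch_integral Z s) (simple_stoch_integral Z s') =
      (\<Sum>y\<in>s ` {-pi..pi}. \<Sum>y'\<in>s' ` {-pi..pi}. y * cnj y' * l2ip M (Z (A s y)) (Z (A s' y')))"
    unfolding eq by (intro l2ip_sum_sum fin s sq A)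
  also have "\<dots> = of_real (1 / (2 * pi)) * l2ip (spectral_meas f) s s'"
    unfolding 1 by (simp add: orthogonal_measure_l2ip[OF Z] A s sum_distrib_left mult_ac)
  finally show "l2ip M (simple_stoch_integral Z s) (simple_stoch_integral Z s') = of_real (1 / (2 * pi)) * l2ip (spectral_meas f) s s'" .
qed

text \<open>
  The isometry is stated for inner products rather than norms: the integral of a linear combination
  is then never needed, only mean squares of linear combinations of integrals.
\<close>

lemma stoch_integral_l2ip:
  assumes f: "spectral_density f" and Z: "orthogonal_measure M Z f"
    and g: "has_stoch_integral M Z f g X" "has_stoch_integral M Z f g' X'"
  shows "l2ip M X X' = of_real (1 / (2 * pi)) * l2ip (spectral_meas f) g g'"
proof -
  obtain s where s: "\<And>N::nat. simple_function circ (s N)" "(\<lambda>N. l2sq (spectral_meas f) (\<lambda>t. s N t - g t)) \<longlonglongrightarrow> 0"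
    "ms_tendsto M (\<lambda>N. simple_stoch_integral Z (s N)) X" "sq_integrable (spectral_meas f) g"
    using g(1) unfolding has_stoch_integral_alt[OF f] by blast
  obtain s' where s': "\<And>N::nat. simple_function circ (s' N)" "(\<lambda>N. l2sq (spectral_meas f) (\<lambda>t. s' N t - g' t)) \<longlonglongrightarrow> 0"
    "ms_tendsto M (\<lambda>N. simple_stoch_integral Z (s' N)) X'" "sq_integrable (spectral_meas f) g'"
    using g(2) unfolding has_stoch_integral_alt[OF f] by blast
  have "(\<lambda>N. l2ip M (simple_stoch_integral Z (s N)) (simple_stoch_integral Z (s' N))) \<longlonglongrightarrow> l2ip M X X'"
    by (rule l2ip_tendsto) (use s(3) s'(3) in \<open>auto simp: ms_tendsto_def l2sq_def\<close>)
  moreover have "(\<lambda>N. of_real (1 / (2 * pi)) * l2ip (spectral_meas f) (s N) (s' N)) \<longlonglongrightarrow> of_real (1 / (2 * pi)) * l2ip (spectral_meas f) g g'"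
    by (intro tendsto_mult tendsto_const l2ip_tendsto sq_integrable_simple f s s')
  ultimately show ?thesis
    unfolding simple_stoch_integral_l2ip(1)[OF f Z s(1) s'(1)] by (rule LIMSEQ_unique)
qed

lemma has_stoch_integralD:
  assumes "spectral_density f" "has_stoch_integral M Z f g X"
  shows "sq_integrable M X" "sq_integrable (spectral_meas f) g"
  using assms by (auto simp: has_stoch_integral_alt ms_tendsto_def)

lemma stoch_integral_lincomb:
  assumes f: "spectral_density f" and Z: "orthogonal_measure M Z f" and "finite I"
    and g: "\<And>i. i \<in> I \<Longrightarrow> has_stoch_integral M Z f (g i) (X i)"
  shows "l2sq M (\<lambda>\<omega>. \<Sum>i\<in>I. c i * X i \<omega>) = 1 / (2 * pi) * l2sq (spectral_meas f) (\<lambda>t. \<Sum>i\<in>I. c i * g i t)"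
proof -
  have "l2ip M (\<lambda>\<omega>. \<Sum>i\<in>I. c i * X i \<omega>) (\<lambda>\<omega>. \<Sum>i\<in>I. c i * X i \<omega>) =
      (\<Sum>i\<in>I. \<Sum>j\<in>I. c i * cnj (c j) * l2ip M (X i) (X j))"
    by (intro l2ip_sum_sum assms(3) has_stoch_integralD(1)[OF f g])
  also have "\<dots> = (\<Sum>i\<in>I. \<Sum>j\<in>I. c i * cnj (c j) * (of_real (1 / (2 * pi)) * l2ip (spectral_meas f) (g i) (g j)))"
    by (intro sum.cong refl) (simp only: stoch_integral_l2ip[OF f Z g g])
  also have "\<dots> = of_real (1 / (2 * pi)) * (\<Sum>i\<in>I. \<Sum>j\<in>I. c i * cnj (c j) * l2ip (spectral_meas f) (g i) (g j))"
    by (simp add: sum_distrib_left mult_ac)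
  also have "(\<Sum>i\<in>I. \<Sum>j\<in>I. c i * cnj (c j) * l2ip (spectral_meas f) (g i) (g j)) =
      l2ip (spectral_meas f) (\<lambda>t. \<Sum>i\<in>I. c i * g i t) (\<lambda>t. \<Sum>i\<in>I. c i * g i t)"
    by (intro l2ip_sum_sum[symmetric] assms(3) has_stoch_integralD(2)[OF f g])
  finally show ?thesis
    unfolding l2sq_eq_l2ip[symmetric] of_real_mult[symmetric] of_real_eq_iff .
qed

lemma stoch_integral_diff:
  assumes f: "spectral_density f" and Z: "orthogonal_measure M Z f" and "finite I"
    and g: "\<And>i. i \<in> I \<Longrightarrow> has_stoch_integral M Z f (g i) (X i)" and h: "has_stoch_integral M Z f h Y"
  shows "l2sq M (\<lambda>\<omega>. (\<Sum>i\<in>I. c i * X i \<omega>) - Y \<omega>) =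
    1 / (2 * pi) * l2sq (spectral_meas f) (\<lambda>t. (\<Sum>i\<in>I. c i * g i t) - h t)"
proof -
  \<comment> \<open>The index \<open>None\<close> carries the subtracted integral, with coefficient \<open>-1\<close>.\<close>
  define c' where "c' = case_option (- 1) c"
  have eq: "(\<Sum>i\<in>insert None (Some ` I). c' i * case_option u v i) = (\<Sum>i\<in>I. c i * v i) - u" for u v
    using \<open>finite I\<close> by (simp add: c'_def sum.reindex)
  have "l2sq M (\<lambda>\<omega>. \<Sum>i\<in>insert None (Some ` I). c' i * (case i of None \<Rightarrow> Y | Some i \<Rightarrow> X i) \<omega>) =
    1 / (2 * pi) * l2sq (spectral_meas f) (\<lambda>t. \<Sum>i\<in>insert None (Some ` I). c' i * (case i of None \<Rightarrow> h | Some i \<Rightarrow> g i) t)"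
    using \<open>finite I\<close> g h by (intro stoch_integral_lincomb[OF f Z]) auto
  moreover have "(case i of None \<Rightarrow> Y | Some i \<Rightarrow> X i) \<omega> = case_option (Y \<omega>) (\<lambda>i. X i \<omega>) i" for i \<omega>
    by (cases i) auto
  moreover have "(case i of None \<Rightarrow> h | Some i \<Rightarrow> g i) t = case_option (h t) (\<lambda>i. g i t) i" for i t
    by (cases i) auto
  ultimately show ?thesis by (simp only: eq)
qed

text \<open>
  The integrals of approximating simple functions form a Cauchy sequence by the isometry.
\<close>

lemma stoch_integral_exists:
  assumes f: "spectral_density f" and Z: "orthogonal_measure M Z f" and g: "sq_integrable (spectral_meas f) g"
  obtains X where "has_stoch_integral M Z f g X"
proof -
  obtain s where s: "\<And>N::nat. simple_function circ (s N)" "(\<lambda>N. l2sq (spectral_meas f) (\<lambda>t. s N t - g t)) \<longlonglongrightarrow> 0"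
    using simple_dense[OF f g] by blast
  let ?I = "\<lambda>N. simple_stoch_integral Z (s N)"
  have sq: "sq_integrable M (?I N)" for N by (rule simple_stoch_integral_l2ip(2)[OF f Z s(1) s(1)])
  have sqs: "sq_integrable (spectral_meas f) (s N)" for N by (rule sq_integrable_simple[OF f s(1)])
  have iso: "l2sq M (\<lambda>\<omega>. ?I j \<omega> - ?I k \<omega>) = 1 / (2 * pi) * l2sq (spectral_meas f) (\<lambda>t. s j t - s k t)" for j k
  proof -
    have "complex_of_real (l2sq M (\<lambda>\<omega>. ?I j \<omega> - ?I k \<omega>)) =
        l2ip M (?I j) (?I j) - l2ip M (?I j) (?I k) - (l2ip M (?I k) (?I j) - l2ip M (?I k) (?I k))"
      by (simp add: l2sq_eq_l2ip l2ip_diff_left l2ip_diff_right sq sq_integrable_diff)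
    also have "\<dots> = of_real (1 / (2 * pi)) * (l2ip (spectral_meas f) (s j) (s j) - l2ip (spectral_meas f) (s j) (s k) -
        (l2ip (spectral_meas f) (s k) (s j) - l2ip (spectral_meas f) (s k) (s k)))"
      by (simp only: simple_stoch_integral_l2ip(1)[OF f Z s(1) s(1)] right_diff_distrib)
    also have "\<dots> = of_real (1 / (2 * pi)) * of_real (l2sq (spectral_meas f) (\<lambda>t. s j t - s k t))"
      by (simp add: l2sq_eq_l2ip l2ip_diff_left l2ip_diff_right sqs sq_integrable_diff)
    finally show ?thesis by (simp only: of_real_mult[symmetric] of_real_eq_iff)
  qed
  have cauchy: "\<exists>N. \<forall>j\<ge>N. \<forall>k\<ge>N. l2sq M (\<lambda>\<omega>. ?I j \<omega> - ?I k \<omega>) < e" if "e > 0" for e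
  proof -
    have "\<forall>\<^sub>F N in sequentially. l2sq (spectral_meas f) (\<lambda>t. s N t - g t) < e / 4"
      using s(2) that by (intro order_tendstoD(2)) auto
    then obtain N where N: "\<And>k. k \<ge> N \<Longrightarrow> l2sq (spectral_meas f) (\<lambda>t. s k t - g t) < e / 4"
      unfolding eventually_sequentially by blast
    have "l2sq M (\<lambda>\<omega>. ?I j \<omega> - ?I k \<omega>) < e" if "j \<ge> N" "k \<ge> N" for j k
    proof -
      have "1 / (2 * pi) \<le> 1" using pi_gt3 by simp
      then have "l2sq M (\<lambda>\<omega>. ?I j \<omega> - ?I k \<omega>) \<le> 1 * l2sq (spectral_meas f) (\<lambda>t. s j t - s k t)"
        unfolding iso by (intro mult_right_mono) auto
      also have "\<dots> \<le> 2 * l2sq (spectral_meas f) (\<lambda>t. s j t - g t) + 2 * l2sq (spectral_meas f) (\<lambda>t. g t - s k t)"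
        using l2sq_triangle[OF sqs g sqs] by simp
      also have "\<dots> < e"
        using N[OF that(1)] N[OF that(2)] by (simp add: l2sq_minus_commute[of _ g])
      finally show ?thesis .
    qed
    then show ?thesis by blast
  qed
  obtain X where X: "sq_integrable M X" "(\<lambda>N. l2sq M (\<lambda>\<omega>. ?I N \<omega> - X \<omega>)) \<longlonglongrightarrow> 0"
    using l2sq_complete[where M=M and X="?I", OF sq cauchy] by blast
  have "ms_tendsto M ?I X" using X sq by (simp add: ms_tendsto_def l2sq_def)
  then have "has_stoch_integral M Z f g X"
    unfolding has_stoch_integral_alt[OF f] using g s by blast
  then show ?thesis by (rule that)
qed

section \<open>A sequence with a prescribed spectral density\<close>

text \<open>
  The mean square error is defined through sequences whose sample space is the real line, and one
  has to exist for each density. The probability space is \<open>[-\<pi>,\<pi>]\<close> with the uniform distribution,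
  times a fair sign. The random measure \<open>Z(S)\<close> is the sign times the indicator of \<open>S\<close> times
  \<open>sqrt (f t)\<close>, and the stochastic integral of \<open>g\<close> is the sign times \<open>g(t) sqrt (f t)\<close>; the sign is
  there to make all means vanish. The pairs are coded injectively by real numbers: \<open>arctan\<close> takes
  values in an interval shorter than the shift \<open>10\<close>.
\<close>

definition code_point :: "real \<times> bool \<Rightarrow> real" where
  "code_point p = arctan (fst p) + (if snd p then 10 else 0)"

lemma inj_code_point: "inj code_point"
proof (rule injI)
  fix p q :: "real \<times> bool" assume eq: "code_point p = code_point q"
  have b: "\<bar>arctan x\<bar> < 2" for x
    using arctan_lbound[of x] arctan_ubound[of x] pi_less_4 by linarith
  have "snd p = snd q"
    using eq b[of "fst p"] b[of "fst q"] unfolding code_point_def by (cases "snd p"; cases "snd q") auto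
  moreover from this have "fst p = fst q" using eq by (auto simp: code_point_def arctan_eq_iff)
  ultimately show "p = q" by (rule prod_eqI[rotated])
qed

definition circ_prob :: "real measure" where
  "circ_prob = density circ (\<lambda>_. ennreal (1 / (2 * pi)))"

definition sign_prob :: "(real \<times> bool) measure" where
  "sign_prob = circ_prob \<Otimes>\<^sub>M measure_pmf (pmf_of_set UNIV)"

definition model :: "real measure" where
  "model = embed_measure sign_prob code_point"

text \<open>
  The indicator makes \<open>sign_lift G\<close> depend on \<open>G\<close> only through its restriction to \<open>[-\<pi>,\<pi>]\<close>, so that
  identities between lifts hold everywhere and not just on the space of the measure.
\<close>

definition sign_lift :: "(real \<Rightarrow> complex) \<Rightarrow> real \<Rightarrow> complex" where
  "sign_lift G \<omega> = (case inv code_point \<omega> of (t, b) \<Rightarrow>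
     (if b then 1 else - 1) * (indicator {-pi..pi} t * G t))"

lemma prob_circ_prob: "prob_space circ_prob"
proof
  have "emeasure circ_prob (space circ_prob) = (\<integral>\<^sup>+t. ennreal (1 / (2 * pi)) * indicator {-pi..pi} t \<partial>circ)"
    unfolding circ_prob_def by (subst emeasure_density) auto
  also have "\<dots> = (\<integral>\<^sup>+t. ennreal (1 / (2 * pi)) \<partial>circ)" by (intro nn_integral_cong) auto
  also have "\<dots> = ennreal (1 / (2 * pi)) * ennreal (2 * pi)" by (simp add: emeasure_restrict_space)
  also have "\<dots> = 1" by (subst ennreal_mult[symmetric]) auto
  finally show "emeasure circ_prob (space circ_prob) = 1" .
qed

lemma sets_circ_prob [measurable_cong]: "sets circ_prob = sets circ"
  by (simp add: circ_prob_def)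

lemma prob_sign_prob: "prob_space sign_prob"
proof -
  interpret A: prob_space circ_prob by (rule prob_circ_prob)
  interpret AB: pair_prob_space circ_prob "measure_pmf (pmf_of_set (UNIV :: bool set))" ..
  show ?thesis unfolding sign_prob_def by (rule AB.prob_space_axioms)
qed

lemma model_distr: "model = distr sign_prob model code_point"
  unfolding model_def by (rule embed_measure_eq_distr[OF inj_code_point])

lemma code_point_measurable [measurable]: "code_point \<in> measurable sign_prob model"
  unfolding model_def by (rule measurable_embed_measure2[OF inj_code_point])

lemma prob_model: "prob_space model"
  by (subst model_distr, rule prob_space.prob_space_distr[OF prob_sign_prob code_point_measurable])

lemma sign_lift_code: "sign_lift G (code_point (t, b)) = (if b then 1 else - 1) * (indicator {-pi..pi} t * G t)"
  by (simp add: sign_lift_def inv_f_f[OF inj_code_point])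

lemma fst_sign_measurable: "G \<in> borel_measurable circ \<Longrightarrow> (\<lambda>p. G (fst p)) \<in> borel_measurable sign_prob"
  unfolding sign_prob_def
  by (rule measurable_compose[of fst _ circ_prob G, OF measurable_fst])
     (simp add: measurable_cong_sets[OF sets_circ_prob refl])

lemma sign_lift_measurable:
  assumes "G \<in> borel_measurable circ" shows "sign_lift G \<in> borel_measurable model"
  unfolding model_def
proof (rule measurable_embed_measure1)
  have "(\<lambda>t. indicator {-pi..pi} t * G t) \<in> borel_measurable circ"
    by (intro borel_measurable_times borel_measurable_indicator assms) auto
  from fst_sign_measurable[OF this]
  have [measurable]: "(\<lambda>p. indicator {-pi..pi} (fst p) * G (fst p)) \<in> borel_measurable sign_prob" .
  have [measurable]: "(\<lambda>p. (if snd p then 1 else - 1) :: complex) \<in> borel_measurable sign_prob"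
    unfolding sign_prob_def by (rule measurable_compose[OF measurable_snd]) simp
  have "(\<lambda>p. (if snd p then 1 else - 1) * (indicator {-pi..pi} (fst p) * G (fst p))) \<in> borel_measurable sign_prob"
    by measurable
  then show "(\<lambda>p. sign_lift G (code_point p)) \<in> borel_measurable sign_prob"
    by (simp add: sign_lift_code split_beta' flip: split_paired_all) (simp add: sign_lift_def inv_f_f[OF inj_code_point] split_beta')
qed

lemma integral_model_fst:
  fixes G :: "real \<Rightarrow> 'b::{banach, second_countable_topology}"
  assumes G: "G \<in> borel_measurable circ" and X: "X \<in> borel_measurable model"
    and eq: "\<And>t b. t \<in> {-pi..pi} \<Longrightarrow> X (code_point (t, b)) = G t"
  shows "integral\<^sup>L model X = (1 / (2 * pi)) *\<^sub>R (LINT t|circ. G t)"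
    and "integrable model X \<longleftrightarrow> integrable circ G"
proof -
  have Gm: "G \<in> borel_measurable circ_prob" using G by (simp add: measurable_cong_sets[OF sets_circ_prob refl])
  have fstm: "fst \<in> measurable sign_prob circ_prob" unfolding sign_prob_def by (rule measurable_fst)
  have sp: "space sign_prob = {-pi..pi} \<times> UNIV"
    by (simp add: sign_prob_def space_pair_measure circ_prob_def)
  have "integral\<^sup>L model X = (LINT p|sign_prob. X (code_point p))"
    by (subst model_distr, rule integral_distr[OF code_point_measurable X])
  also have "\<dots> = (LINT p|sign_prob. G (fst p))"
    by (intro Bochner_Integration.integral_cong refl) (auto simp: sp eq)
  also have "\<dots> = integral\<^sup>L (distr sign_prob circ_prob fst) G"
    by (rule integral_distr[symmetric, OF fstm Gm])
  also have "distr sign_prob circ_prob fst = circ_prob"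
    unfolding sign_prob_def by (rule measure_pmf.distr_pair_fst)
  also have "integral\<^sup>L circ_prob G = (1 / (2 * pi)) *\<^sub>R (LINT t|circ. G t)"
    unfolding circ_prob_def using G by (subst integral_density) auto
  finally show "integral\<^sup>L model X = (1 / (2 * pi)) *\<^sub>R (LINT t|circ. G t)" .
  have "integrable model X \<longleftrightarrow> integrable sign_prob (\<lambda>p. X (code_point p))"
    by (subst model_distr, rule integrable_distr_eq[OF code_point_measurable X])
  also have "\<dots> \<longleftrightarrow> integrable sign_prob (\<lambda>p. G (fst p))"
    by (intro Bochner_Integration.integrable_cong refl) (auto simp: sp eq)
  also have "\<dots> \<longleftrightarrow> integrable (distr sign_prob circ_prob fst) G"
    by (rule integrable_distr_eq[symmetric, OF fstm Gm])
  also have "distr sign_prob circ_prob fst = circ_prob"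
    unfolding sign_prob_def by (rule measure_pmf.distr_pair_fst)
  also have "integrable circ_prob G \<longleftrightarrow> integrable circ G"
  proof
    assume "integrable circ_prob G"
    then have "integrable circ (\<lambda>t. (1 / (2 * pi)) *\<^sub>R G t)"
      unfolding circ_prob_def using G by (subst (asm) integrable_density) auto
    from integrable_scaleR_right[OF this, of "2 * pi"] show "integrable circ G" by simp
  next
    assume "integrable circ G"
    then show "integrable circ_prob G"
      unfolding circ_prob_def using G by (subst integrable_density) auto
  qed
  finally show "integrable model X \<longleftrightarrow> integrable circ G" .
qed

lemma sign_lift_mult_cnj:
  assumes "G \<in> borel_measurable circ" "G' \<in> borel_measurable circ"
  shows "l2ip model (sign_lift G) (sign_lift G') = of_real (1 / (2 * pi)) * l2ip circ G G'"
proof -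
  note [measurable] = assms sign_lift_measurable[OF assms(1)] sign_lift_measurable[OF assms(2)]
  show ?thesis
    unfolding l2ip_def
    by (subst integral_model_fst(1)[where G="\<lambda>t. G t * cnj (G' t)"]) (auto simp: sign_lift_code scaleR_conv_of_real)
qed

lemma sq_integrable_lift:
  assumes "sq_integrable circ G" shows "sq_integrable model (sign_lift G)"
  unfolding sq_integrable_def
proof
  note [measurable] = sq_integrable_measurable[OF assms] sign_lift_measurable[OF sq_integrable_measurable[OF assms]]
  show "sign_lift G \<in> borel_measurable model" by measurable
  show "integrable model (\<lambda>\<omega>. (cmod (sign_lift G \<omega>))\<^sup>2)"
    using assms
    by (subst integral_model_fst(2)[where G="\<lambda>t. (cmod (G t))\<^sup>2"]) (auto simp: sign_lift_code sq_integrable_def norm_mult)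
qed

lemma integral_lift:
  assumes G: "sq_integrable circ G"
  shows "integrable model (sign_lift G)" "integral\<^sup>L model (sign_lift G) = 0"
proof -
  interpret prob_space model by (rule prob_model)
  have "integrable model (\<lambda>\<omega>. sign_lift G \<omega> * cnj 1)"
    using sq_integrable_lift[OF G] sq_integrable_bounded(1)[of "\<lambda>_. 1" 1] by (intro sq_integrable_mult) auto
  then show i: "integrable model (sign_lift G)" by simp
  interpret A: prob_space circ_prob by (rule prob_circ_prob)
  interpret PQ: pair_sigma_finite circ_prob "measure_pmf (pmf_of_set (UNIV :: bool set))" ..
  note m = sign_lift_measurable[OF sq_integrable_measurable[OF G]]
  have i': "integrable sign_prob (\<lambda>p. sign_lift G (code_point p))"
    using i by (subst (asm) model_distr, subst (asm) integrable_distr_eq[OF code_point_measurable m])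
  have "integral\<^sup>L model (sign_lift G) = (LINT p|sign_prob. sign_lift G (code_point p))"
    by (subst model_distr, rule integral_distr[OF code_point_measurable m])
  also have "\<dots> = (LINT t|circ_prob. LINT b|measure_pmf (pmf_of_set UNIV). sign_lift G (code_point (t, b)))"
    using i' unfolding sign_prob_def by (rule PQ.integral_fst'[symmetric])
  also have "\<dots> = (LINT t|circ_prob. 0)"
  proof (intro Bochner_Integration.integral_cong refl)
    fix t
    have "(LINT b|measure_pmf (pmf_of_set UNIV). sign_lift G (code_point (t, b))) =
        (\<Sum>b\<in>UNIV. pmf (pmf_of_set UNIV) b *\<^sub>R sign_lift G (code_point (t, b)))"
      by (rule integral_measure_pmf) auto
    then show "(LINT b|measure_pmf (pmf_of_set UNIV). sign_lift G (code_point (t, b))) = 0"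
      by (simp add: UNIV_bool sign_lift_code)
  qed
  finally show "integral\<^sup>L model (sign_lift G) = 0" by simp
qed

lemma sign_lift_add: "sign_lift (\<lambda>t. G t + G' t) \<omega> = sign_lift G \<omega> + sign_lift G' \<omega>"
  by (simp add: sign_lift_def split_beta' algebra_simps)

lemma sign_lift_cmult: "sign_lift (\<lambda>t. c * G t) \<omega> = c * sign_lift G \<omega>"
  by (simp add: sign_lift_def split_beta' algebra_simps)

lemma sign_lift_sum: "sign_lift (\<lambda>t. \<Sum>i\<in>I. G i t) \<omega> = (\<Sum>i\<in>I. sign_lift (G i) \<omega>)"
  by (simp add: sign_lift_def split_beta' sum_distrib_left)

lemma sign_lift_cong: "(\<And>t. t \<in> {-pi..pi} \<Longrightarrow> G t = G' t) \<Longrightarrow> sign_lift G = sign_lift G'"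
  by (auto simp: sign_lift_def split_beta' fun_eq_iff indicator_def)

context
  fixes f :: "real \<Rightarrow> real"
  assumes f: "spectral_density f"
begin

definition root_density :: "real \<Rightarrow> complex" where
  "root_density t = complex_of_real (sqrt (f t))"

lemma root_density_measurable [measurable]: "root_density \<in> borel_measurable circ"
  using spectral_densityD(3)[OF f] unfolding root_density_def by measurable

lemma root_density_l2ip:
  assumes [measurable]: "g \<in> borel_measurable circ" "g' \<in> borel_measurable circ"
  shows "l2ip circ (\<lambda>t. g t * root_density t) (\<lambda>t. g' t * root_density t) = l2ip (spectral_meas f) g g'"
proof -
  have "l2ip (spectral_meas f) g g' = (LINT t|circ. f t *\<^sub>R (g t * cnj (g' t)))"
    unfolding l2ip_def by (rule integral_spec[OF f]) measurable
  also have "\<dots> = l2ip circ (\<lambda>t. g t * root_density t) (\<lambda>t. g' t * root_density t)"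
    unfolding l2ip_def
  proof (intro integral_cong_AE)
    show "AE t in circ. f t *\<^sub>R (g t * cnj (g' t)) = g t * root_density t * cnj (g' t * root_density t)"
      using spectral_densityD(2)[OF f]
    proof eventually_elim
      case (elim t)
      then have "root_density t * cnj (root_density t) = complex_of_real (f t)"
        by (simp add: root_density_def flip: of_real_mult)
      then show ?case by (simp add: scaleR_conv_of_real mult_ac)
    qed
  qed (use spectral_densityD(3)[OF f] in measurable)
  finally show ?thesis by simp
qed

lemma root_density_sq:
  assumes "sq_integrable (spectral_meas f) g"
  shows "sq_integrable circ (\<lambda>t. g t * root_density t)"
  unfolding sq_integrable_def
proof
  have [measurable]: "g \<in> borel_measurable circ" using sq_integrable_measurable[OF assms] by (simp add: measurable_spec)
  show "(\<lambda>t. g t * root_density t) \<in> borel_measurable circ" by measurable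
  have "integrable circ (\<lambda>t. f t *\<^sub>R (cmod (g t))\<^sup>2)"
    using sq_integrable_integrable[OF assms] by (subst (asm) integrable_spec[OF f]) auto
  then show "integrable circ (\<lambda>t. (cmod (g t * root_density t))\<^sup>2)"
  proof (rule integrable_cong_AE_imp)
    show "AE t in circ. f t *\<^sub>R (cmod (g t))\<^sup>2 = (cmod (g t * root_density t))\<^sup>2"
      using spectral_densityD(2)[OF f]
      by eventually_elim (simp add: root_density_def norm_mult power_mult_distrib)
  qed measurable
qed

definition model_integral :: "(real \<Rightarrow> complex) \<Rightarrow> real \<Rightarrow> complex" where
  "model_integral g = sign_lift (\<lambda>t. g t * root_density t)"

lemma model_integral_l2ip:
  "g \<in> borel_measurable circ \<Longrightarrow> g' \<in> borel_measurable circ \<Longrightarrow>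
     l2ip model (model_integral g) (model_integral g') = of_real (1 / (2 * pi)) * l2ip (spectral_meas f) g g'"
  unfolding model_integral_def by (subst sign_lift_mult_cnj) (simp_all add: root_density_l2ip)

lemma model_integral_sq: "sq_integrable (spectral_meas f) g \<Longrightarrow> sq_integrable model (model_integral g)"
  unfolding model_integral_def by (intro sq_integrable_lift root_density_sq)

lemma model_integral_l2sq:
  "g \<in> borel_measurable circ \<Longrightarrow> l2sq model (model_integral g) = 1 / (2 * pi) * l2sq (spectral_meas f) g"
  using model_integral_l2ip[of g g] unfolding l2sq_eq_l2ip[symmetric] of_real_mult[symmetric] of_real_eq_iff by simp

lemma model_integral_cmult: "model_integral (\<lambda>t. c * g t) \<omega> = c * model_integral g \<omega>"
  unfolding model_integral_def mult.assoc by (rule sign_lift_cmult)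

lemma model_integral_sum: "model_integral (\<lambda>t. \<Sum>i\<in>I. g i t) \<omega> = (\<Sum>i\<in>I. model_integral (g i) \<omega>)"
  unfolding model_integral_def sum_distrib_right by (rule sign_lift_sum)

lemma model_integral_diff: "model_integral (\<lambda>t. g t - g' t) \<omega> = model_integral g \<omega> - model_integral g' \<omega>"
  by (simp add: model_integral_def sign_lift_def split_beta' algebra_simps)

definition model_noise :: "real set \<Rightarrow> real \<Rightarrow> complex" where
  "model_noise S = model_integral (indicator S)"

text \<open>
  \<open>\<xi>(m)\<close> itself need not be square integrable, because of the pole of \<open>1/(it)\<^sup>n\<close> at \<open>0\<close>; only its increments are,
  where the pole is cancelled.
\<close>

definition model_sequence :: "nat \<Rightarrow> int \<Rightarrow> real \<Rightarrow> complex" where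
  "model_sequence n m = model_integral (\<lambda>t. cis (real_of_int m * t) / (\<i> * complex_of_real t) ^ n)"

lemma model_noise_orthogonal: "orthogonal_measure model model_noise f"
  unfolding orthogonal_measure_def
proof (intro conjI ballI impI)
  fix S assume S: "S \<in> sets circ"
  have ind: "(indicator S :: real \<Rightarrow> complex) \<in> borel_measurable circ" if "S \<in> sets circ" for S using that by simp
  have sq: "sq_integrable (spectral_meas f) (indicator S)" if "S \<in> sets circ" for S
    by (intro sq_integrable_simple f simple_function_indicator that)
  show "sq_integrable model (model_noise S)" unfolding model_noise_def by (intro model_integral_sq sq S)
  have "(LINT \<omega>|model. (cmod (model_noise S \<omega>))\<^sup>2) = 1 / (2 * pi) * l2sq (spectral_meas f) (indicator S)"
    using model_integral_l2sq[OF ind[OF S]] by (simp add: model_noise_def l2sq_def)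
  also have "l2sq (spectral_meas f) (indicator S) = (LINT t:S|circ. f t)"
    unfolding l2sq_spec[OF f ind[OF S]] set_lebesgue_integral_def
    by (intro Bochner_Integration.integral_cong) (auto simp: indicator_def)
  finally show "(LINT \<omega>|model. (cmod (model_noise S \<omega>))\<^sup>2) = 1 / (2 * pi) * (LINT t:S|circ. f t)" .
  fix T assume T: "T \<in> sets circ" and disj: "S \<inter> T = {}"
  have "model_noise (S \<union> T) \<omega> = model_noise S \<omega> + model_noise T \<omega>" for \<omega>
    unfolding model_noise_def model_integral_def sign_lift_add[symmetric]
    by (rule fun_cong[OF sign_lift_cong]) (use disj in \<open>auto simp: indicator_def\<close>)
  then show "AE \<omega> in model. model_noise (S \<union> T) \<omega> = model_noise S \<omega> + model_noise T \<omega>" by simp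
  have "l2ip model (model_noise S) (model_noise T) = of_real (1 / (2 * pi)) * l2ip (spectral_meas f) (indicator S) (indicator T)"
    unfolding model_noise_def by (rule model_integral_l2ip[OF ind[OF S] ind[OF T]])
  also have "l2ip (spectral_meas f) (indicator S) (indicator T) = (LINT t|spectral_meas f. 0)"
    unfolding l2ip_def using disj by (intro Bochner_Integration.integral_cong) (auto simp: indicator_def)
  finally show "(LINT \<omega>|model. model_noise S \<omega> * cnj (model_noise T \<omega>)) = 0" by (simp add: l2ip_def)
qed

lemma model_simple_integral:
  assumes "simple_function circ s"
  shows "simple_stoch_integral model_noise s = model_integral s"
proof
  fix \<omega>
  have fin: "finite (s ` {-pi..pi})" using assms by (auto simp: simple_function_def)
  have "simple_stoch_integral model_noise s \<omega> =
      model_integral (\<lambda>t. \<Sum>y\<in>s ` {-pi..pi}. y * indicator {t \<in> {-pi..pi}. s t = y} t) \<omega>"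
    unfolding simple_stoch_integral_def model_noise_def model_integral_sum model_integral_cmult ..
  also have "\<dots> = model_integral s \<omega>"
    unfolding model_integral_def
  proof (rule fun_cong[OF sign_lift_cong])
    fix t assume t: "t \<in> {-pi..pi}"
    have "(\<Sum>y\<in>s ` {-pi..pi}. y * indicator {t \<in> {-pi..pi}. s t = y} t) = (\<Sum>y\<in>s ` {-pi..pi}. if y = s t then y else 0)"
      using t by (intro sum.cong) (auto simp: indicator_def)
    also have "\<dots> = s t" using fin t by (subst sum.delta) auto
    finally show "(\<Sum>y\<in>s ` {-pi..pi}. y * indicator {t \<in> {-pi..pi}. s t = y} t) * root_density t = s t * root_density t"
      by simp
  qed
  finally show "simple_stoch_integral model_noise s \<omega> = model_integral s \<omega>" .
qed

lemma model_stoch_integral: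
  assumes g: "sq_integrable (spectral_meas f) g"
  shows "has_stoch_integral model model_noise f g (model_integral g)"
proof -
  obtain s where s: "\<And>N::nat. simple_function circ (s N)" "(\<lambda>N. l2sq (spectral_meas f) (\<lambda>t. s N t - g t)) \<longlonglongrightarrow> 0"
    using simple_dense[OF f g] by blast
  have [measurable]: "g \<in> borel_measurable circ" "s N \<in> borel_measurable circ" for N
    using sq_integrable_measurable[OF g] borel_measurable_simple_function[OF s(1)] by (auto simp: measurable_spec)
  have "l2sq model (\<lambda>\<omega>. model_integral (s N) \<omega> - model_integral g \<omega>) = 1 / (2 * pi) * l2sq (spectral_meas f) (\<lambda>t. s N t - g t)" for N
    unfolding model_integral_diff[symmetric] by (rule model_integral_l2sq) measurable
  moreover have "(\<lambda>N. 1 / (2 * pi) * l2sq (spectral_meas f) (\<lambda>t. s N t - g t)) \<longlonglongrightarrow> 1 / (2 * pi) * 0"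
    by (intro tendsto_mult tendsto_const s)
  ultimately have "ms_tendsto model (\<lambda>N. simple_stoch_integral model_noise (s N)) (model_integral g)"
    unfolding ms_tendsto_def model_simple_integral[OF s(1)]
    by (simp add: model_integral_sq g sq_integrable_simple f s(1) l2sq_def)
  then show ?thesis
    unfolding has_stoch_integral_alt[OF f] using g s by blast
qed

text \<open>
  The binomial theorem turns the \<open>n\<close>-th difference of \<open>exp(imt)\<close> into the factor
  \<open>(1 - exp(-i\<mu>t))\<^sup>n\<close>.
\<close>

lemma model_incr:
  "incr n \<mu> (model_sequence n) m = model_integral (\<lambda>t. cis (real_of_int m * t) * beta n \<mu> t)"
proof
  fix \<omega>
  have "incr n \<mu> (model_sequence n) m \<omega> = model_integral (\<lambda>t. \<Sum>l\<le>n. (- 1) ^ l * of_nat (n choose l) *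
     (cis (real_of_int (m - int l * \<mu>) * t) / (\<i> * complex_of_real t) ^ n)) \<omega>"
    unfolding incr_def model_sequence_def model_integral_sum model_integral_cmult ..
  also have "(\<lambda>t. \<Sum>l\<le>n. (- 1) ^ l * of_nat (n choose l) *
     (cis (real_of_int (m - int l * \<mu>) * t) / (\<i> * complex_of_real t) ^ n)) =
     (\<lambda>t. cis (real_of_int m * t) * beta n \<mu> t)"
  proof
    fix t
    define w where "w = cis (- (real_of_int \<mu> * t))"
    have c: "cis (real_of_int (m - int l * \<mu>) * t) = cis (real_of_int m * t) * w ^ l" for l
      by (simp add: w_def Complex.DeMoivre cis_mult algebra_simps)
    have "(\<Sum>l\<le>n. (- 1) ^ l * of_nat (n choose l) * (cis (real_of_int (m - int l * \<mu>) * t) / (\<i> * complex_of_real t) ^ n)) =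
      cis (real_of_int m * t) * ((\<Sum>l\<le>n. of_nat (n choose l) * (- w) ^ l * 1 ^ (n - l)) / (\<i> * complex_of_real t) ^ n)"
      unfolding c sum_distrib_left sum_divide_distrib
      by (intro sum.cong refl) (simp add: power_minus[of w] mult_ac)
    also have "(\<Sum>l\<le>n. of_nat (n choose l) * (- w) ^ l * 1 ^ (n - l)) = (- w + 1) ^ n"
      by (rule binomial_ring[symmetric])
    finally show "(\<Sum>l\<le>n. (- 1) ^ l * of_nat (n choose l) * (cis (real_of_int (m - int l * \<mu>) * t) / (\<i> * complex_of_real t) ^ n)) =
      cis (real_of_int m * t) * beta n \<mu> t" by (simp add: beta_def w_def)
  qed
  finally show "incr n \<mu> (model_sequence n) m \<omega> = model_integral (\<lambda>t. cis (real_of_int m * t) * beta n \<mu> t) \<omega>" .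
qed

lemma sq_integrable_cis_beta: "sq_integrable (spectral_meas f) (\<lambda>t. cis (c * t) * beta n \<mu> t)"
  by (rule sq_integrable_bounded_beta(1)[OF f, where C=1]) auto

lemma model_representation: "spectral_representation n model (model_sequence n) model_noise f"
  unfolding spectral_representation_def
proof (intro conjI allI f prob_model model_noise_orthogonal)
  note sq = sq_integrable_cis_beta
  have m: "(\<lambda>t. cis (c * t) * beta n \<mu> t) \<in> borel_measurable circ" for c \<mu> by measurable
  show "has_stoch_integral model model_noise f (\<lambda>t. cis (real_of_int m * t) * beta n \<mu> t) (incr n \<mu> (model_sequence n) m)" for m \<mu>
    unfolding model_incr by (intro model_stoch_integral sq)
  show "stationary_increments n model (model_sequence n)"
    unfolding stationary_increments_def
  proof (intro conjI allI)
    show "model_sequence n m \<in> borel_measurable model" for m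
    proof -
      have "(\<lambda>t. (\<i> * complex_of_real t) ^ n) \<in> borel_measurable circ"
        by (intro continuous_borel_circ continuous_intros)
      then show ?thesis unfolding model_sequence_def model_integral_def
        by (intro sign_lift_measurable borel_measurable_times borel_measurable_divide cis_measurable root_density_measurable)
    qed
    show "integrable model (incr n \<mu> (model_sequence n) m)" "(LINT \<omega>|model. incr n \<mu> (model_sequence n) m \<omega>) = 0" for m \<mu>
      unfolding model_incr model_integral_def by (intro integral_lift root_density_sq sq)+
    show "integrable model (\<lambda>\<omega>. incr n \<mu>\<^sub>1 (model_sequence n) (m\<^sub>0 + m) \<omega> * cnj (incr n \<mu>\<^sub>2 (model_sequence n) m\<^sub>0 \<omega>))" for m\<^sub>0 m \<mu>\<^sub>1 \<mu>\<^sub>2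
      unfolding model_incr by (intro sq_integrable_mult model_integral_sq sq)
    have "(LINT \<omega>|model. incr n \<mu>\<^sub>1 (model_sequence n) (m\<^sub>0 + m) \<omega> * cnj (incr n \<mu>\<^sub>2 (model_sequence n) m\<^sub>0 \<omega>)) =
        of_real (1 / (2 * pi)) * (LINT t|spectral_meas f. cis (real_of_int m * t) * (beta n \<mu>\<^sub>1 t * cnj (beta n \<mu>\<^sub>2 t)))" for m\<^sub>0 m \<mu>\<^sub>1 \<mu>\<^sub>2
    proof -
      have "cis (real_of_int (m\<^sub>0 + m) * t) * cnj (cis (real_of_int m\<^sub>0 * t)) = cis (real_of_int m * t)" for t
        by (simp add: cis_cnj cis_mult algebra_simps)
      then have "cis (real_of_int (m\<^sub>0 + m) * t) * beta n \<mu>\<^sub>1 t * cnj (cis (real_of_int m\<^sub>0 * t) * beta n \<mu>\<^sub>2 t) =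
        cis (real_of_int m * t) * (beta n \<mu>\<^sub>1 t * cnj (beta n \<mu>\<^sub>2 t))" for t
        by (metis (no_types, lifting) complex_cnj_mult mult.assoc mult.left_commute)
      then show ?thesis
        using model_integral_l2ip[OF m m, of "real_of_int (m\<^sub>0 + m)" \<mu>\<^sub>1 "real_of_int m\<^sub>0" \<mu>\<^sub>2]
        unfolding model_incr l2ip_def by (simp only:)
    qed
    then show "(LINT \<omega>|model. incr n \<mu>\<^sub>1 (model_sequence n) (m\<^sub>0 + m) \<omega> * cnj (incr n \<mu>\<^sub>2 (model_sequence n) m\<^sub>0 \<omega>)) =
        (LINT \<omega>|model. incr n \<mu>\<^sub>1 (model_sequence n) (m\<^sub>0' + m) \<omega> * cnj (incr n \<mu>\<^sub>2 (model_sequence n) m\<^sub>0' \<omega>))" for m\<^sub>0 m\<^sub>0' m \<mu>\<^sub>1 \<mu>\<^sub>2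
      by simp
  qed
qed

section \<open>The mean square error as an integral\<close>

lemma A_partial_tendsto:
  assumes b: "l1 b"
  shows "(\<lambda>N. l2sq (spectral_meas f) (\<lambda>t. (\<Sum>k<N. b k * (cis (real_of_int (int k) * t) * beta n \<mu> t)) - powser b (cis t) * beta n \<mu> t)) \<longlonglongrightarrow> 0"
proof -
  define tail where "tail N = (\<Sum>k. cmod (b (k + N)))" for N
  have bound: "l2sq (spectral_meas f) (\<lambda>t. (\<Sum>k<N. b k * (cis (real_of_int (int k) * t) * beta n \<mu> t)) - powser b (cis t) * beta n \<mu> t) \<le>
      (tail N * \<bar>real_of_int \<mu>\<bar> ^ n)\<^sup>2 * (LINT t|circ. f t)" for N
  proof -
    have eq: "(\<Sum>k<N. b k * (cis (real_of_int (int k) * t) * beta n \<mu> t)) - powser b (cis t) * beta n \<mu> t =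
        ((\<Sum>k<N. b k * cis t ^ k) - powser b (cis t)) * beta n \<mu> t" for t
      by (simp add: left_diff_distrib sum_distrib_right Complex.DeMoivre mult.assoc)
    show ?thesis unfolding eq
    proof (rule sq_integrable_bounded_beta(2)[OF f])
      show "(\<lambda>t. (\<Sum>k<N. b k * cis t ^ k) - powser b (cis t)) \<in> borel_measurable circ"
        by (intro continuous_borel_circ continuous_intros powser_cis_continuous b)
      show "AE t in circ. cmod ((\<Sum>k<N. b k * cis t ^ k) - powser b (cis t)) \<le> tail N"
        using powser_truncation[OF b] by (intro AE_I2) (simp add: norm_minus_commute tail_def)
      show "0 \<le> tail N" using b unfolding tail_def l1_def
        by (intro suminf_nonneg) (simp_all add: summable_iff_shift[where f="\<lambda>k. cmod (b k)"])
    qed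
  qed
  have "(\<lambda>N. (tail N * \<bar>real_of_int \<mu>\<bar> ^ n)\<^sup>2 * (LINT t|circ. f t)) \<longlonglongrightarrow> (0 * \<bar>real_of_int \<mu>\<bar> ^ n)\<^sup>2 * (LINT t|circ. f t)"
    unfolding tail_def by (intro tendsto_intros l1_tail_tendsto b)
  then show ?thesis
    using tendsto_sandwich[OF always_eventually always_eventually tendsto_const, OF allI allI, OF l2sq_nonneg bound]
    by simp
qed

lemma sq_integrable_powser_beta:
  assumes b: "l1 b" shows "sq_integrable (spectral_meas f) (\<lambda>t. powser b (cis t) * beta n \<mu> t)"
proof (rule sq_integrable_bounded_beta(1)[OF f])
  show "(\<lambda>t. powser b (cis t)) \<in> borel_measurable circ"
    by (intro continuous_borel_circ powser_cis_continuous b continuous_intros)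
  show "AE t in circ. cmod (powser b (cis t)) \<le> (\<Sum>k. cmod (b k))"
    using powser_bound[OF b] by simp
  show "0 \<le> (\<Sum>k. cmod (b k))" using b unfolding l1_def by (intro suminf_nonneg) auto
qed

text \<open>
  The terms \<open>V\<xi>\<close> cancel in the error. What remains is the difference of two limits of stochastic
  integrals, so every sequence with density \<open>f\<close> gives the same number, and the sequence constructed
  above shows that there is one.
\<close>

lemma mse_integral:
  assumes b: "l1 (bcoeff n \<mu> a)" and h: "sq_integrable (spectral_meas f) (\<lambda>t. h t * beta n (int \<mu>) t)"
  shows "mse n \<mu> a h f = 1 / (2 * pi) *
    l2sq (spectral_meas f) (\<lambda>t. powser (bcoeff n \<mu> a) (cis t) * beta n (int \<mu>) t - h t * beta n (int \<mu>) t)"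
    (is "_ = 1 / (2 * pi) * l2sq _ ?R")
proof -
  let ?b = "bcoeff n \<mu> a"
  let ?inc = "\<lambda>k t. cis (real_of_int (int k) * t) * beta n (int \<mu>) t"
  let ?A = "\<lambda>N t. \<Sum>k<N. ?b k * ?inc k t"
  have sqA: "sq_integrable (spectral_meas f) (?A N)" for N
    by (intro sq_integrable_sum sq_integrable_cmult sq_integrable_cis_beta)
  have unique: "(LINT \<omega>|M. (cmod (X \<omega> - Y \<omega>))\<^sup>2) = 1 / (2 * pi) * l2sq (spectral_meas f) ?R"
    if rep: "spectral_representation n M \<xi> Z f" and X: "is_A_functional n \<mu> a M \<xi> X" and Y: "is_estimate n \<mu> a M \<xi> Z f h Y"
    for M :: "real measure" and \<xi> Z X Y
  proof -
    have Z: "orthogonal_measure M Z f"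
      and inc: "\<And>k. has_stoch_integral M Z f (?inc k) (incr n (int \<mu>) \<xi> (int k))"
      using rep unfolding spectral_representation_def by blast+
    obtain B where B: "ms_sums M (\<lambda>k \<omega>. ?b k * incr n (int \<mu>) \<xi> (int k) \<omega>) B"
        "X = (\<lambda>\<omega>. B \<omega> - V_functional n \<mu> a \<xi> \<omega>)"
      using X by (auto simp: is_A_functional_def)
    obtain H where H: "has_stoch_integral M Z f (\<lambda>t. h t * beta n (int \<mu>) t) H" "Y = (\<lambda>\<omega>. - V_functional n \<mu> a \<xi> \<omega> + H \<omega>)"
      using Y by (auto simp: is_estimate_def)
    let ?B = "\<lambda>N \<omega>. \<Sum>k<N. ?b k * incr n (int \<mu>) \<xi> (int k) \<omega>"
    have Bt: "\<And>N. sq_integrable M (?B N)" "sq_integrable M B" "(\<lambda>N. l2sq M (\<lambda>\<omega>. ?B N \<omega> - B \<omega>)) \<longlonglongrightarrow> 0"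
      using B(1) by (auto simp: ms_sums_def ms_tendsto_def l2sq_def)
    have sqH: "sq_integrable M H" using has_stoch_integralD[OF f H(1)] by simp
    have "(\<lambda>N. l2sq M (\<lambda>\<omega>. ?B N \<omega> - H \<omega>)) \<longlonglongrightarrow> l2sq M (\<lambda>\<omega>. B \<omega> - H \<omega>)"
    proof (rule l2sq_tendsto)
      show "(\<lambda>N. l2sq M (\<lambda>\<omega>. ?B N \<omega> - H \<omega> - (B \<omega> - H \<omega>))) \<longlonglongrightarrow> 0" using Bt(3) by simp
    qed (intro sq_integrable_diff Bt sqH)+
    moreover have "l2sq M (\<lambda>\<omega>. ?B N \<omega> - H \<omega>) = 1 / (2 * pi) * l2sq (spectral_meas f) (\<lambda>t. ?A N t - h t * beta n (int \<mu>) t)" for N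
      by (rule stoch_integral_diff[OF f Z _ inc H(1)]) simp
    moreover have "(\<lambda>N. 1 / (2 * pi) * l2sq (spectral_meas f) (\<lambda>t. ?A N t - h t * beta n (int \<mu>) t)) \<longlonglongrightarrow> 1 / (2 * pi) * l2sq (spectral_meas f) ?R"
    proof (intro tendsto_mult tendsto_const, rule l2sq_tendsto)
      show "(\<lambda>N. l2sq (spectral_meas f) (\<lambda>t. ?A N t - h t * beta n (int \<mu>) t - ?R t)) \<longlonglongrightarrow> 0"
        using A_partial_tendsto[OF b, of n "int \<mu>"] by simp
    qed (intro sq_integrable_diff sqA h sq_integrable_powser_beta b)+
    ultimately have "l2sq M (\<lambda>\<omega>. B \<omega> - H \<omega>) = 1 / (2 * pi) * l2sq (spectral_meas f) ?R"
      by (simp only:) (rule LIMSEQ_unique)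
    then show ?thesis by (simp add: B(2) H(2) l2sq_def)
  qed
  have "\<exists>(M :: real measure) \<xi> Z X Y. spectral_representation n M \<xi> Z f \<and>
     is_A_functional n \<mu> a M \<xi> X \<and> is_estimate n \<mu> a M \<xi> Z f h Y"
  proof (intro exI conjI)
    show "spectral_representation n model (model_sequence n) model_noise f" by (rule model_representation)
    show "is_estimate n \<mu> a model (model_sequence n) model_noise f h
        (\<lambda>\<omega>. - V_functional n \<mu> a (model_sequence n) \<omega> + model_integral (\<lambda>t. h t * beta n (int \<mu>) t) \<omega>)"
      unfolding is_estimate_def using model_stoch_integral[OF h] by blast
    have partial: "(\<lambda>\<omega>. \<Sum>k<N. ?b k * incr n (int \<mu>) (model_sequence n) (int k) \<omega>) = model_integral (?A N)" for N
      by (simp add: model_incr model_integral_sum model_integral_cmult fun_eq_iff del: of_int_of_nat_eq)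
    have sqL: "sq_integrable (spectral_meas f) (\<lambda>t. powser ?b (cis t) * beta n (int \<mu>) t)"
      by (rule sq_integrable_powser_beta[OF b])
    have "ms_sums model (\<lambda>k \<omega>. ?b k * incr n (int \<mu>) (model_sequence n) (int k) \<omega>)
        (model_integral (\<lambda>t. powser ?b (cis t) * beta n (int \<mu>) t))"
      unfolding ms_sums_def ms_tendsto_def partial
    proof (intro conjI allI model_integral_sq sqA sqL)
      have "(LINT \<omega>|model. (cmod (model_integral (?A N) \<omega> - model_integral (\<lambda>t. powser ?b (cis t) * beta n (int \<mu>) t) \<omega>))\<^sup>2) =
        1 / (2 * pi) * l2sq (spectral_meas f) (\<lambda>t. ?A N t - powser ?b (cis t) * beta n (int \<mu>) t)" for N
      proof -
        have "(\<lambda>t. ?A N t - powser ?b (cis t) * beta n (int \<mu>) t) \<in> borel_measurable circ"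
          using sq_integrable_measurable[OF sq_integrable_diff[OF sqA sqL]] by (simp add: measurable_spec)
        from model_integral_l2sq[OF this] show ?thesis by (simp add: l2sq_def model_integral_diff)
      qed
      moreover have "(\<lambda>N. 1 / (2 * pi) * l2sq (spectral_meas f) (\<lambda>t. ?A N t - powser ?b (cis t) * beta n (int \<mu>) t)) \<longlonglongrightarrow> 1 / (2 * pi) * 0"
        by (intro tendsto_mult tendsto_const A_partial_tendsto b)
      ultimately show "(\<lambda>N. LINT \<omega>|model. (cmod (model_integral (?A N) \<omega> - model_integral (\<lambda>t. powser ?b (cis t) * beta n (int \<mu>) t) \<omega>))\<^sup>2) \<longlonglongrightarrow> 0"
        by simp
    qed
    then show "is_A_functional n \<mu> a model (model_sequence n)
       (\<lambda>\<omega>. model_integral (\<lambda>t. powser ?b (cis t) * beta n (int \<mu>) t) \<omega> - V_functional n \<mu> a (model_sequence n) \<omega>)"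
      unfolding is_A_functional_def by blast
  qed
  then obtain M :: "real measure" and \<xi> Z X Y where ex: "spectral_representation n M \<xi> Z f"
     "is_A_functional n \<mu> a M \<xi> X" "is_estimate n \<mu> a M \<xi> Z f h Y" by blast
  show ?thesis
    unfolding mse_def
  proof (rule the_equality)
    show "\<exists>(M :: real measure) \<xi> Z X Y. spectral_representation n M \<xi> Z f \<and>
        is_A_functional n \<mu> a M \<xi> X \<and> is_estimate n \<mu> a M \<xi> Z f h Y \<and>
        1 / (2 * pi) * l2sq (spectral_meas f) ?R = (LINT \<omega>|M. (cmod (X \<omega> - Y \<omega>))\<^sup>2)"
      using ex unique[OF ex] by metis
  next
    fix d assume "\<exists>(M :: real measure) \<xi> Z X Y. spectral_representation n M \<xi> Z f \<and>
        is_A_functional n \<mu> a M \<xi> X \<and> is_estimate n \<mu> a M \<xi> Z f h Y \<and>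
        d = (LINT \<omega>|M. (cmod (X \<omega> - Y \<omega>))\<^sup>2)"
    then show "d = 1 / (2 * pi) * l2sq (spectral_meas f) ?R" using unique by (elim exE conjE) (simp only:)
  qed
qed

end

section \<open>Analytic and antianalytic parts of a product\<close>

lemma double_series:
  fixes G :: "nat \<times> nat \<Rightarrow> complex"
  assumes G: "(\<lambda>p. norm (G p)) summable_on UNIV"
  shows "l1 (\<lambda>m. \<Sum>j. G (m, j))" "(\<lambda>m. \<Sum>j. G (m, j)) sums infsum G UNIV"
proof -
  have G': "(\<lambda>p. norm (G p)) summable_on (UNIV \<times> UNIV)" using G by simp
  have row: "(\<lambda>j. norm (G (m, j))) summable_on UNIV" for m
    using G' by (subst (asm) Infinite_Sum.abs_summable_on_Sigma_iff) auto
  have row_eq: "(\<Sum>j. G (m, j)) = (\<Sum>\<^sub>\<infinity>j. G (m, j))" for m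
  proof -
    have "((\<lambda>j. G (m, j)) has_sum (\<Sum>\<^sub>\<infinity>j. G (m, j))) UNIV"
      by (rule has_sum_infsum[OF abs_summable_summable[OF row]])
    then show ?thesis by (rule sums_unique[OF has_sum_imp_sums, symmetric])
  qed
  have "(\<lambda>m. norm (\<Sum>\<^sub>\<infinity>j. norm (G (m, j)))) summable_on UNIV"
    using G' by (subst (asm) Infinite_Sum.abs_summable_on_Sigma_iff) simp
  then have rows: "(\<lambda>m. \<Sum>\<^sub>\<infinity>j. norm (G (m, j))) summable_on UNIV"
    by (rule abs_summable_summable)
  have norms: "(\<lambda>m. norm (\<Sum>j. G (m, j))) summable_on UNIV"
  proof (rule summable_on_comparison_test[OF rows])
    show "norm (\<Sum>j. G (m, j)) \<le> (\<Sum>\<^sub>\<infinity>j. norm (G (m, j)))" for m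
      unfolding row_eq by (rule norm_infsum_bound[OF row])
  qed auto
  then show "l1 (\<lambda>m. \<Sum>j. G (m, j))" unfolding l1_def
    by (meson summable_on_UNIV_nonneg_real_iff norm_ge_zero)
  have "infsum G (UNIV \<times> UNIV) = (\<Sum>\<^sub>\<infinity>m. \<Sum>\<^sub>\<infinity>j. G (m, j))"
    by (rule infsum_Sigma'_banach[symmetric, where f="\<lambda>m j. G (m, j)", simplified])
       (use abs_summable_summable[OF G] in simp)
  then have "infsum G UNIV = (\<Sum>\<^sub>\<infinity>m. \<Sum>j. G (m, j))" by (simp add: row_eq)
  moreover have "((\<lambda>m. \<Sum>j. G (m, j)) has_sum (\<Sum>\<^sub>\<infinity>m. \<Sum>j. G (m, j))) UNIV"
    by (rule has_sum_infsum[OF abs_summable_summable[OF norms]])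
  ultimately show "(\<lambda>m. \<Sum>j. G (m, j)) sums infsum G UNIV"
    by (simp only: has_sum_imp_sums)
qed

lemma l1_bounded:
  assumes "l1 x" shows "cmod (x j) \<le> (\<Sum>k. cmod (x k))"
  using sum_le_suminf[of "\<lambda>k. cmod (x k)" "{j}"] assms by (auto simp: l1_def)

definition hankel :: "(nat \<Rightarrow> complex) \<Rightarrow> (nat \<Rightarrow> complex) \<Rightarrow> nat \<Rightarrow> complex" where
  "hankel b x m = (\<Sum>j. b (m + j) * x j)"

text \<open>
  The product of \<open>\<Sum>k. b(k) exp(ikt)\<close> and \<open>\<Sum>j. x(j) exp(-ijt)\<close>, sorted by frequency: the index pairs
  with \<open>j \<le> k\<close>, written as \<open>(m + j, j)\<close>, form the analytic part, and those with \<open>k < j\<close>, written as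
  \<open>(k, Suc m + k)\<close>, the antianalytic one.
\<close>

lemma hankel_split:
  assumes b: "l1 b" and x: "l1 x"
  shows "l1 (hankel b x)" "l1 (\<lambda>m. hankel x b (Suc m))"
    and "powser b (cis t) * powser x (cis (- t)) =
      powser (hankel b x) (cis t) + cis (- t) * powser (\<lambda>m. hankel x b (Suc m)) (cis (- t))"
proof -
  have abs: "(\<lambda>p. norm (c (fst p) * y (snd p))) summable_on UNIV" if cy: "l1 c" "l1 y" for c y
  proof -
    have hy: "((\<lambda>j. norm (y j)) has_sum (\<Sum>j. norm (y j))) UNIV"
      using cy(2) unfolding l1_def by (intro sums_nonneg_imp_has_sum summable_sums) auto
    have hc: "(\<lambda>k. norm (c k)) summable_on UNIV"
      using cy(1) unfolding l1_def by (intro summable_nonneg_imp_summable_on) auto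
    have "(\<lambda>p. norm (c (fst p) * y (snd p))) summable_on (UNIV \<times> UNIV)"
    proof (subst Infinite_Sum.abs_summable_on_Sigma_iff, intro conjI ballI)
      show "(\<lambda>j. norm (c (fst (k, j)) * y (snd (k, j)))) summable_on UNIV" for k
        using hy by (auto simp: norm_mult summable_on_def intro: has_sum_cmult_right)
      have "(\<Sum>\<^sub>\<infinity>j. norm (c (fst (k, j)) * y (snd (k, j)))) = norm (c k) * (\<Sum>j. norm (y j))" for k
        using has_sum_cmult_right[OF hy, of "norm (c k)"] by (simp add: norm_mult infsumI)
      then show "(\<lambda>k. norm (\<Sum>\<^sub>\<infinity>j. norm (c (fst (k, j)) * y (snd (k, j))))) summable_on UNIV"
        using summable_on_cmult_left[OF hc, of "norm (\<Sum>j. norm (y j))"] by (simp add: abs_mult)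
    qed
    then show ?thesis by simp
  qed
  have reindex: "(\<lambda>p. norm (G (h p))) summable_on UNIV" "infsum (G \<circ> h) UNIV = infsum G (range h)"
    if "(\<lambda>p. norm (G p)) summable_on UNIV" "inj h" for G :: "nat \<times> nat \<Rightarrow> complex" and h :: "nat \<times> nat \<Rightarrow> nat \<times> nat"
  proof -
    have "(\<lambda>p. norm (G p)) summable_on range h" using that(1) by (rule summable_on_subset_banach) simp
    then show "(\<lambda>p. norm (G (h p))) summable_on UNIV"
      using summable_on_reindex[OF that(2), of "\<lambda>p. norm (G p)"] by (simp add: o_def)
    show "infsum (G \<circ> h) UNIV = infsum G (range h)" using infsum_reindex[OF that(2), of G] by simp
  qed
  define h1 h2 where "h1 = (\<lambda>(m, j). (m + j, j :: nat))" and "h2 = (\<lambda>(m, k). (k :: nat, Suc m + k))"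
  have inj: "inj h1" "inj h2" by (auto simp: h1_def h2_def inj_def)
  have range: "range h1 = {(k, j). j \<le> k}" "range h2 = {(k, j). k < j}"
  proof -
    have "(k, j) \<in> range h1" if "j \<le> k" for k j
      using that by (intro image_eqI[of _ _ "(k - j, j)"]) (auto simp: h1_def)
    then show "range h1 = {(k, j). j \<le> k}" by (auto simp: h1_def)
    have "(k, j) \<in> range h2" if "k < j" for k j
      using that by (intro image_eqI[of _ _ "(j - Suc k, k)"]) (auto simp: h2_def)
    then show "range h2 = {(k, j). k < j}" by (auto simp: h2_def)
  qed
  show l1: "l1 (hankel b x)" "l1 (\<lambda>m. hankel x b (Suc m))"
    using double_series(1)[OF reindex(1)[OF abs[OF b x] inj(1)]] double_series(1)[OF reindex(1)[OF abs[OF b x] inj(2)]]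
    by (simp_all add: h1_def h2_def hankel_def[abs_def] mult.commute)
  define c y where "c k = b k * cis t ^ k" and "y k = x k * cis (- t) ^ k" for k
  have cy: "l1 c" "l1 y"
    using b x by (simp_all add: l1_def c_def y_def norm_mult norm_power)
  define G where "G p = c (fst p) * y (snd p)" for p
  have G: "(\<lambda>p. norm (G p)) summable_on UNIV" unfolding G_def by (rule abs[OF cy])
  have total: "infsum G UNIV = powser b (cis t) * powser x (cis (- t))"
  proof -
    have "(\<Sum>j. G (m, j)) = c m * powser x (cis (- t))" for m
      using cy(2) unfolding G_def powser_def y_def[symmetric]
      by (simp add: l1_def summable_norm_cancel suminf_mult)
    moreover have "(\<lambda>m. c m * powser x (cis (- t))) sums (powser b (cis t) * powser x (cis (- t)))"
      unfolding c_def by (intro sums_mult2 l1_sums b) simp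
    ultimately show ?thesis using double_series(2)[OF G] sums_unique2 by simp
  qed
  have cc: "cis t ^ j * cis (- t) ^ j = 1" for j by (simp add: cis_mult flip: power_mult_distrib)
  have p1: "infsum G (range h1) = powser (hankel b x) (cis t)"
  proof -
    have "(\<Sum>j. G (h1 (m, j))) = hankel b x m * cis t ^ m" for m
    proof -
      have "G (h1 (m, j)) = b (m + j) * x j * cis t ^ m" for j
        using cc[of j] by (simp add: G_def h1_def c_def y_def power_add)
      moreover have "summable (\<lambda>j. b (m + j) * x j)"
      proof -
        have "l1 (\<lambda>j. b (m + j))" using b summable_iff_shift[of "\<lambda>k. cmod (b k)" m] by (simp add: l1_def add.commute)
        then show ?thesis by (rule l1_summable_mult) (rule l1_bounded[OF x])
      qed
      ultimately show ?thesis unfolding hankel_def by (simp add: suminf_mult2)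
    qed
    then show ?thesis
      using double_series(2)[OF reindex(1)[OF G inj(1)]] reindex(2)[OF G inj(1)] by (simp add: powser_def sums_iff o_def)
  qed
  have p2: "infsum G (range h2) = cis (- t) * powser (\<lambda>m. hankel x b (Suc m)) (cis (- t))"
  proof -
    have "(\<Sum>k. G (h2 (m, k))) = cis (- t) * (hankel x b (Suc m) * cis (- t) ^ m)" for m
    proof -
      have "G (h2 (m, k)) = x (Suc m + k) * b k * (cis (- t) * cis (- t) ^ m)" for k
        using cc[of k] by (simp add: G_def h2_def c_def y_def power_add)
      moreover have "summable (\<lambda>k. x (Suc m + k) * b k)"
      proof -
        have "l1 (\<lambda>j. x (Suc m + j))" using x summable_iff_shift[of "\<lambda>k. cmod (x k)" "Suc m"] by (simp add: l1_def add.commute)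
        then show ?thesis by (rule l1_summable_mult) (rule l1_bounded[OF b])
      qed
      ultimately have "(\<Sum>k. G (h2 (m, k))) = hankel x b (Suc m) * (cis (- t) * cis (- t) ^ m)"
        unfolding hankel_def by (simp only: suminf_mult2)
      then show ?thesis by (simp only: mult_ac)
    qed
    then have "(\<lambda>m. cis (- t) * (hankel x b (Suc m) * cis (- t) ^ m)) sums infsum G (range h2)"
      using double_series(2)[OF reindex(1)[OF G inj(2)]] reindex(2)[OF G inj(2)] by (simp add: o_def)
    moreover have "(\<lambda>m. cis (- t) * (hankel x b (Suc m) * cis (- t) ^ m)) sums
        (cis (- t) * powser (\<lambda>m. hankel x b (Suc m)) (cis (- t)))"
      by (intro sums_mult l1_sums l1) simp
    ultimately show ?thesis by (rule sums_unique2)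
  qed
  have "infsum G UNIV = infsum G (range h1 \<union> range h2)" unfolding range by (rule arg_cong[where f="infsum G"]) auto
  also have "\<dots> = infsum G (range h1) + infsum G (range h2)"
  proof (rule infsum_Un_disjoint)
    show "G summable_on range h1" "G summable_on range h2"
      using abs_summable_summable[OF G] by (auto intro: summable_on_subset_banach)
    show "range h1 \<inter> range h2 = {}" unfolding range by auto
  qed
  finally show "powser b (cis t) * powser x (cis (- t)) =
      powser (hankel b x) (cis t) + cis (- t) * powser (\<lambda>m. hankel x b (Suc m)) (cis (- t))"
    by (simp add: total p1 p2)
qed

section \<open>The matrices\<close>

text \<open>
  \<open>D\<^sup>\<mu>\<close> is an upper triangular Toeplitz matrix, so it commutes with the shift of \<open>a\<close> by \<open>j\<close>.
\<close>

lemma mat_mul_D_A: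
  assumes "admissible_coeffs n \<mu> a"
  shows "mat_mul (Dmat n \<mu>) (Amat a) k j = bcoeff n \<mu> a (k + j)"
proof -
  define F where "F i = Dmat n \<mu> (k + j) i * a i" for i
  have "summable F" using assms by (simp add: admissible_coeffs_def F_def[abs_def])
  then have "suminf F = (\<Sum>i. F (i + j)) + (\<Sum>i<j. F i)" by (rule suminf_split_initial_segment)
  also have "(\<Sum>i<j. F i) = 0" by (intro sum.neutral) (auto simp: F_def Dmat_def)
  also have "(\<lambda>i. F (i + j)) = (\<lambda>i. Dmat n \<mu> k i * Amat a i j)" by (auto simp: F_def Dmat_def Amat_def)
  finally show ?thesis by (simp add: mat_mul_def bcoeff_def mat_app_def F_def)
qed

lemma DA_hankel: "admissible_coeffs n \<mu> a \<Longrightarrow> DA n \<mu> a x = hankel (bcoeff n \<mu> a) x"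
  by (simp add: DA_def mat_app_def hankel_def fun_eq_iff mat_mul_D_A)

lemma admissible_l1: "admissible_coeffs n \<mu> a \<Longrightarrow> l1 (bcoeff n \<mu> a)"
  by (simp add: admissible_coeffs_def l1_def)

lemma phi_mu_conv: "phi_mu n \<mu> \<phi> = conv \<phi> (wcoeff n \<mu>)"
proof
  fix k
  have "phi_mu n \<mu> \<phi> k = (\<Sum>j\<le>k. Wmat n \<mu> k j * \<phi> j)"
    unfolding phi_mu_def mat_app_def by (rule suminf_finite) (auto simp: Wmat_def)
  also have "\<dots> = conv \<phi> (wcoeff n \<mu>) k"
    unfolding conv_def by (intro sum.cong) (auto simp: Wmat_def)
  finally show "phi_mu n \<mu> \<phi> k = conv \<phi> (wcoeff n \<mu>) k" .
qed

section \<open>Canonical factorizations\<close>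

text \<open>
  By compactness \<open>\<Phi>\<close> has no zeros in a slightly larger disc either, so the Taylor coefficients of
  \<open>1/\<Phi>\<close> decay geometrically.
\<close>

lemma canonical_reciprocal:
  assumes rad: "conv_radius \<phi> > 1" and nz: "\<And>z. cmod z \<le> 1 \<Longrightarrow> powser \<phi> z \<noteq> 0"
  obtains y where "l1 y" "\<And>z. cmod z \<le> 1 \<Longrightarrow> powser y z = inverse (powser \<phi> z)"
proof -
  obtain \<rho> where \<rho>: "1 < \<rho>" "ereal \<rho> < conv_radius \<phi>"
    using ereal_dense2[OF rad] by (auto simp: one_ereal_def)
  have holo: "powser \<phi> holomorphic_on ball 0 \<rho>"
  proof (rule power_series_holomorphic[of _ _ \<phi>])
    fix w assume "w \<in> ball (0::complex) \<rho>"
    then have "ereal (norm w) < ereal \<rho>" by simp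
    then have "ereal (norm w) < conv_radius \<phi>" using \<rho>(2) by (rule less_trans)
    then show "(\<lambda>k. \<phi> k * (w - 0) ^ k) sums powser \<phi> w"
      unfolding powser_def using summable_in_conv_radius[of w \<phi>] by (simp add: summable_sums)
  qed
  define U where "U = ball 0 \<rho> \<inter> powser \<phi> -` (- {0})"
  have "open U" unfolding U_def
    by (rule continuous_open_preimage[OF holomorphic_on_imp_continuous_on[OF holo]]) auto
  moreover have "cball 0 1 \<subseteq> U" unfolding U_def using nz \<rho>(1) by auto
  ultimately obtain e where e: "e > 0" "(\<Union>x\<in>cball 0 1. cball x e) \<subseteq> U"
    using compact_subset_open_imp_cball_epsilon_subset[of "cball 0 1" U] by auto
  have sub: "ball 0 (1 + e) \<subseteq> U"
  proof
    fix z :: complex assume z: "z \<in> ball 0 (1 + e)"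
    define w where "w = z / of_real (max 1 (cmod z))"
    have "cmod w \<le> 1" by (simp add: w_def norm_divide divide_le_eq)
    moreover have "dist w z \<le> e"
    proof (cases "cmod z \<le> 1")
      case False
      then have "cmod z > 0" "max 1 (cmod z) = cmod z" by linarith+
      then have "w - z = z * of_real (1 / cmod z - 1)" by (simp add: w_def algebra_simps)
      then have "dist w z = cmod z * \<bar>1 / cmod z - 1\<bar>" by (simp only: dist_norm norm_mult norm_of_real)
      also have "\<dots> = cmod z - 1" using False \<open>cmod z > 0\<close> by (simp add: abs_if field_simps)
      finally show ?thesis using z by simp
    qed (use e in \<open>simp add: w_def max_def\<close>)
    ultimately show "z \<in> U" by (intro subsetD[OF e(2)] UN_I[of w]) auto
  qed
  have "(\<lambda>z. inverse (powser \<phi> z)) holomorphic_on ball 0 (1 + e)"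
    by (intro holomorphic_intros holomorphic_on_subset[OF holo]) (use sub in \<open>auto simp: U_def\<close>)
  then show ?thesis using l1_holomorphic[of _ "1 + e"] e(1) that by auto
qed

text \<open>
  The properties of \<open>\<Phi>\<^sub>\<mu>\<close> from which prediction theory is developed; \<open>x\<close> are its coefficients. The
  last one replaces the statement that \<open>\<Phi>\<^sub>\<mu>\<close> is an outer function: bounded approximate inverses
  given by absolutely convergent power series.
\<close>

locale outer_factor =
  fixes n \<mu> :: nat and f0 :: "real \<Rightarrow> real" and x :: "nat \<Rightarrow> complex"
  assumes f0: "spectral_density f0" and l1x: "l1 x"
    and modulus: "AE t in circ. (cmod (powser x (cis (- t))))\<^sup>2 = (cmod (beta n (int \<mu>) t))\<^sup>2 * f0 t"
    and nonzero: "AE t in circ. powser x (cis (- t)) \<noteq> 0"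
    and ratio_bounded: "\<exists>C. AE t in circ. cmod (beta n (int \<mu>) t * inverse (powser x (cis (- t)))) \<le> C"
    and approx_inverse: "\<exists>R C. (\<forall>j::nat. l1 (R j)) \<and>
       (AE t in circ. \<forall>j. cmod (powser (R j) (cis (- t)) * powser x (cis (- t))) \<le> C) \<and>
       (AE t in circ. (\<lambda>j. powser (R j) (cis (- t)) * powser x (cis (- t))) \<longlonglongrightarrow> 1)"

lemma AE_beta_nz: "\<mu> > 0 \<Longrightarrow> AE t in circ. beta n (int \<mu>) t \<noteq> 0"
proof -
  assume "\<mu> > 0"
  from AE_circ_generic[OF this] show ?thesis
  proof eventually_elim
    case (elim t)
    have "cmod (beta n (int \<mu>) t) \<noteq> 0" using cmod_beta[of t \<mu> n] elim by simp
    then show ?case by simp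
  qed
qed

text \<open>
  The absolutely convergent series of \<open>1/\<Phi>\<close> bounds \<open>\<Phi>\<close> away from \<open>0\<close> on the circle.
\<close>

lemma canonical_bounds:
  assumes "canonical_factorization \<phi> f"
  obtains m where "m > 0" "\<And>t. m \<le> cmod (powser \<phi> (cis (- t)))"
proof -
  have l1: "l1 \<phi>" and nz: "\<And>z. cmod z \<le> 1 \<Longrightarrow> powser \<phi> z \<noteq> 0"
    using assms conv_radius_l1 by (auto simp: canonical_factorization_def)
  obtain y where y: "l1 y" "\<And>z. cmod z \<le> 1 \<Longrightarrow> powser y z = inverse (powser \<phi> z)"
    using canonical_reciprocal[of \<phi>] assms unfolding canonical_factorization_def by metis
  define S where "S = (\<Sum>k. cmod (y k)) + 1"
  have "0 \<le> (\<Sum>k. cmod (y k))" using y(1) unfolding l1_def by (intro suminf_nonneg) auto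
  then have S: "S > 0" by (simp add: S_def)
  have "1 / S \<le> cmod (powser \<phi> (cis (- t)))" for t
  proof -
    have "inverse (cmod (powser \<phi> (cis (- t)))) \<le> S"
      using powser_bound[OF y(1), of "cis (- t)"] y(2)[of "cis (- t)"] by (simp add: S_def norm_inverse)
    moreover have "cmod (powser \<phi> (cis (- t))) > 0" using nz[of "cis (- t)"] by simp
    ultimately show ?thesis using S by (simp add: field_simps)
  qed
  with S that[of "1 / S"] show ?thesis by auto
qed

lemma canonical_outer_factor:
  assumes \<mu>: "\<mu> > 0" and f0: "spectral_density f0" and can: "canonical_factorization \<phi> f0"
  shows "outer_factor n \<mu> f0 (phi_mu n \<mu> \<phi>)"
proof
  have rad: "conv_radius \<phi> > 1" and nz: "\<And>z. cmod z \<le> 1 \<Longrightarrow> powser \<phi> z \<noteq> 0"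
    and dens: "AE t in circ. f0 t = (cmod (powser \<phi> (cis (- t))))\<^sup>2"
    using can by (auto simp: canonical_factorization_def density_of_def)
  have l1\<phi>: "l1 \<phi>" by (rule conv_radius_l1[OF rad])
  note w = wcoeff_outer[OF \<mu>]
  have px: "powser (phi_mu n \<mu> \<phi>) z = powser \<phi> z * powser (wcoeff n \<mu>) z" if "cmod z \<le> 1" for z
    unfolding phi_mu_conv by (rule powser_conv[OF l1\<phi> w(1) that])
  show "spectral_density f0" by fact
  show "l1 (phi_mu n \<mu> \<phi>)" unfolding phi_mu_conv by (rule l1_conv[OF l1\<phi> w(1)])
  show "AE t in circ. (cmod (powser (phi_mu n \<mu> \<phi>) (cis (- t))))\<^sup>2 = (cmod (beta n (int \<mu>) t))\<^sup>2 * f0 t"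
    using dens cmod_wcoeff_beta[OF \<mu>, of n] by eventually_elim (simp add: px norm_mult power_mult_distrib)
  show "AE t in circ. powser (phi_mu n \<mu> \<phi>) (cis (- t)) \<noteq> 0"
    using AE_beta_nz[OF \<mu>, of n] cmod_wcoeff_beta[OF \<mu>, of n]
    by eventually_elim (use nz in \<open>auto simp: px\<close>)
  obtain m where m: "m > 0" "\<And>t. m \<le> cmod (powser \<phi> (cis (- t)))" using canonical_bounds[OF can] by blast
  have "AE t in circ. cmod (beta n (int \<mu>) t * inverse (powser (phi_mu n \<mu> \<phi>) (cis (- t)))) \<le> 1 / m"
    using AE_beta_nz[OF \<mu>, of n] cmod_wcoeff_beta[OF \<mu>, of n]
  proof eventually_elim
    case (elim t)
    have "cmod (beta n (int \<mu>) t * inverse (powser (phi_mu n \<mu> \<phi>) (cis (- t)))) = 1 / cmod (powser \<phi> (cis (- t)))"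
      using elim by (simp add: px norm_mult norm_inverse divide_inverse)
    also have "\<dots> \<le> 1 / m" using m(1) m(2)[of t] by (intro divide_left_mono mult_pos_pos) auto
    finally show ?case .
  qed
  then show "\<exists>C. AE t in circ. cmod (beta n (int \<mu>) t * inverse (powser (phi_mu n \<mu> \<phi>) (cis (- t)))) \<le> C" by blast
  obtain y where y: "l1 y" "\<And>z. cmod z \<le> 1 \<Longrightarrow> powser y z = inverse (powser \<phi> z)"
    using canonical_reciprocal[OF rad nz] by metis
  obtain R where R: "\<And>j. l1 (R j)" "\<And>j z. cmod z = 1 \<Longrightarrow> cmod (powser (R j) z * powser (wcoeff n \<mu>) z) \<le> 2 ^ n"
    "\<And>z. cmod z = 1 \<Longrightarrow> z ^ \<mu> \<noteq> 1 \<Longrightarrow> (\<lambda>j. powser (R j) z * powser (wcoeff n \<mu>) z) \<longlonglongrightarrow> 1"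
    using wcoeff_approx_inverse[OF \<mu>, of n] by blast
  have eq: "powser (conv y (R j)) z * powser (phi_mu n \<mu> \<phi>) z = powser (R j) z * powser (wcoeff n \<mu>) z" if "cmod z \<le> 1" for j z
    using nz[OF that] by (simp add: powser_conv[OF y(1) R(1) that] px[OF that] y(2)[OF that])
  show "\<exists>R C. (\<forall>j::nat. l1 (R j)) \<and>
       (AE t in circ. \<forall>j. cmod (powser (R j) (cis (- t)) * powser (phi_mu n \<mu> \<phi>) (cis (- t))) \<le> C) \<and>
       (AE t in circ. (\<lambda>j. powser (R j) (cis (- t)) * powser (phi_mu n \<mu> \<phi>) (cis (- t))) \<longlonglongrightarrow> 1)"
  proof (intro exI[of _ "\<lambda>j. conv y (R j)"] exI[of _ "2 ^ n"] conjI allI)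
    show "l1 (conv y (R j))" for j by (intro l1_conv y R)
    show "AE t in circ. \<forall>j. cmod (powser (conv y (R j)) (cis (- t)) * powser (phi_mu n \<mu> \<phi>) (cis (- t))) \<le> 2 ^ n"
      using R(2) by (simp add: eq)
    show "AE t in circ. (\<lambda>j. powser (conv y (R j)) (cis (- t)) * powser (phi_mu n \<mu> \<phi>) (cis (- t))) \<longlonglongrightarrow> 1"
      using AE_circ_generic[OF \<mu>]
    proof eventually_elim
      case (elim t)
      have "cis (- t) ^ \<mu> = cnj (cis (real \<mu> * t))" by (simp add: Complex.DeMoivre cis_cnj)
      then have "cis (- t) ^ \<mu> \<noteq> 1" using elim by (metis complex_cnj_cnj complex_cnj_one)
      then show ?case using R(3)[of "cis (- t)"] by (simp add: eq)
    qed
  qed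
qed

section \<open>The space spanned by the past\<close>

definition past_span :: "nat \<Rightarrow> nat \<Rightarrow> int \<Rightarrow> (real \<Rightarrow> complex) set" where
  "past_span n \<mu> m = {\<lambda>t. \<Sum>k\<in>K. c k * (cis (real_of_int k * t) * beta n (int \<mu>) t) | K c. finite K \<and> K \<subseteq> {..m}}"

lemma past_span_sq: "spectral_density f \<Longrightarrow> Y \<in> past_span n \<mu> m \<Longrightarrow> sq_integrable (spectral_meas f) Y"
  unfolding past_span_def
  by (auto intro!: sq_integrable_sum sq_integrable_cmult sq_integrable_cis_beta)

lemma past_span_combine:
  assumes "Y \<in> past_span n \<mu> m" "Z \<in> past_span n \<mu> m"
  shows "(\<lambda>t. a * Y t + b * Z t) \<in> past_span n \<mu> m"
proof -
  let ?e = "\<lambda>k t. cis (real_of_int k * t) * beta n (int \<mu>) t"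
  obtain K c where K: "finite K" "K \<subseteq> {..m}" "Y = (\<lambda>t. \<Sum>k\<in>K. c k * ?e k t)"
    using assms(1) unfolding past_span_def by blast
  obtain L d where L: "finite L" "L \<subseteq> {..m}" "Z = (\<lambda>t. \<Sum>k\<in>L. d k * ?e k t)"
    using assms(2) unfolding past_span_def by blast
  define e where "e k = a * (if k \<in> K then c k else 0) + b * (if k \<in> L then d k else 0)" for k
  have "a * Y t + b * Z t = (\<Sum>k\<in>K \<union> L. e k * ?e k t)" for t
  proof -
    have "Y t = (\<Sum>k\<in>K \<union> L. (if k \<in> K then c k else 0) * ?e k t)"
      unfolding K(3) by (intro sum.mono_neutral_cong_left) (use K L in auto)
    moreover have "Z t = (\<Sum>k\<in>K \<union> L. (if k \<in> L then d k else 0) * ?e k t)"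
      unfolding L(3) by (intro sum.mono_neutral_cong_left) (use K L in auto)
    ultimately show ?thesis
      by (simp only: e_def sum_distrib_left sum.distrib[symmetric]) (simp add: algebra_simps)
  qed
  then show ?thesis unfolding past_span_def using K(1,2) L(1,2) by blast
qed

lemma past_span_zero: "(\<lambda>t. 0) \<in> past_span n \<mu> m"
  unfolding past_span_def by (intro CollectI exI[of _ "{}"]) auto

text \<open>
  The defining condition on integrals with weight \<open>f\<close>, restated in the Hilbert space of the
  measure \<open>f dt\<close>.
\<close>

lemma L2_past_closure:
  assumes f: "spectral_density f"
  shows "L2_past n \<mu> f = l2_closure (spectral_meas f) (past_span n \<mu> (- 1))"
proof -
  let ?s = "\<lambda>K c t. \<Sum>k\<in>K. c k * (cis (real_of_int k * t) * beta n (int \<mu>) t)"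
  have eq: "(LINT t|circ. (cmod (g t - ?s K c t))\<^sup>2 * f t) = l2sq (spectral_meas f) (\<lambda>t. g t - ?s K c t)"
    if "sq_integrable (spectral_meas f) g" for g K c
  proof -
    have "sq_integrable (spectral_meas f) (?s K c)"
      by (intro sq_integrable_sum sq_integrable_cmult sq_integrable_cis_beta f)
    then have "(\<lambda>t. g t - ?s K c t) \<in> borel_measurable circ"
      using sq_integrable_measurable[OF sq_integrable_diff[OF that]] by (simp add: measurable_spec)
    then show ?thesis by (rule l2sq_spec[OF f, symmetric])
  qed
  have "g \<in> L2_past n \<mu> f \<longleftrightarrow> g \<in> l2_closure (spectral_meas f) (past_span n \<mu> (- 1))" for g
  proof (cases "sq_integrable (spectral_meas f) g")
    case True
    have "g \<in> L2_past n \<mu> f \<longleftrightarrow> (\<forall>e>0. \<exists>K c. finite K \<and> K \<subseteq> {..-1} \<and> l2sq (spectral_meas f) (\<lambda>t. g t - ?s K c t) < e)"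
      unfolding L2_past_def using True by (simp add: L2_space_spec[OF f] eq[OF True])
    also have "\<dots> \<longleftrightarrow> g \<in> l2_closure (spectral_meas f) (past_span n \<mu> (- 1))"
      unfolding l2_closure_def past_span_def using True by fast
    finally show ?thesis .
  next
    case False
    then show ?thesis unfolding L2_past_def l2_closure_def by (simp add: L2_space_spec[OF f])
  qed
  then show ?thesis by blast
qed

lemma l2sq_cong_AE_spec:
  assumes f: "spectral_density f" and g: "g \<in> borel_measurable circ" "g' \<in> borel_measurable circ"
    and ae: "AE t in circ. g t = g' t"
  shows "l2sq (spectral_meas f) g = l2sq (spectral_meas f) g'"
  unfolding l2sq_def
  by (intro integral_cong_AE)
     (use g AE_spec[OF f ae] in \<open>auto simp: measurable_spec elim!: eventually_mono intro!: borel_measurable_power borel_measurable_norm\<close>)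

lemma l2_closure_cong_AE:
  assumes f: "spectral_density f" and V: "\<And>Y. Y \<in> V \<Longrightarrow> sq_integrable (spectral_meas f) Y"
    and g: "g \<in> l2_closure (spectral_meas f) V" and g': "g' \<in> borel_measurable circ" and ae: "AE t in circ. g t = g' t"
  shows "g' \<in> l2_closure (spectral_meas f) V"
proof -
  have sq: "sq_integrable (spectral_meas f) g" using g by (simp add: l2_closure_def)
  have gm: "g \<in> borel_measurable circ" using sq_integrable_measurable[OF sq] by (simp add: measurable_spec)
  have sq': "sq_integrable (spectral_meas f) g'"
    by (rule sq_integrable_bound[OF sq]) (use g' AE_spec[OF f ae] in \<open>auto simp: measurable_spec elim!: eventually_mono\<close>)
  have "l2sq (spectral_meas f) (\<lambda>t. g' t - Y t) = l2sq (spectral_meas f) (\<lambda>t. g t - Y t)" if "Y \<in> V" for Y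
  proof (rule l2sq_cong_AE_spec[OF f])
    have [measurable]: "Y \<in> borel_measurable circ" using sq_integrable_measurable[OF V[OF that]] by (simp add: measurable_spec)
    show "(\<lambda>t. g' t - Y t) \<in> borel_measurable circ" "(\<lambda>t. g t - Y t) \<in> borel_measurable circ"
      using g' gm by measurable
    show "AE t in circ. g' t - Y t = g t - Y t" using ae by eventually_elim simp
  qed
  then show ?thesis using g sq' unfolding l2_closure_def by simp
qed

section \<open>Prediction from an outer factor\<close>

context outer_factor
begin

abbreviation X :: "real \<Rightarrow> complex" where "X t \<equiv> powser x (cis (- t))"

lemma X_measurable [measurable]: "X \<in> borel_measurable circ"
  by (intro continuous_borel_circ powser_cis_continuous l1x continuous_intros)

text \<open>
  Up to the approximate inverses \<open>R\<^sub>j\<close> the function is \<open>exp(imt) Y R\<^sub>j \<beta>\<close>, an absolutely convergent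
  series in \<open>exp(ikt) \<beta>\<close> with \<open>k \<le> m\<close>. The error carries the factor \<open>1 - R\<^sub>j X\<close> and is bounded, so it
  tends to \<open>0\<close> in \<open>L\<^sub>2(f)\<close> by dominated convergence for every integrable \<open>f\<close>. That the density here
  is arbitrary, and not the one factored by \<open>X\<close>, is what puts the predictor into the class of
  characteristics admitted for all densities.
\<close>

lemma in_past:
  assumes f: "spectral_density f" and y: "l1 y"
  shows "(\<lambda>t. cis (real_of_int m * t) * powser y (cis (- t)) * (beta n (int \<mu>) t * inverse (X t)))
    \<in> l2_closure (spectral_meas f) (past_span n \<mu> m)" (is "?g \<in> _")
proof -
  obtain C where C: "AE t in circ. cmod (beta n (int \<mu>) t * inverse (X t)) \<le> C" using ratio_bounded by blast
  obtain R C' where R: "\<And>j::nat. l1 (R j)"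
     "AE t in circ. \<forall>j. cmod (powser (R j) (cis (- t)) * X t) \<le> C'"
     "AE t in circ. (\<lambda>j. powser (R j) (cis (- t)) * X t) \<longlonglongrightarrow> 1"
    using approx_inverse by blast
  define S where "S = (\<Sum>k. cmod (y k))"
  define D where "D = S * \<bar>C\<bar> * (\<bar>C'\<bar> + 1)"
  have S0: "0 \<le> S" using y unfolding S_def l1_def by (intro suminf_nonneg) auto
  let ?Y = "\<lambda>t. powser y (cis (- t))"
  let ?Rj = "\<lambda>j t. powser (R j) (cis (- t))"
  have [measurable]: "?Y \<in> borel_measurable circ" "?Rj j \<in> borel_measurable circ" for j
    by (intro continuous_borel_circ powser_cis_continuous y R continuous_intros)+
  define h where "h j t = cis (real_of_int m * t) * (?Y t * ?Rj j t) * beta n (int \<mu>) t" for j t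
  have hm [measurable]: "h j \<in> borel_measurable circ" for j unfolding h_def by measurable
  have gm [measurable]: "?g \<in> borel_measurable circ" by measurable
  interpret fin: finite_measure "spectral_meas f" by (rule finite_measure_spec[OF f])
  have diff: "AE t in circ. \<forall>j. ?g t - h j t = cis (real_of_int m * t) * ?Y t * (beta n (int \<mu>) t * inverse (X t)) * (1 - ?Rj j t * X t)"
    using nonzero by eventually_elim (auto simp: h_def field_simps)
  have dbound: "AE t in circ. \<forall>j. cmod (?g t - h j t) \<le> D"
    using diff C R(2)
  proof eventually_elim
    case (elim t)
    show ?case
    proof
      fix j
      have "cmod (?g t - h j t) = cmod (?Y t) * cmod (beta n (int \<mu>) t * inverse (X t)) * cmod (1 - ?Rj j t * X t)"
        using elim(1) by (simp add: norm_mult)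
      also have "\<dots> \<le> S * \<bar>C\<bar> * (\<bar>C'\<bar> + 1)"
      proof (intro mult_mono)
        show "cmod (?Y t) \<le> S" unfolding S_def by (rule powser_bound[OF y]) simp
        show "cmod (beta n (int \<mu>) t * inverse (X t)) \<le> \<bar>C\<bar>" using elim(2) by linarith
        have "cmod (1 - ?Rj j t * X t) \<le> 1 + cmod (?Rj j t * X t)" using norm_triangle_ineq4[of 1 "?Rj j t * X t"] by simp
        also have "\<dots> \<le> \<bar>C'\<bar> + 1" using elim(3) by (smt (verit) abs_ge_self)
        finally show "cmod (1 - ?Rj j t * X t) \<le> \<bar>C'\<bar> + 1" .
      qed (use S0 in auto)
      finally show "cmod (?g t - h j t) \<le> D" by (simp add: D_def)
    qed
  qed
  have "(\<lambda>j. LINT t|spectral_meas f. (cmod (?g t - h j t))\<^sup>2) \<longlonglongrightarrow> (LINT t|spectral_meas f. 0)"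
  proof (rule integral_dominated_convergence[where w="\<lambda>_. D\<^sup>2"])
    show "AE t in spectral_meas f. (\<lambda>j. (cmod (?g t - h j t))\<^sup>2) \<longlonglongrightarrow> 0"
      using AE_spec[OF f diff] AE_spec[OF f R(3)]
    proof eventually_elim
      case (elim t)
      have "(\<lambda>j. (cmod (cis (real_of_int m * t) * ?Y t * (beta n (int \<mu>) t * inverse (X t)) * (1 - ?Rj j t * X t)))\<^sup>2) \<longlonglongrightarrow>
          (cmod (cis (real_of_int m * t) * ?Y t * (beta n (int \<mu>) t * inverse (X t)) * (1 - 1)))\<^sup>2"
        by (intro tendsto_intros elim)
      then show ?case using elim(1) by simp
    qed
    show "AE t in spectral_meas f. norm ((cmod (?g t - h j t))\<^sup>2) \<le> D\<^sup>2" for j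
      using AE_spec[OF f dbound] by eventually_elim (auto intro!: power_mono)
  qed (auto simp: measurable_spec intro!: borel_measurable_power borel_measurable_norm borel_measurable_diff hm gm)
  then have lim: "(\<lambda>j. l2sq (spectral_meas f) (\<lambda>t. h j t - ?g t)) \<longlonglongrightarrow> 0"
    by (simp add: l2sq_minus_commute[of _ "h _"]) (simp add: l2sq_def)
  have h_past: "h j \<in> l2_closure (spectral_meas f) (past_span n \<mu> m)" for j
  proof (rule l2_closure_limit[OF past_span_sq[OF f]])
    define u where "u = conv y (R j)"
    have u: "l1 u" "powser u (cis (- t)) = ?Y t * ?Rj j t" for t
      unfolding u_def by (auto intro: l1_conv y R simp: powser_conv y R)
    define s where "s N t = (\<Sum>k<N. u k * (cis (real_of_int (m - int k) * t) * beta n (int \<mu>) t))" for N t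
    have s_span: "s N \<in> past_span n \<mu> m" for N
    proof -
      let ?K = "(\<lambda>k. m - int k) ` {..<N}"
      have "s N = (\<lambda>t. \<Sum>k\<in>?K. u (nat (m - k)) * (cis (real_of_int k * t) * beta n (int \<mu>) t))"
        by (subst sum.reindex) (auto simp: s_def inj_on_def fun_eq_iff)
      then show ?thesis unfolding past_span_def by (intro CollectI exI[of _ ?K] exI[of _ "\<lambda>k. u (nat (m - k))"]) auto
    qed
    show "s N \<in> l2_closure (spectral_meas f) (past_span n \<mu> m)" for N
      using s_span[of N] past_span_sq[OF f s_span] unfolding l2_closure_def by (force simp: l2sq_def)
    have eq: "s N t - h j t = cis (real_of_int m * t) * ((\<Sum>k<N. u k * cis (- t) ^ k) - powser u (cis (- t))) * beta n (int \<mu>) t" for N t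
    proof -
      have "cis (real_of_int (m - int k) * t) = cis (real_of_int m * t) * cis (- t) ^ k" for k
        by (simp add: Complex.DeMoivre cis_mult left_diff_distrib)
      then show ?thesis
        by (simp add: s_def h_def u(2) right_diff_distrib left_diff_distrib sum_distrib_left sum_distrib_right mult_ac)
    qed
    have bd: "l2sq (spectral_meas f) (\<lambda>t. s N t - h j t) \<le> ((\<Sum>k. cmod (u (k + N))) * \<bar>real_of_int (int \<mu>)\<bar> ^ n)\<^sup>2 * (LINT t|circ. f t)" for N
      unfolding eq
    proof (rule sq_integrable_bounded_beta(2)[OF f])
      show "(\<lambda>t. cis (real_of_int m * t) * ((\<Sum>k<N. u k * cis (- t) ^ k) - powser u (cis (- t)))) \<in> borel_measurable circ"
        by (intro continuous_borel_circ continuous_intros powser_cis_continuous u)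
      show "AE t in circ. cmod (cis (real_of_int m * t) * ((\<Sum>k<N. u k * cis (- t) ^ k) - powser u (cis (- t)))) \<le> (\<Sum>k. cmod (u (k + N)))"
        using powser_truncation[OF u(1)] by (intro AE_I2) (simp add: norm_mult norm_minus_commute)
      show "0 \<le> (\<Sum>k. cmod (u (k + N)))" using u(1) unfolding l1_def
        by (intro suminf_nonneg) (simp_all add: summable_iff_shift[where f="\<lambda>k. cmod (u k)"])
    qed
    have "(\<lambda>N. ((\<Sum>k. cmod (u (k + N))) * \<bar>real_of_int (int \<mu>)\<bar> ^ n)\<^sup>2 * (LINT t|circ. f t)) \<longlonglongrightarrow> (0 * \<bar>real_of_int (int \<mu>)\<bar> ^ n)\<^sup>2 * (LINT t|circ. f t)"
      by (intro tendsto_intros l1_tail_tendsto u)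
    then show "(\<lambda>N. l2sq (spectral_meas f) (\<lambda>t. s N t - h j t)) \<longlonglongrightarrow> 0"
      using tendsto_sandwich[OF always_eventually always_eventually tendsto_const, OF allI allI, OF l2sq_nonneg bd] by simp
    show "sq_integrable (spectral_meas f) (h j)"
      unfolding h_def
    proof (rule sq_integrable_bounded_beta(1)[OF f])
      show "(\<lambda>t. cis (real_of_int m * t) * (?Y t * ?Rj j t)) \<in> borel_measurable circ" by measurable
      show "AE t in circ. cmod (cis (real_of_int m * t) * (?Y t * ?Rj j t)) \<le> (\<Sum>k. cmod (u k))"
        using powser_bound[OF u(1)] by (intro AE_I2) (simp add: norm_mult flip: u(2))
      show "0 \<le> (\<Sum>k. cmod (u k))" using u(1) unfolding l1_def by (intro suminf_nonneg) auto
    qed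
  qed
  have "sq_integrable (spectral_meas f) ?g"
  proof (rule fin.sq_integrable_bounded(1))
    show "?g \<in> borel_measurable (spectral_meas f)" using gm by (simp add: measurable_spec)
    show "AE t in spectral_meas f. cmod (?g t) \<le> S * \<bar>C\<bar>"
      using AE_spec[OF f C]
    proof eventually_elim
      case (elim t)
      have "cmod (?g t) = cmod (?Y t) * cmod (beta n (int \<mu>) t * inverse (X t))" by (simp add: norm_mult)
      also have "\<dots> \<le> S * \<bar>C\<bar>"
        using elim S0 powser_bound[OF y, of "cis (- t)"] by (intro mult_mono) (auto simp: S_def)
      finally show ?case .
    qed
  qed
  from l2_closure_limit[where X=h, OF past_span_sq[OF f] h_past this lim] show ?thesis .
qed

text \<open>
  The prediction error \<open>r \<beta> / \<Phi>\<^sub>\<mu>\<close> and the predictor \<open>A - r / \<Phi>\<^sub>\<mu>\<close>.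
\<close>

definition remainder :: "(nat \<Rightarrow> complex) \<Rightarrow> real \<Rightarrow> complex" where
  "remainder b t = powser (hankel b x) (cis t) * (beta n (int \<mu>) t * inverse (X t))"

definition predictor :: "(nat \<Rightarrow> complex) \<Rightarrow> real \<Rightarrow> complex" where
  "predictor b t = powser b (cis t) - powser (hankel b x) (cis t) * inverse (X t)"

context
  fixes b :: "nat \<Rightarrow> complex"
  assumes b: "l1 b"
begin

lemma hankel_measurable [measurable]: "(\<lambda>t. powser (hankel b x) (cis t)) \<in> borel_measurable circ"
  by (intro continuous_borel_circ powser_cis_continuous hankel_split b l1x continuous_intros)

lemma b_measurable [measurable]: "(\<lambda>t. powser b (cis t)) \<in> borel_measurable circ"
  by (intro continuous_borel_circ powser_cis_continuous b continuous_intros)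

lemma remainder_measurable [measurable]: "remainder b \<in> borel_measurable circ"
  unfolding remainder_def by measurable

lemma remainder_sq: "spectral_density f \<Longrightarrow> sq_integrable (spectral_meas f) (remainder b)"
proof -
  assume f: "spectral_density f"
  interpret fin: finite_measure "spectral_meas f" by (rule finite_measure_spec[OF f])
  obtain C where C: "AE t in circ. cmod (beta n (int \<mu>) t * inverse (X t)) \<le> C" using ratio_bounded by blast
  define S where "S = (\<Sum>k. cmod (hankel b x k))"
  have l: "l1 (hankel b x)" by (rule hankel_split[OF b l1x])
  have S0: "0 \<le> S" using l unfolding S_def l1_def by (intro suminf_nonneg) auto
  show ?thesis
  proof (rule fin.sq_integrable_bounded(1))
    show "remainder b \<in> borel_measurable (spectral_meas f)" by (simp add: measurable_spec)
    show "AE t in spectral_meas f. cmod (remainder b t) \<le> S * \<bar>C\<bar>"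
      using AE_spec[OF f C]
    proof eventually_elim
      case (elim t)
      then show ?case unfolding remainder_def norm_mult[of "powser _ _"]
        using S0 powser_bound[OF l, of "cis t"] by (intro mult_mono) (auto simp: S_def)
    qed
  qed
qed

text \<open>
  Multiplied by \<open>\<Phi>\<^sub>\<mu>\<close>, the predictor is the antianalytic part of the product of \<open>A\<close> and \<open>\<Phi>\<^sub>\<mu>\<close>.
\<close>

lemma predictor_spectral_char:
  assumes f: "spectral_density f" shows "spectral_char n \<mu> f (predictor b)"
  unfolding spectral_char_def L2_past_closure[OF f]
proof (rule l2_closure_cong_AE[OF f past_span_sq[OF f] in_past[OF f, where m="-1" and y="\<lambda>m. hankel x b (Suc m)"]])
  show "l1 (\<lambda>m. hankel x b (Suc m))" by (rule hankel_split[OF b l1x])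
  show "(\<lambda>t. predictor b t * beta n (int \<mu>) t) \<in> borel_measurable circ"
    unfolding predictor_def by measurable
  show "AE t in circ. cis (real_of_int (- 1) * t) * powser (\<lambda>m. hankel x b (Suc m)) (cis (- t)) * (beta n (int \<mu>) t * inverse (X t)) =
     predictor b t * beta n (int \<mu>) t"
    using nonzero
  proof eventually_elim
    case (elim t)
    have eq: "cis (real_of_int (- 1) * t) * powser (\<lambda>m. hankel x b (Suc m)) (cis (- t)) =
        powser b (cis t) * X t - powser (hankel b x) (cis t)"
      using hankel_split(3)[OF b l1x, of t] by simp
    show ?case unfolding eq predictor_def using elim by (simp add: field_simps)
  qed
qed

text \<open>
  By \<open>|\<beta>|\<^sup>2 f0 = |\<Phi>\<^sub>\<mu>|\<^sup>2\<close> the inner product of \<open>r \<beta>/\<Phi>\<^sub>\<mu>\<close> with \<open>exp(ikt) \<beta>\<close> is the \<open>k\<close>-th Fourier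
  coefficient of \<open>r\<close> times the conjugate of \<open>\<Phi>\<^sub>\<mu>\<close>. Both factors are analytic, so it vanishes for
  \<open>k < 0\<close>.
\<close>

lemma remainder_orthogonal:
  assumes "Y \<in> past_span n \<mu> (- 1)"
  shows "l2ip (spectral_meas f0) (remainder b) Y = 0"
proof -
  let ?e = "\<lambda>k t. cis (real_of_int k * t) * beta n (int \<mu>) t"
  obtain K c where K: "finite K" "K \<subseteq> {..-1}" "Y = (\<lambda>t. \<Sum>k\<in>K. c k * ?e k t)"
    using assms unfolding past_span_def by blast
  have single: "l2ip (spectral_meas f0) (remainder b) (?e k) = 0" if "k \<le> -1" for k
  proof -
    define u where "u = conv (hankel b x) (\<lambda>k. cnj (x k))"
    have l: "l1 (hankel b x)" by (rule hankel_split[OF b l1x])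
    have u: "l1 u" "powser u (cis t) = powser (hankel b x) (cis t) * cnj (X t)" for t
      using powser_cnj[OF l1x, of "cis (- t)"]
      by (auto simp: u_def powser_conv l l1_cnj l1x cis_cnj intro!: l1_conv)
    have "l2ip (spectral_meas f0) (remainder b) (?e k) = (LINT t|circ. f0 t *\<^sub>R (remainder b t * cnj (?e k t)))"
      unfolding l2ip_def by (rule integral_spec[OF f0]) measurable
    also have "\<dots> = (LINT t|circ. cis (- (real_of_int k * t)) * powser u (cis t))"
    proof (rule integral_cong_AE)
      show "(\<lambda>t. f0 t *\<^sub>R (remainder b t * cnj (?e k t))) \<in> borel_measurable circ"
        using spectral_densityD(3)[OF f0] by measurable
      show "(\<lambda>t. cis (- (real_of_int k * t)) * powser u (cis t)) \<in> borel_measurable circ"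
        by (intro continuous_borel_circ continuous_intros powser_cis_continuous u)
      show "AE t in circ. f0 t *\<^sub>R (remainder b t * cnj (?e k t)) = cis (- (real_of_int k * t)) * powser u (cis t)"
        using modulus nonzero
      proof eventually_elim
        case (elim t)
        have "f0 t *\<^sub>R (remainder b t * cnj (?e k t)) =
           powser (hankel b x) (cis t) * cis (- (real_of_int k * t)) * (of_real (f0 t) * (beta n (int \<mu>) t * cnj (beta n (int \<mu>) t))) * inverse (X t)"
          by (simp add: remainder_def scaleR_conv_of_real cis_cnj mult_ac)
        also have "of_real (f0 t) * (beta n (int \<mu>) t * cnj (beta n (int \<mu>) t)) = complex_of_real ((cmod (X t))\<^sup>2)"
          unfolding elim(1) of_real_mult complex_norm_square by simp
        also have "\<dots> = X t * cnj (X t)" by (rule complex_norm_square)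
        finally show ?case using elim(2) by (simp add: u(2) field_simps)
      qed
    qed
    also have "\<dots> = 0" using fourier_coeff_powser[OF u(1), of k] that by simp
    finally show ?thesis .
  qed
  have "l2ip (spectral_meas f0) (\<lambda>t. \<Sum>i\<in>{()}. 1 * remainder b t) Y = (\<Sum>i\<in>{()}. \<Sum>k\<in>K. 1 * cnj (c k) * l2ip (spectral_meas f0) (remainder b) (?e k))"
    unfolding K(3) by (intro l2ip_sum_sum K remainder_sq f0 sq_integrable_cis_beta) auto
  also have "\<dots> = 0" using K(2) single by (auto intro!: sum.neutral)
  finally show ?thesis by simp
qed

lemma prediction_pythagoras:
  assumes h: "spectral_char n \<mu> f0 h"
  shows "l2sq (spectral_meas f0) (\<lambda>t. powser b (cis t) * beta n (int \<mu>) t - h t * beta n (int \<mu>) t) =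
    l2sq (spectral_meas f0) (remainder b) + l2sq (spectral_meas f0) (\<lambda>t. predictor b t * beta n (int \<mu>) t - h t * beta n (int \<mu>) t)"
proof -
  define d where "d t = predictor b t * beta n (int \<mu>) t - h t * beta n (int \<mu>) t" for t
  have past: "(\<lambda>t. predictor b t * beta n (int \<mu>) t) \<in> l2_closure (spectral_meas f0) (past_span n \<mu> (- 1))"
    "(\<lambda>t. h t * beta n (int \<mu>) t) \<in> l2_closure (spectral_meas f0) (past_span n \<mu> (- 1))"
    using predictor_spectral_char[OF f0] h by (auto simp: spectral_char_def L2_past_closure[OF f0])
  have "(\<lambda>t. 1 * (predictor b t * beta n (int \<mu>) t) + (- 1) * (h t * beta n (int \<mu>) t)) \<in> l2_closure (spectral_meas f0) (past_span n \<mu> (- 1))"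
    by (rule l2_closure_combine[OF past_span_sq[OF f0] past_span_combine past])
  then have d: "d \<in> l2_closure (spectral_meas f0) (past_span n \<mu> (- 1))" by (simp add: d_def[abs_def])
  have orth: "l2ip (spectral_meas f0) (remainder b) d = 0"
    by (rule l2_closure_orthogonal[OF remainder_sq[OF f0] past_span_sq[OF f0] remainder_orthogonal d])
  have "l2sq (spectral_meas f0) (\<lambda>t. remainder b t + d t) = l2sq (spectral_meas f0) (remainder b) + l2sq (spectral_meas f0) d"
    using l2sq_add_expand[OF remainder_sq[OF f0], of d] d orth by (simp add: l2_closure_def)
  moreover have "(\<lambda>t. remainder b t + d t) = (\<lambda>t. powser b (cis t) * beta n (int \<mu>) t - h t * beta n (int \<mu>) t)"
    by (simp add: fun_eq_iff d_def predictor_def remainder_def algebra_simps)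
  ultimately show ?thesis by (simp add: d_def[abs_def])
qed

end

lemma mse_char:
  assumes f: "spectral_density f" and b: "l1 (bcoeff n \<mu> a)" and h: "spectral_char n \<mu> f h"
  shows "mse n \<mu> a h f = 1 / (2 * pi) *
    l2sq (spectral_meas f) (\<lambda>t. powser (bcoeff n \<mu> a) (cis t) * beta n (int \<mu>) t - h t * beta n (int \<mu>) t)"
  using h by (intro mse_integral f b) (auto simp: spectral_char_def L2_past_closure[OF f] l2_closure_def)

lemma mse_predictor:
  assumes f: "spectral_density f" and b: "l1 (bcoeff n \<mu> a)"
  shows "mse n \<mu> a (predictor (bcoeff n \<mu> a)) f = 1 / (2 * pi) * l2sq (spectral_meas f) (remainder (bcoeff n \<mu> a))"
proof -
  have "(\<lambda>t. powser (bcoeff n \<mu> a) (cis t) * beta n (int \<mu>) t - predictor (bcoeff n \<mu> a) t * beta n (int \<mu>) t) = remainder (bcoeff n \<mu> a)"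
    by (simp add: fun_eq_iff predictor_def remainder_def algebra_simps)
  then show ?thesis using mse_char[OF f b predictor_spectral_char[OF b f]] by simp
qed

lemma predictor_optimal:
  assumes b: "l1 (bcoeff n \<mu> a)"
  shows "optimal_char n \<mu> a f0 (predictor (bcoeff n \<mu> a))"
  unfolding optimal_char_def
proof (intro conjI allI impI predictor_spectral_char b f0)
  fix h assume h: "spectral_char n \<mu> f0 h"
  show "mse n \<mu> a (predictor (bcoeff n \<mu> a)) f0 \<le> mse n \<mu> a h f0"
    unfolding mse_predictor[OF f0 b] mse_char[OF f0 b h] prediction_pythagoras[OF b h]
    by (intro mult_left_mono) auto
qed

lemma mse_predictor_density:
  assumes f: "spectral_density f" and b: "l1 (bcoeff n \<mu> a)" and pos: "AE t in circ. f0 t > 0"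
  shows "mse n \<mu> a (predictor (bcoeff n \<mu> a)) f =
     1 / (2 * pi) * (LINT t|circ. (cmod (powser (hankel (bcoeff n \<mu> a) x) (cis t)))\<^sup>2 / f0 t * f t)"
    and "integrable circ (\<lambda>t. (cmod (powser (hankel (bcoeff n \<mu> a) x) (cis t)))\<^sup>2 / f0 t * f t)"
proof -
  let ?b = "bcoeff n \<mu> a"
  note [measurable] = remainder_measurable[OF b] hankel_measurable[OF b] spectral_densityD(3)[OF f] spectral_densityD(3)[OF f0]
  have ae: "AE t in circ. (cmod (remainder ?b t))\<^sup>2 * f t = (cmod (powser (hankel ?b x) (cis t)))\<^sup>2 / f0 t * f t"
    using modulus nonzero pos
  proof eventually_elim
    case (elim t)
    have nz: "cmod (beta n (int \<mu>) t) \<noteq> 0" using elim by auto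
    have "(cmod (remainder ?b t))\<^sup>2 =
        (cmod (powser (hankel ?b x) (cis t)))\<^sup>2 * ((cmod (beta n (int \<mu>) t))\<^sup>2 * inverse ((cmod (X t))\<^sup>2))"
      by (simp add: remainder_def norm_mult norm_inverse power_mult_distrib power_inverse)
    also have "\<dots> = (cmod (powser (hankel ?b x) (cis t)))\<^sup>2 / f0 t"
      unfolding elim(1) using nz elim(3) by (simp add: field_simps)
    finally show ?case by simp
  qed
  have "l2sq (spectral_meas f) (remainder ?b) = (LINT t|circ. (cmod (remainder ?b t))\<^sup>2 * f t)"
    by (rule l2sq_spec[OF f]) measurable
  also have "\<dots> = (LINT t|circ. (cmod (powser (hankel ?b x) (cis t)))\<^sup>2 / f0 t * f t)"
    using ae by (intro integral_cong_AE) measurable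
  finally show "mse n \<mu> a (predictor ?b) f =
     1 / (2 * pi) * (LINT t|circ. (cmod (powser (hankel ?b x) (cis t)))\<^sup>2 / f0 t * f t)"
    by (simp add: mse_predictor[OF f b])
  have "integrable circ (\<lambda>t. (cmod (remainder ?b t))\<^sup>2 * f t)"
    using remainder_sq[OF b f] unfolding L2_space_spec[OF f, symmetric] L2_space_def by simp
  then show "integrable circ (\<lambda>t. (cmod (powser (hankel ?b x) (cis t)))\<^sup>2 / f0 t * f t)"
    by (rule integrable_cong_AE_imp) (use ae in measurable)
qed

end

context outer_factor
begin

section \<open>The moving average representation\<close>

text \<open>
  The spectral characteristics of the innovations: the increments are recovered from them by the
  filter \<open>\<Phi>\<^sub>\<mu>\<close>, as \<open>\<Phi>\<^sub>\<mu> \<cdot> \<beta>/\<Phi>\<^sub>\<mu> = \<beta>\<close>.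
\<close>

definition innovation :: "int \<Rightarrow> real \<Rightarrow> complex" where
  "innovation m t = cis (real_of_int m * t) * (beta n (int \<mu>) t * inverse (X t))"

lemma innovation_measurable [measurable]: "innovation m \<in> borel_measurable circ"
  unfolding innovation_def by measurable

lemma innovation_past: "innovation m \<in> l2_closure (spectral_meas f0) (past_span n \<mu> m)"
  using in_past[OF f0 l1_unit(1), of m] by (simp add: l1_unit(2) innovation_def[abs_def])

lemma innovation_sq: "sq_integrable (spectral_meas f0) (innovation m)"
  using innovation_past by (simp add: l2_closure_def)

lemma innovation_orthonormal:
  "l2ip (spectral_meas f0) (innovation j) (innovation k) = (if j = k then complex_of_real (2 * pi) else 0)"
proof -
  have "l2ip (spectral_meas f0) (innovation j) (innovation k) = (LINT t|circ. f0 t *\<^sub>R (innovation j t * cnj (innovation k t)))"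
    unfolding l2ip_def by (rule integral_spec[OF f0]) measurable
  also have "\<dots> = (LINT t|circ. cis (real_of_int (j - k) * t))"
  proof (rule integral_cong_AE)
    show "AE t in circ. f0 t *\<^sub>R (innovation j t * cnj (innovation k t)) = cis (real_of_int (j - k) * t)"
      using modulus nonzero
    proof eventually_elim
      case (elim t)
      have "f0 t *\<^sub>R (innovation j t * cnj (innovation k t)) =
          (cis (real_of_int j * t) * cnj (cis (real_of_int k * t))) *
          (of_real (f0 t) * (beta n (int \<mu>) t * cnj (beta n (int \<mu>) t))) * (inverse (X t) * inverse (cnj (X t)))"
        by (simp add: innovation_def scaleR_conv_of_real mult_ac)
      also have "of_real (f0 t) * (beta n (int \<mu>) t * cnj (beta n (int \<mu>) t)) = complex_of_real ((cmod (X t))\<^sup>2)"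
        unfolding elim(1) of_real_mult complex_norm_square by simp
      also have "\<dots> = X t * cnj (X t)" by (rule complex_norm_square)
      also have "cis (real_of_int j * t) * cnj (cis (real_of_int k * t)) = cis (real_of_int (j - k) * t)"
        by (simp add: cis_cnj cis_mult left_diff_distrib)
      finally show ?case using elim(2) by (simp add: field_simps)
    qed
  qed (use spectral_densityD(3)[OF f0] in measurable)
  also have "\<dots> = (if j = k then complex_of_real (2 * pi) else 0)" by (simp only: integral_cis) auto
  finally show ?thesis .
qed

text \<open>
  The stochastic integrals of the innovations are orthonormal by the isometry. The random measure is
  not assumed to be centered, so their means have to be computed from the increments, in whose
  closed span they lie.
\<close>

lemma moving_average:
  assumes rep: "spectral_representation n M \<xi> Z f0"
  shows "one_sided_moving_average M (incr n (int \<mu>) \<xi>)"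
proof -
  have Z: "orthogonal_measure M Z f0" and P: "prob_space M" and st: "stationary_increments n M \<xi>"
    and inc: "\<And>m. has_stoch_integral M Z f0 (\<lambda>t. cis (real_of_int m * t) * beta n (int \<mu>) t) (incr n (int \<mu>) \<xi> m)"
    using rep unfolding spectral_representation_def by blast+
  interpret prob_space M by (rule P)
  have "\<exists>X. has_stoch_integral M Z f0 (innovation m) X" for m
    using stoch_integral_exists[OF f0 Z innovation_sq] by metis
  then obtain \<epsilon> where \<epsilon>: "\<And>m. has_stoch_integral M Z f0 (innovation m) (\<epsilon> m)" by metis
  have sq: "sq_integrable M (\<epsilon> m)" for m by (rule has_stoch_integralD(1)[OF f0 \<epsilon>])
  have sq_inc: "sq_integrable M (incr n (int \<mu>) \<xi> m)" for m by (rule has_stoch_integralD(1)[OF f0 inc])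
  have one: "sq_integrable M (\<lambda>_. 1)" by (rule sq_integrable_bounded(1)[of _ 1]) auto
  have mean: "(LINT \<omega>|M. \<epsilon> m \<omega>) = 0" for m
  proof -
    have "(cmod (LINT \<omega>|M. \<epsilon> m \<omega>))\<^sup>2 \<le> e" if "e > 0" for e
    proof -
      obtain K c where K: "finite K" "l2sq (spectral_meas f0) (\<lambda>t. innovation m t - (\<Sum>k\<in>K. c k * (cis (real_of_int k * t) * beta n (int \<mu>) t))) < e"
        using innovation_past[of m] \<open>e > 0\<close> unfolding l2_closure_def past_span_def by blast
      define Y where "Y \<omega> = (\<Sum>k\<in>K. c k * incr n (int \<mu>) \<xi> k \<omega>)" for \<omega>
      have sqY: "sq_integrable M Y" unfolding Y_def[abs_def] by (intro sq_integrable_sum sq_integrable_cmult sq_inc)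
      have "(LINT \<omega>|M. Y \<omega>) = (\<Sum>k\<in>K. c k * (LINT \<omega>|M. incr n (int \<mu>) \<xi> k \<omega>))"
        unfolding Y_def using st by (subst Bochner_Integration.integral_sum) (auto simp: stationary_increments_def)
      also have "\<dots> = 0" using st by (simp add: stationary_increments_def)
      finally have "l2ip M (\<epsilon> m) (\<lambda>_. 1) = l2ip M (\<lambda>\<omega>. \<epsilon> m \<omega> - Y \<omega>) (\<lambda>_. 1)"
        using l2ip_diff_left[OF sq sqY one] by (simp add: l2ip_def)
      then have "(cmod (l2ip M (\<epsilon> m) (\<lambda>_. 1)))\<^sup>2 \<le> l2sq M (\<lambda>\<omega>. \<epsilon> m \<omega> - Y \<omega>) * l2sq M (\<lambda>_. 1)"
        using l2ip_Cauchy_Schwarz[OF sq_integrable_diff[OF sq sqY] one] by simp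
      also have "l2sq M (\<lambda>_. 1) = 1" by (simp add: l2sq_def prob_space)
      also have "l2sq M (\<lambda>\<omega>. \<epsilon> m \<omega> - Y \<omega>) = 1 / (2 * pi) * l2sq (spectral_meas f0) (\<lambda>t. innovation m t - (\<Sum>k\<in>K. c k * (cis (real_of_int k * t) * beta n (int \<mu>) t)))"
        unfolding l2sq_minus_commute[of M "\<epsilon> m"] l2sq_minus_commute[of "spectral_meas f0" "innovation m"] Y_def
        by (rule stoch_integral_diff[OF f0 Z K(1) inc \<epsilon>])
      also have "1 / (2 * pi) * l2sq (spectral_meas f0) (\<lambda>t. innovation m t - (\<Sum>k\<in>K. c k * (cis (real_of_int k * t) * beta n (int \<mu>) t))) \<le> 1 * e"
        using K(2) pi_gt3 by (intro mult_mono) auto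
      finally show ?thesis by (simp add: l2ip_def)
    qed
    then have "(cmod (LINT \<omega>|M. \<epsilon> m \<omega>))\<^sup>2 \<le> 0" by (rule field_le_epsilon) simp
    then show ?thesis by simp
  qed
  have orth: "(LINT \<omega>|M. \<epsilon> j \<omega> * cnj (\<epsilon> k \<omega>)) = (if j = k then 1 else 0)" for j k
  proof -
    have "l2ip M (\<epsilon> j) (\<epsilon> k) = (if j = k then 1 else 0)"
      using stoch_integral_l2ip[OF f0 Z \<epsilon> \<epsilon>, of j k] by (simp add: innovation_orthonormal)
    then show ?thesis by (simp only: l2ip_def)
  qed
  obtain C where C: "AE t in circ. cmod (beta n (int \<mu>) t * inverse (X t)) \<le> C" using ratio_bounded by blast
  interpret fin: finite_measure "spectral_meas f0" by (rule finite_measure_spec[OF f0])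
  have sums: "ms_sums M (\<lambda>k \<omega>. x k * \<epsilon> (m - int k) \<omega>) (incr n (int \<mu>) \<xi> m)" for m
    unfolding ms_sums_def ms_tendsto_def
  proof (intro conjI allI sq_inc sq_integrable_sum sq_integrable_cmult sq)
    define tail where "tail N = (\<Sum>k. cmod (x (k + N)))" for N
    let ?D = "\<lambda>N t. (\<Sum>k<N. x k * innovation (m - int k) t) - cis (real_of_int m * t) * beta n (int \<mu>) t"
    have "(LINT \<omega>|M. (cmod ((\<Sum>k<N. x k * \<epsilon> (m - int k) \<omega>) - incr n (int \<mu>) \<xi> m \<omega>))\<^sup>2) = 1 / (2 * pi) * l2sq (spectral_meas f0) (?D N)" for N
      using stoch_integral_diff[OF f0 Z finite_lessThan \<epsilon> inc, of x "\<lambda>k. m - int k" N m] by (simp add: l2sq_def)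
    moreover have "l2sq (spectral_meas f0) (?D N) \<le> (tail N * \<bar>C\<bar>)\<^sup>2 * measure (spectral_meas f0) (space (spectral_meas f0))" for N
    proof (rule fin.sq_integrable_bounded(2))
      show "?D N \<in> borel_measurable (spectral_meas f0)" unfolding measurable_spec by measurable
      show "AE t in spectral_meas f0. cmod (?D N t) \<le> tail N * \<bar>C\<bar>"
        using AE_spec[OF f0 C] AE_spec[OF f0 nonzero]
      proof eventually_elim
        case (elim t)
        have "innovation (m - int k) t = cis (- t) ^ k * (cis (real_of_int m * t) * (beta n (int \<mu>) t * inverse (X t)))" for k

        proof -
          have "cis (real_of_int (m - int k) * t) = cis (- t) ^ k * cis (real_of_int m * t)"
            by (simp add: Complex.DeMoivre cis_mult left_diff_distrib)
          then show ?thesis by (simp only: innovation_def mult.assoc)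
        qed
        then have "?D N t = ((\<Sum>k<N. x k * cis (- t) ^ k) - X t) * (cis (real_of_int m * t) * (beta n (int \<mu>) t * inverse (X t)))"
          using elim(2) by (simp add: sum_distrib_right left_diff_distrib mult.assoc)
        then have "cmod (?D N t) = cmod ((\<Sum>k<N. x k * cis (- t) ^ k) - X t) * cmod (beta n (int \<mu>) t * inverse (X t))"
          by (simp only: norm_mult) simp
        also have "\<dots> \<le> tail N * \<bar>C\<bar>"
          using powser_truncation[OF l1x, of "cis (- t)" N] elim(1)
          by (intro mult_mono') (auto simp: norm_minus_commute tail_def)
        finally show ?case .
      qed
    qed
    moreover have "(\<lambda>N. (tail N * \<bar>C\<bar>)\<^sup>2 * measure (spectral_meas f0) (space (spectral_meas f0))) \<longlonglongrightarrow> (0 * \<bar>C\<bar>)\<^sup>2 * measure (spectral_meas f0) (space (spectral_meas f0))"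
      unfolding tail_def by (intro tendsto_intros l1_tail_tendsto l1x)
    ultimately have "(\<lambda>N. l2sq (spectral_meas f0) (?D N)) \<longlonglongrightarrow> 0"
      using tendsto_sandwich[OF always_eventually always_eventually tendsto_const, OF allI allI, OF l2sq_nonneg,
          of "\<lambda>N. spectral_meas f0" ?D "\<lambda>N. (tail N * \<bar>C\<bar>)\<^sup>2 * measure (spectral_meas f0) (space (spectral_meas f0))"] by simp
    then have "(\<lambda>N. 1 / (2 * pi) * l2sq (spectral_meas f0) (?D N)) \<longlonglongrightarrow> 1 / (2 * pi) * 0" by (intro tendsto_mult tendsto_const)
    then show "(\<lambda>N. LINT \<omega>|M. (cmod ((\<Sum>k<N. x k * \<epsilon> (m - int k) \<omega>) - incr n (int \<mu>) \<xi> m \<omega>))\<^sup>2) \<longlonglongrightarrow> 0"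
      using stoch_integral_diff[OF f0 Z finite_lessThan \<epsilon> inc, of x "\<lambda>k. m - int k" _ m] by (simp add: l2sq_def)
  qed
  show ?thesis
    unfolding one_sided_moving_average_def
    using sq mean orth sums l1_imp_l2[OF l1x] by (intro exI[of _ \<epsilon>] exI[of _ x]) auto
qed

section \<open>Saddle points\<close>

lemma saddle_least_favorable:
  assumes b: "l1 (bcoeff n \<mu> a)" and D: "\<And>f. f \<in> D \<Longrightarrow> spectral_density f" "f0 \<in> D"
    and saddle: "\<And>f. f \<in> D \<Longrightarrow> mse n \<mu> a (predictor (bcoeff n \<mu> a)) f \<le> mse n \<mu> a (predictor (bcoeff n \<mu> a)) f0"
  shows "least_favorable n \<mu> a D f0"
  unfolding least_favorable_def
proof (intro conjI exI[of _ "predictor (bcoeff n \<mu> a)"] ballI allI impI D(2) predictor_optimal b)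
  fix f h assume f: "f \<in> D" and h: "optimal_char n \<mu> a f h"
  have "mse n \<mu> a h f \<le> mse n \<mu> a (predictor (bcoeff n \<mu> a)) f"
    using h predictor_spectral_char[OF b D(1)[OF f]] by (simp add: optimal_char_def)
  then show "mse n \<mu> a h f \<le> mse n \<mu> a (predictor (bcoeff n \<mu> a)) f0" using saddle[OF f] by simp
qed

lemma saddle_minimax:
  assumes b: "l1 (bcoeff n \<mu> a)" and D: "\<And>f. f \<in> D \<Longrightarrow> spectral_density f" "f0 \<in> D"
    and saddle: "\<And>f. f \<in> D \<Longrightarrow> mse n \<mu> a (predictor (bcoeff n \<mu> a)) f \<le> mse n \<mu> a (predictor (bcoeff n \<mu> a)) f0"
  shows "minimax_robust n \<mu> a D (predictor (bcoeff n \<mu> a))"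
  unfolding minimax_robust_def
proof (intro conjI ballI)
  let ?h0 = "predictor (bcoeff n \<mu> a)"
  show "?h0 \<in> H_class n \<mu> D" unfolding H_class_def using predictor_spectral_char[OF b D(1)] by blast
  show "\<exists>f1\<in>D. \<forall>f\<in>D. mse n \<mu> a ?h0 f \<le> mse n \<mu> a ?h0 f1" using saddle D(2) by blast
  fix h assume h: "h \<in> H_class n \<mu> D"
  have "(SUP f\<in>D. ereal (mse n \<mu> a ?h0 f)) \<le> ereal (mse n \<mu> a ?h0 f0)"
    using saddle by (intro SUP_least) simp
  also have "\<dots> \<le> ereal (mse n \<mu> a h f0)"
    using predictor_optimal[OF b] h D(2) by (simp add: optimal_char_def H_class_def)
  also have "\<dots> \<le> (SUP f\<in>D. ereal (mse n \<mu> a h f))" by (intro SUP_upper D)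
  finally show "(SUP f\<in>D. ereal (mse n \<mu> a ?h0 f)) \<le> (SUP f\<in>D. ereal (mse n \<mu> a h f))" .
qed

end

section \<open>Least favorable densities are saddle points\<close>

text \<open>
  A best approximation of \<open>A \<beta>\<close> from the past has the form \<open>h \<beta>\<close> almost everywhere because \<open>\<beta>\<close>
  vanishes only on a null set.
\<close>

lemma optimal_char_exists:
  assumes \<mu>: "\<mu> > 0" and f: "spectral_density f" and b: "l1 (bcoeff n \<mu> a)"
  obtains h where "optimal_char n \<mu> a f h"
proof -
  let ?A = "\<lambda>t. powser (bcoeff n \<mu> a) (cis t) * beta n (int \<mu>) t"
  have sqA: "sq_integrable (spectral_meas f) ?A" by (rule sq_integrable_powser_beta[OF f b])
  obtain g where g: "g \<in> l2_closure (spectral_meas f) (past_span n \<mu> (- 1))"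
    "\<And>Y. Y \<in> l2_closure (spectral_meas f) (past_span n \<mu> (- 1)) \<Longrightarrow> l2sq (spectral_meas f) (\<lambda>t. ?A t - g t) \<le> l2sq (spectral_meas f) (\<lambda>t. ?A t - Y t)"
  proof (rule l2_closure_minimizer[where M="spectral_meas f" and V="past_span n \<mu> (- 1)" and U="?A"])
    show "sq_integrable (spectral_meas f) Y" if "Y \<in> past_span n \<mu> (- 1)" for Y by (rule past_span_sq[OF f that])
    show "(\<lambda>t. c * Y t + d * Z t) \<in> past_span n \<mu> (- 1)"
      if "Y \<in> past_span n \<mu> (- 1)" "Z \<in> past_span n \<mu> (- 1)" for Y Z c d by (rule past_span_combine[OF that])
    show "past_span n \<mu> (- 1) \<noteq> {}" using past_span_zero by blast
  qed (use sqA in blast)+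
  have gm [measurable]: "g \<in> borel_measurable circ"
    using g(1) sq_integrable_measurable[of "spectral_meas f" g] by (simp add: l2_closure_def measurable_spec)
  have Am [measurable]: "?A \<in> borel_measurable circ"
    using sq_integrable_measurable[OF sqA] by (simp add: measurable_spec)
  define h where "h t = g t / beta n (int \<mu>) t" for t
  have hm [measurable]: "(\<lambda>t. h t * beta n (int \<mu>) t) \<in> borel_measurable circ" unfolding h_def by measurable
  have ae: "AE t in circ. g t = h t * beta n (int \<mu>) t"
    using AE_beta_nz[OF \<mu>, of n] by eventually_elim (simp add: h_def)
  have char: "spectral_char n \<mu> f h"
    unfolding spectral_char_def L2_past_closure[OF f]
    by (rule l2_closure_cong_AE[OF f past_span_sq[OF f] g(1) hm ae])
  have char_mse: "mse n \<mu> a k f = 1 / (2 * pi) * l2sq (spectral_meas f) (\<lambda>t. ?A t - k t * beta n (int \<mu>) t)"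
    if "spectral_char n \<mu> f k" for k
    using that by (intro mse_integral f b) (auto simp: spectral_char_def L2_past_closure[OF f] l2_closure_def)
  have "l2sq (spectral_meas f) (\<lambda>t. ?A t - h t * beta n (int \<mu>) t) = l2sq (spectral_meas f) (\<lambda>t. ?A t - g t)"
  proof (rule l2sq_cong_AE_spec[OF f])
    show "(\<lambda>t. ?A t - h t * beta n (int \<mu>) t) \<in> borel_measurable circ" using Am hm by (rule borel_measurable_diff)
    show "(\<lambda>t. ?A t - g t) \<in> borel_measurable circ" using Am gm by (rule borel_measurable_diff)
    show "AE t in circ. ?A t - h t * beta n (int \<mu>) t = ?A t - g t" using ae by eventually_elim simp
  qed
  then have "optimal_char n \<mu> a f h"
    unfolding optimal_char_def
  proof (intro conjI allI impI char)
    fix k assume k: "spectral_char n \<mu> f k"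
    then have "l2sq (spectral_meas f) (\<lambda>t. ?A t - g t) \<le> l2sq (spectral_meas f) (\<lambda>t. ?A t - k t * beta n (int \<mu>) t)"
      by (intro g(2)) (simp add: spectral_char_def L2_past_closure[OF f])
    then show "mse n \<mu> a h f \<le> mse n \<mu> a k f"
      unfolding char_mse[OF char] char_mse[OF k] \<open>l2sq (spectral_meas f) (\<lambda>t. ?A t - h t * beta n (int \<mu>) t) = _\<close>
      by (intro mult_left_mono) auto
  qed
  then show ?thesis by (rule that)
qed

lemma spectral_density_convex:
  assumes f: "spectral_density f" and g: "spectral_density g" and e: "0 \<le> e" "e \<le> 1"
  shows "spectral_density (\<lambda>t. (1 - e) * f t + e * g t)"
  using f g e unfolding spectral_density_def by (auto elim!: eventually_elim2)

lemma spec_convex: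
  assumes f: "spectral_density f" and g: "spectral_density g" and e: "0 < e" "e < 1"
    and X: "sq_integrable (spectral_meas (\<lambda>t. (1 - e) * f t + e * g t)) X"
  shows "sq_integrable (spectral_meas f) X" "sq_integrable (spectral_meas g) X"
    and "l2sq (spectral_meas (\<lambda>t. (1 - e) * f t + e * g t)) X = (1 - e) * l2sq (spectral_meas f) X + e * l2sq (spectral_meas g) X"
proof -
  have fg: "spectral_density (\<lambda>t. (1 - e) * f t + e * g t)" by (rule spectral_density_convex[OF f g]) (use e in auto)
  have [measurable]: "X \<in> borel_measurable circ" using sq_integrable_measurable[OF X] by (simp add: measurable_spec)
  note [measurable] = spectral_densityD(3)[OF f] spectral_densityD(3)[OF g]
  have i: "integrable circ (\<lambda>t. (cmod (X t))\<^sup>2 * ((1 - e) * f t + e * g t))"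
    using X unfolding L2_space_spec[OF fg, symmetric] L2_space_def by simp
  have i1: "integrable circ (\<lambda>t. (1 - e) * ((cmod (X t))\<^sup>2 * f t))"
  proof (rule Bochner_Integration.integrable_bound[OF i])
    show "AE t in circ. norm ((1 - e) * ((cmod (X t))\<^sup>2 * f t)) \<le> norm ((cmod (X t))\<^sup>2 * ((1 - e) * f t + e * g t))"
      using spectral_densityD(2)[OF f] spectral_densityD(2)[OF g]
    proof eventually_elim
      case (elim t)
      then have "0 \<le> (1 - e) * ((cmod (X t))\<^sup>2 * f t)" "0 \<le> e * ((cmod (X t))\<^sup>2 * g t)" using e by simp_all
      moreover have "(cmod (X t))\<^sup>2 * ((1 - e) * f t + e * g t) =
          (1 - e) * ((cmod (X t))\<^sup>2 * f t) + e * ((cmod (X t))\<^sup>2 * g t)" by (simp add: algebra_simps)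
      ultimately show ?case by simp
    qed
  qed measurable
  have i2: "integrable circ (\<lambda>t. e * ((cmod (X t))\<^sup>2 * g t))"
  proof (rule Bochner_Integration.integrable_bound[OF i])
    show "AE t in circ. norm (e * ((cmod (X t))\<^sup>2 * g t)) \<le> norm ((cmod (X t))\<^sup>2 * ((1 - e) * f t + e * g t))"
      using spectral_densityD(2)[OF f] spectral_densityD(2)[OF g]
    proof eventually_elim
      case (elim t)
      then have "0 \<le> (1 - e) * ((cmod (X t))\<^sup>2 * f t)" "0 \<le> e * ((cmod (X t))\<^sup>2 * g t)" using e by simp_all
      moreover have "(cmod (X t))\<^sup>2 * ((1 - e) * f t + e * g t) =
          (1 - e) * ((cmod (X t))\<^sup>2 * f t) + e * ((cmod (X t))\<^sup>2 * g t)" by (simp add: algebra_simps)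
      ultimately show ?case by simp
    qed
  qed measurable
  show "sq_integrable (spectral_meas f) X" unfolding L2_space_spec[OF f, symmetric] L2_space_def
    using i1 e by simp
  show "sq_integrable (spectral_meas g) X" unfolding L2_space_spec[OF g, symmetric] L2_space_def
    using i2 e by simp
  have "l2sq (spectral_meas (\<lambda>t. (1 - e) * f t + e * g t)) X = (LINT t|circ. (1 - e) * ((cmod (X t))\<^sup>2 * f t) + e * ((cmod (X t))\<^sup>2 * g t))"
    by (subst l2sq_spec[OF fg]) (auto intro!: Bochner_Integration.integral_cong simp: algebra_simps)
  also have "\<dots> = (1 - e) * l2sq (spectral_meas f) X + e * l2sq (spectral_meas g) X"
    using i1 i2 by (simp add: l2sq_spec[OF f] l2sq_spec[OF g])
  finally show "l2sq (spectral_meas (\<lambda>t. (1 - e) * f t + e * g t)) X = (1 - e) * l2sq (spectral_meas f) X + e * l2sq (spectral_meas g) X" .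
qed

lemma l2_closure_convex:
  assumes f: "spectral_density f" and g: "spectral_density g" and e: "0 < e" "e < 1"
    and X: "X \<in> l2_closure (spectral_meas (\<lambda>t. (1 - e) * f t + e * g t)) V"
    and V: "\<And>Y f. spectral_density f \<Longrightarrow> Y \<in> V \<Longrightarrow> sq_integrable (spectral_meas f) Y"
  shows "X \<in> l2_closure (spectral_meas f) V"
proof -
  let ?m = "\<lambda>t. (1 - e) * f t + e * g t"
  have fg: "spectral_density ?m" by (rule spectral_density_convex[OF f g]) (use e in auto)
  have sq: "sq_integrable (spectral_meas ?m) X" using X by (simp add: l2_closure_def)
  have "\<exists>Y\<in>V. l2sq (spectral_meas f) (\<lambda>t. X t - Y t) < d" if "d > 0" for d
  proof -
    have "(1 - e) * d > 0" using e that by simp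
    then obtain Y where Y: "Y \<in> V" "l2sq (spectral_meas ?m) (\<lambda>t. X t - Y t) < (1 - e) * d"
      using X unfolding l2_closure_def by blast
    have "(1 - e) * l2sq (spectral_meas f) (\<lambda>t. X t - Y t) \<le> l2sq (spectral_meas ?m) (\<lambda>t. X t - Y t)"
      using spec_convex(3)[OF f g e sq_integrable_diff[OF sq V[OF fg Y(1)]]] e by simp
    then have "l2sq (spectral_meas f) (\<lambda>t. X t - Y t) < d" using Y(2) e by (smt (verit) mult_less_cancel_left_pos)
    then show ?thesis using Y(1) by blast
  qed
  then show ?thesis using spec_convex(1)[OF f g e sq] by (simp add: l2_closure_def)
qed

text \<open>
  Errors are taken without the factor \<open>1/(2\<pi>)\<close>. With \<open>e\<close> the mixing weight, \<open>h\<close> optimal for the mixture \<open>m = (1 - e) f0 + e f\<close>, \<open>Q\<close> the optimal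
  value under \<open>f0\<close> and \<open>d = (h0 - h) \<beta>\<close>, the error of \<open>h\<close> under \<open>f0\<close> is \<open>Q + \<parallel>d\<parallel>\<^sup>2\<close> by Pythagoras, and
  least favorability of \<open>f0\<close> says \<open>(1 - e) (Q + \<parallel>d\<parallel>\<^sup>2) + e E \<le> Q\<close>, where \<open>E\<close> is the error of \<open>h\<close>
  under \<open>f\<close>. Dropping \<open>\<parallel>d\<parallel>\<^sup>2\<close> gives \<open>E \<le> Q\<close>; dropping \<open>E\<close> gives \<open>\<parallel>d\<parallel>\<^sup>2 \<le> Q/(1 - e) - Q\<close>. As
  \<open>e \<rightarrow> 0\<close> a subsequence of \<open>d\<close> tends to \<open>0\<close> almost everywhere, here positivity of \<open>f0\<close> is used, and
  Fatou's lemma carries the bound over to \<open>h0\<close>.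
\<close>

lemma (in outer_factor) least_favorable_saddle:
  assumes \<mu>: "\<mu> > 0" and b: "l1 (bcoeff n \<mu> a)" and pos: "AE t in circ. f0 t > 0"
    and D: "\<And>f. f \<in> D \<Longrightarrow> spectral_density f"
    and convex: "\<And>f e. f \<in> D \<Longrightarrow> 0 < e \<Longrightarrow> e < 1 \<Longrightarrow> (\<lambda>t. (1 - e) * f0 t + e * f t) \<in> D"
    and lf: "least_favorable n \<mu> a D f0" and f: "f \<in> D"
  shows "mse n \<mu> a (predictor (bcoeff n \<mu> a)) f \<le> mse n \<mu> a (predictor (bcoeff n \<mu> a)) f0"
proof -
  let ?b = "bcoeff n \<mu> a"
  let ?h0 = "predictor ?b"
  let ?B = "beta n (int \<mu>)"
  let ?R = "\<lambda>h t. powser ?b (cis t) * ?B t - h t * ?B t"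
  have sf: "spectral_density f" by (rule D[OF f])
  define Q where "Q = l2sq (spectral_meas f0) (remainder ?b)"
  \<comment> \<open>The shift by \<open>2\<close> keeps the weights strictly between \<open>0\<close> and \<open>1\<close>.\<close>
  define e where "e k = 1 / (real k + 2)" for k
  have e: "0 < e k" "e k < 1" for k by (auto simp: e_def)
  define m where "m k t = (1 - e k) * f0 t + e k * f t" for k t
  have mD: "m k \<in> D" for k unfolding m_def[abs_def] by (intro convex f e)
  have sm: "spectral_density (m k)" for k by (rule D[OF mD])
  have "\<exists>h. optimal_char n \<mu> a (m k) h" for k using optimal_char_exists[OF \<mu> sm b] by metis
  then obtain h where h: "\<And>k. optimal_char n \<mu> a (m k) (h k)" by metis
  have char: "spectral_char n \<mu> (m k) (h k)" for k using h[of k] by (simp add: optimal_char_def)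
  have char0: "spectral_char n \<mu> f0 (h k)" for k
  proof -
    have "(\<lambda>t. h k t * ?B t) \<in> l2_closure (spectral_meas (m k)) (past_span n \<mu> (- 1))"
      using char[of k] by (simp add: spectral_char_def L2_past_closure[OF sm])
    then have "(\<lambda>t. h k t * ?B t) \<in> l2_closure (spectral_meas (\<lambda>t. (1 - e k) * f0 t + e k * f t)) (past_span n \<mu> (- 1))"
      by (simp only: m_def[abs_def])
    then have "(\<lambda>t. h k t * ?B t) \<in> l2_closure (spectral_meas f0) (past_span n \<mu> (- 1))"
      by (rule l2_closure_convex[OF f0 sf e _ past_span_sq])
    then show ?thesis by (simp add: spectral_char_def L2_past_closure[OF f0])
  qed
  have sqR: "sq_integrable (spectral_meas (m k)) (?R (h k))" for k
    using char[of k] unfolding spectral_char_def L2_past_closure[OF sm] l2_closure_def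
    by (intro sq_integrable_diff sq_integrable_powser_beta sm b) auto
  have R: "sq_integrable (spectral_meas f0) (?R (h k))" "sq_integrable (spectral_meas f) (?R (h k))"
    "l2sq (spectral_meas (m k)) (?R (h k)) = (1 - e k) * l2sq (spectral_meas f0) (?R (h k)) + e k * l2sq (spectral_meas f) (?R (h k))" for k
    using spec_convex[OF f0 sf e, of k "?R (h k)"] sqR[of k] unfolding m_def[abs_def] by auto
  obtain h1 where h1: "optimal_char n \<mu> a f0 h1" "\<And>f h. f \<in> D \<Longrightarrow> optimal_char n \<mu> a f h \<Longrightarrow> mse n \<mu> a h f \<le> mse n \<mu> a h1 f0"
    using lf unfolding least_favorable_def by blast
  have le: "l2sq (spectral_meas (m k)) (?R (h k)) \<le> Q" for k
  proof -
    have "mse n \<mu> a (h k) (m k) \<le> mse n \<mu> a h1 f0" by (rule h1(2)[OF mD h])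
    also have "\<dots> \<le> mse n \<mu> a ?h0 f0"
      using h1(1) predictor_spectral_char[OF b f0] by (simp add: optimal_char_def)
    finally have "1 / (2 * pi) * l2sq (spectral_meas (m k)) (?R (h k)) \<le> 1 / (2 * pi) * Q"
      using mse_char[OF sm b char[of k]] mse_predictor[OF f0 b] by (simp only: Q_def)
    then show ?thesis by (simp add: divide_le_cancel)
  qed
  define d where "d k t = ?h0 t * ?B t - h k t * ?B t" for k t
  have pyth: "l2sq (spectral_meas f0) (?R (h k)) = Q + l2sq (spectral_meas f0) (d k)" for k
    unfolding Q_def d_def by (rule prediction_pythagoras[OF b char0])
  have bound_f: "l2sq (spectral_meas f) (?R (h k)) \<le> Q" for k
  proof -
    have "(1 - e k) * Q + e k * l2sq (spectral_meas f) (?R (h k)) \<le> (1 - e k) * l2sq (spectral_meas f0) (?R (h k)) + e k * l2sq (spectral_meas f) (?R (h k))"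
      using e[of k] by (intro add_right_mono mult_left_mono) (auto simp: pyth)
    also have "\<dots> \<le> Q" using le[of k] by (simp add: R(3))
    finally have "e k * l2sq (spectral_meas f) (?R (h k)) \<le> e k * Q" by (simp add: algebra_simps)
    then show ?thesis using e[of k] by simp
  qed
  have bound_d: "l2sq (spectral_meas f0) (d k) \<le> Q / (1 - e k) - Q" for k
  proof -
    have "(1 - e k) * (Q + l2sq (spectral_meas f0) (d k)) \<le> Q"
    proof -
      have "0 \<le> e k * l2sq (spectral_meas f) (?R (h k))" using e[of k] by simp
      then show ?thesis using le[of k] unfolding R(3) pyth by linarith
    qed
    then show ?thesis using e[of k] by (simp add: field_simps)
  qed
  have "(\<lambda>k. Q / (1 - e k) - Q) \<longlonglongrightarrow> Q / (1 - 0) - Q"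
  proof (intro tendsto_intros)
    show "e \<longlonglongrightarrow> 0" unfolding e_def by real_asymp
  qed auto
  then have d_lim: "(\<lambda>k. l2sq (spectral_meas f0) (d k)) \<longlonglongrightarrow> 0"
    using tendsto_sandwich[OF always_eventually always_eventually tendsto_const, OF allI allI, OF l2sq_nonneg bound_d] by simp
  have sqd: "sq_integrable (spectral_meas f0) (d k)" for k
    using predictor_spectral_char[OF b f0] char0[of k] unfolding d_def spectral_char_def L2_past_closure[OF f0] l2_closure_def
    by (intro sq_integrable_diff) auto
  obtain r where r: "strict_mono r" "AE t in spectral_meas f0. (\<lambda>k. d (r k) t) \<longlonglongrightarrow> 0"
    using l2sq_AE_subseq[OF sqd d_lim] by blast
  have "AE t in circ. 0 < ennreal (f0 t) \<longrightarrow> (\<lambda>k. d (r k) t) \<longlonglongrightarrow> 0"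
    using r(2) spectral_densityD(3)[OF f0] unfolding spectral_meas_def by (subst (asm) AE_density) auto
  then have ae: "AE t in circ. (\<lambda>k. d (r k) t) \<longlonglongrightarrow> 0" using pos by eventually_elim auto
  have lim: "AE t in spectral_meas f. (\<lambda>k. ?R (h (r k)) t) \<longlonglongrightarrow> remainder ?b t"
  proof (rule AE_spec[OF sf])
    show "AE t in circ. (\<lambda>k. ?R (h (r k)) t) \<longlonglongrightarrow> remainder ?b t"
      using ae
    proof eventually_elim
      case (elim t)
      have "(\<lambda>k. remainder ?b t + d (r k) t) \<longlonglongrightarrow> remainder ?b t + 0" by (intro tendsto_intros elim)
      moreover have "remainder ?b t + d k t = ?R (h k) t" for k
        by (simp add: d_def remainder_def predictor_def algebra_simps)
      ultimately show ?case by simp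
    qed
  qed
  have "l2sq (spectral_meas f) (remainder ?b) \<le> Q"
  proof (rule l2sq_fatou(2)[OF R(2) _ lim])
    show "remainder ?b \<in> borel_measurable (spectral_meas f)" using remainder_measurable[OF b] by (simp add: measurable_spec)
    show "\<forall>\<^sub>F k in sequentially. l2sq (spectral_meas f) (?R (h (r k))) \<le> Q" using bound_f by simp
  qed
  then show ?thesis
    unfolding mse_predictor[OF sf b] mse_predictor[OF f0 b] Q_def by (intro mult_left_mono) auto
qed

section \<open>Band classes\<close>

lemma band_classD:
  assumes "f \<in> band_class v u P0"
  shows "spectral_density f" "AE t in circ. v t \<le> f t \<and> f t \<le> u t" "(LINT t|circ. f t) \<le> 2 * pi * P0"
  using assms pi_gt_zero by (auto simp: band_class_def field_simps)

lemma band_class_convex: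
  assumes f: "f \<in> band_class v u P0" and g: "g \<in> band_class v u P0" and e: "0 < e" "e < 1"
  shows "(\<lambda>t. (1 - e) * f t + e * g t) \<in> band_class v u P0"
  unfolding band_class_def
proof (intro CollectI conjI)
  show "spectral_density (\<lambda>t. (1 - e) * f t + e * g t)"
    using band_classD(1)[OF f] band_classD(1)[OF g] e by (intro spectral_density_convex) auto
  show "AE t in circ. v t \<le> (1 - e) * f t + e * g t \<and> (1 - e) * f t + e * g t \<le> u t"
    using band_classD(2)[OF f] band_classD(2)[OF g]
  proof eventually_elim
    case (elim t)
    have "(1 - e) * v t + e * v t \<le> (1 - e) * f t + e * g t" "(1 - e) * f t + e * g t \<le> (1 - e) * u t + e * u t"
      using elim e by (intro add_mono mult_left_mono; simp)+
    then show ?case by (simp add: algebra_simps)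
  qed
  have "(LINT t|circ. (1 - e) * f t + e * g t) = (1 - e) * (LINT t|circ. f t) + e * (LINT t|circ. g t)"
    using band_classD(1)[OF f] band_classD(1)[OF g] by (simp add: spectral_density_def)
  also have "\<dots> \<le> (1 - e) * (2 * pi * P0) + e * (2 * pi * P0)"
    using e band_classD(3)[OF f] band_classD(3)[OF g] by (intro add_mono mult_left_mono) auto
  also have "\<dots> = 2 * pi * P0" by (simp add: algebra_simps)
  finally show "1 / (2 * pi) * (LINT t|circ. (1 - e) * f t + e * g t) \<le> P0"
    by (simp add: field_simps)
qed

lemma spectral_density_of: "l1 \<phi> \<Longrightarrow> spectral_density (density_of \<phi>)"
  unfolding spectral_density_def density_of_def
  by (intro conjI circ_integrable_continuous continuous_intros powser_cis_continuous) auto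

lemma canonical_l1: "canonical_factorization \<phi> f \<Longrightarrow> l1 \<phi>"
  by (auto simp: canonical_factorization_def intro: conv_radius_l1)

lemma canonical_density_pos: "canonical_factorization \<phi> f \<Longrightarrow> density_of \<phi> t > 0"
  by (auto simp: canonical_factorization_def density_of_def)

lemma char_formula_predictor:
  assumes "admissible_coeffs n \<mu> a" "outer_factor n \<mu> f0 (phi_mu n \<mu> \<phi>)"
  shows "char_formula n \<mu> a \<phi> = outer_factor.predictor (phi_mu n \<mu> \<phi>) (bcoeff n \<mu> a)"
  by (simp add: fun_eq_iff char_formula_def outer_factor.predictor_def[OF assms(2)] DA_hankel[OF assms(1)])

text \<open>
  For a solution of the eigenvalue equation \<open>|r|\<^sup>2/f0\<close> is the constant \<open>|\<alpha>|\<^sup>2\<close>, so the error of the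
  predictor under \<open>f\<close> is \<open>|\<alpha>|\<^sup>2\<close> times the power of \<open>f\<close>, and \<open>f0\<close> exhausts the admitted power.
\<close>

lemma eigen_saddle:
  assumes \<mu>: "\<mu> > 0" and adm: "admissible_coeffs n \<mu> a" and \<phi>: "\<phi> \<in> nu_set n \<mu> a v u P0"
  shows "least_favorable n \<mu> a (band_class v u P0) (density_of \<phi>)"
proof -
  let ?f0 = "density_of \<phi>"
  let ?b = "bcoeff n \<mu> a"
  have can: "canonical_factorization \<phi> ?f0" and norm: "(l2norm \<phi>)\<^sup>2 = P0" and E: "eq_E n \<mu> a \<phi>"
    and band: "AE t in circ. v t \<le> ?f0 t \<and> ?f0 t \<le> u t"
    using \<phi> by (auto simp: nu_set_def)
  have l1\<phi>: "l1 \<phi>" by (rule canonical_l1[OF can])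
  have f0: "spectral_density ?f0" by (rule spectral_density_of[OF l1\<phi>])
  have int: "(LINT t|circ. ?f0 t) = 2 * pi * P0"
    using parseval_l1[OF l1\<phi>] norm by (simp add: density_of_def)
  have mem: "?f0 \<in> band_class v u P0" unfolding band_class_def using f0 band int by simp
  interpret outer_factor n \<mu> ?f0 "phi_mu n \<mu> \<phi>" by (rule canonical_outer_factor[OF \<mu> f0 can])
  have b: "l1 ?b" by (rule admissible_l1[OF adm])
  have pos: "AE t in circ. ?f0 t > 0" using canonical_density_pos[OF can] by simp
  obtain \<alpha> where \<alpha>: "\<And>k. DAW n \<mu> a \<phi> k = \<alpha> * cnj (\<phi> k)" using E by (auto simp: eq_E_def)
  have han: "hankel ?b (phi_mu n \<mu> \<phi>) = (\<lambda>k. \<alpha> * cnj (\<phi> k))"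
    using \<alpha> by (simp add: fun_eq_iff DAW_def DA_hankel[OF adm])
  have "powser (hankel ?b (phi_mu n \<mu> \<phi>)) (cis t) = \<alpha> * cnj (powser \<phi> (cis (- t)))" for t
  proof -
    have "(\<lambda>k. \<alpha> * (cnj (\<phi> k) * cis t ^ k)) sums (\<alpha> * powser (\<lambda>k. cnj (\<phi> k)) (cis t))"
      by (intro sums_mult l1_sums l1_cnj l1\<phi>) simp
    then show ?thesis
      using powser_cnj[OF l1\<phi>, of "cis (- t)"] unfolding han by (simp add: powser_def sums_iff mult.assoc cis_cnj)
  qed
  then have ratio: "(cmod (powser (hankel ?b (phi_mu n \<mu> \<phi>)) (cis t)))\<^sup>2 / ?f0 t * f t = (cmod \<alpha>)\<^sup>2 * f t" for f t
    using canonical_density_pos[OF can, of t] by (simp add: norm_mult power_mult_distrib density_of_def)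
  have mse: "mse n \<mu> a (predictor ?b) f = 1 / (2 * pi) * ((cmod \<alpha>)\<^sup>2 * (LINT t|circ. f t))" if "spectral_density f" for f
    unfolding mse_predictor_density(1)[OF that b pos] ratio by simp
  show "least_favorable n \<mu> a (band_class v u P0) ?f0"
  proof (rule saddle_least_favorable[OF b band_classD(1) mem])
    fix f assume f: "f \<in> band_class v u P0"
    show "mse n \<mu> a (predictor ?b) f \<le> mse n \<mu> a (predictor ?b) ?f0"
      unfolding mse[OF band_classD(1)[OF f]] mse[OF f0]
      using band_classD(3)[OF f] int by (intro mult_left_mono) auto
  qed
qed

text \<open>
  Read \<open>w\<close> as \<open>f0\<close>, \<open>P\<close> as \<open>|r|\<^sup>2\<close> and \<open>K\<close> as \<open>|c|\<^sup>2\<close>. If \<open>w\<close> is clipped from below, then \<open>P/w \<le> 1/K\<close> and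
  \<open>g \<ge> w\<close>; if it is clipped from above, both inequalities are reversed; otherwise \<open>P/w = 1/K\<close>.
\<close>

lemma clip_compare:
  fixes K P v u g :: real
  defines "w \<equiv> max v (min u (K * P))"
  assumes "K > 0" "w > 0" "v \<le> g" "g \<le> u"
  shows "P / w * g \<le> P / w * w + 1 / K * (g - w)"
proof -
  have "(P / w - 1 / K) * (g - w) \<le> 0"
  proof -
    consider "K * P \<le> v" | "v < K * P" "u \<le> K * P" | "v < K * P" "K * P < u" by linarith
    then show ?thesis
    proof cases
      case 1
      then have "w = v" using assms by (simp add: w_def)
      moreover have "P / w \<le> 1 / K" using 1 \<open>w = v\<close> assms by (simp add: field_simps)
      ultimately show ?thesis using assms by (intro mult_nonpos_nonneg) auto
    next
      case 2
      then have "w = u" using assms by (simp add: w_def)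
      moreover have "P / w \<ge> 1 / K" using 2 \<open>w = u\<close> assms by (simp add: field_simps)
      ultimately show ?thesis using assms by (intro mult_nonneg_nonpos) auto
    next
      case 3
      then have "w = K * P" by (simp add: w_def)
      moreover have "P > 0" using \<open>w = K * P\<close> assms(2,3) by (simp add: zero_less_mult_iff)
      ultimately show ?thesis using assms(2) by simp
    qed
  qed
  moreover have "(P / w - 1 / K) * (g - w) = P / w * g - (P / w * w + 1 / K * (g - w))"
    by (simp only: left_diff_distrib right_diff_distrib)
  ultimately show ?thesis by linarith
qed

text \<open>
  For \<open>c \<noteq> 0\<close> the pointwise comparison is integrated, and \<open>\<integral> f \<le> 2\<pi>P0 = \<integral> f0\<close>. For \<open>c = 0\<close> the
  density is the lower bound \<open>v\<close> itself, and a member of the class of no more power that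
  dominates it coincides with it almost everywhere.
\<close>

lemma clipped_saddle:
  assumes \<mu>: "\<mu> > 0" and adm: "admissible_coeffs n \<mu> a" and v: "spectral_density v" and u: "spectral_density u"
    and can: "canonical_factorization \<phi> (density_F n \<mu> a v u \<phi> c)"
    and mem: "density_of \<phi> \<in> band_class v u P0" and int: "(LINT t|circ. density_of \<phi> t) = 2 * pi * P0"
  shows "least_favorable n \<mu> a (band_class v u P0) (density_F n \<mu> a v u \<phi> c)"
proof -
  let ?F = "density_F n \<mu> a v u \<phi> c"
  let ?b = "bcoeff n \<mu> a"
  let ?x = "phi_mu n \<mu> \<phi>"
  let ?P = "\<lambda>t. (cmod (powser (hankel ?b ?x) (cis t)))\<^sup>2"
  have b: "l1 ?b" by (rule admissible_l1[OF adm])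
  have l1x: "l1 ?x" unfolding phi_mu_conv by (intro l1_conv canonical_l1[OF can] wcoeff_outer[OF \<mu>])
  have F: "?F t = max (v t) (min (u t) ((cmod c)\<^sup>2 * ?P t))" for t
    by (simp add: density_F_def DA_hankel[OF adm] norm_mult power_mult_distrib)
  have ae: "AE t in circ. ?F t = density_of \<phi> t" using can by (simp add: canonical_factorization_def)
  have "(\<lambda>t. powser (hankel ?b ?x) (cis t)) \<in> borel_measurable circ"
    by (intro continuous_borel_circ powser_cis_continuous hankel_split b l1x continuous_intros)
  then have Pm [measurable]: "?P \<in> borel_measurable circ" by measurable
  note [measurable] = spectral_densityD(3)[OF v] spectral_densityD(3)[OF u]
  have Fm [measurable]: "?F \<in> borel_measurable circ" unfolding F by measurable
  note dens = band_classD[OF mem]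
  have iF: "integrable circ ?F"
    by (rule integrable_cong_AE_imp[OF spectral_densityD(1)[OF dens(1)] Fm]) (use ae in \<open>auto elim!: eventually_mono\<close>)
  have F0: "spectral_density ?F"
    unfolding spectral_density_def using iF ae canonical_density_pos[OF can] by (auto elim!: eventually_mono intro: less_imp_le)
  have intF: "(LINT t|circ. ?F t) = 2 * pi * P0"
    unfolding int[symmetric] using ae spectral_densityD(3)[OF dens(1)] by (intro integral_cong_AE Fm)
  have "AE t in circ. v t \<le> ?F t \<and> ?F t \<le> u t" using dens(2) ae by eventually_elim simp
  then have memF: "?F \<in> band_class v u P0" unfolding band_class_def using F0 intF by simp
  interpret outer_factor n \<mu> ?F ?x by (rule canonical_outer_factor[OF \<mu> F0 can])
  have pos: "AE t in circ. ?F t > 0" using ae by eventually_elim (simp add: canonical_density_pos[OF can])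
  show ?thesis
  proof (rule saddle_least_favorable[OF b band_classD(1) memF])
    fix f assume f: "f \<in> band_class v u P0"
    note fD = band_classD[OF f]
    note mf = mse_predictor_density[OF fD(1) b pos]
    note mF = mse_predictor_density[OF F0 b pos]
    have "(LINT t|circ. ?P t / ?F t * f t) \<le> (LINT t|circ. ?P t / ?F t * ?F t)"
    proof (cases "c = 0")
      case False
      define K where "K = (cmod c)\<^sup>2"
      have K: "K > 0" using False by (simp add: K_def)
      have i: "integrable circ (\<lambda>t. 1 / K * (f t - ?F t))"
        using spectral_densityD(1)[OF fD(1)] iF by simp
      have "(LINT t|circ. ?P t / ?F t * f t) \<le> (LINT t|circ. ?P t / ?F t * ?F t + 1 / K * (f t - ?F t))"
      proof (intro integral_mono_AE mf(2) Bochner_Integration.integrable_add mF(2) i)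
        show "AE t in circ. ?P t / ?F t * f t \<le> ?P t / ?F t * ?F t + 1 / K * (f t - ?F t)"
          using fD(2) pos
        proof eventually_elim
          case (elim t)
          then show ?case using clip_compare[OF K, of "v t" "u t" "?P t" "f t"] F[of t] by (simp add: K_def)
        qed
      qed
      also have "\<dots> = (LINT t|circ. ?P t / ?F t * ?F t) + 1 / K * ((LINT t|circ. f t) - (LINT t|circ. ?F t))"
        using mF(2) i spectral_densityD(1)[OF fD(1)] iF by simp
      also have "\<dots> \<le> (LINT t|circ. ?P t / ?F t * ?F t)"
        using K fD(3) intF by (simp add: mult_le_0_iff divide_nonpos_pos)
      finally show ?thesis .
    next
      case True
      have le: "AE t in circ. ?F t \<le> f t"
        using fD(2) spectral_densityD(2)[OF v] unfolding F by eventually_elim (auto simp: True)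
      have i: "integrable circ (\<lambda>t. f t - ?F t)" using spectral_densityD(1)[OF fD(1)] iF by simp
      have nn: "AE t in circ. 0 \<le> f t - ?F t" using le by eventually_elim simp
      have "(LINT t|circ. f t - ?F t) \<le> 0"
        using spectral_densityD(1)[OF fD(1)] iF fD(3) intF by simp
      moreover have "(LINT t|circ. f t - ?F t) \<ge> 0" by (rule integral_nonneg_AE[OF nn])
      ultimately have "AE t in circ. f t - ?F t = 0"
        using integral_nonneg_eq_0_iff_AE[OF i nn] by linarith
      then have "AE t in circ. ?P t / ?F t * f t = ?P t / ?F t * ?F t" by eventually_elim simp
      then have "(LINT t|circ. ?P t / ?F t * f t) = (LINT t|circ. ?P t / ?F t * ?F t)"
        by (intro integral_cong_AE borel_measurable_integrable mf(2) mF(2))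
      then show ?thesis by simp
    qed
    then show "mse n \<mu> a (predictor ?b) f \<le> mse n \<mu> a (predictor ?b) ?F"
      unfolding mf(1) mF(1) by (intro mult_left_mono) auto
  qed
qed

theorem theorem7p1:
  fixes n \<mu> :: nat and a :: "nat \<Rightarrow> complex" and v u :: "real \<Rightarrow> real" and P0 :: real
  assumes "n \<ge> 1" and "\<mu> > 0"
    and "admissible_coeffs n \<mu> a"
    and "spectral_density v" and "spectral_density u" and "P0 > 0"
  shows
    "(\<forall>\<nu> \<nu>p :: ereal.
        max_value (\<lambda>\<phi>. (l2norm (DAW n \<mu> a \<phi>))\<^sup>2) (nu_set n \<mu> a v u P0) (\<nu> * ereal P0) \<and>
        max_value (\<lambda>\<phi>. (l2norm (DAW n \<mu> a \<phi>))\<^sup>2) (nu_plus_set n \<mu> a v u P0) (\<nu>p * ereal P0)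
        \<longrightarrow>
        (\<forall>\<phi>0\<in>nu_set n \<mu> a v u P0.
           \<nu> * ereal P0 = \<nu>p * ereal P0 \<and>
           \<nu>p * ereal P0 = ereal ((l2norm (DAW n \<mu> a \<phi>0))\<^sup>2) \<longrightarrow>
           least_favorable n \<mu> a (band_class v u P0) (density_of \<phi>0) \<and>
           (\<forall>(M :: 'w measure) \<xi>. has_spectral_density n M \<xi> (density_of \<phi>0) \<longrightarrow>
              one_sided_moving_average M (incr n (int \<mu>) \<xi>))) \<and>
        (\<nu> < \<nu>p \<longrightarrow>
           (\<forall>\<phi> c. canonical_factorization \<phi> (density_F n \<mu> a v u \<phi> c) \<and>
              solves_extremum n \<mu> a (band_class v u P0) \<phi> \<and>
              (LINT t|circ. density_of \<phi> t) = 2 * pi * P0 \<longrightarrow>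
              least_favorable n \<mu> a (band_class v u P0) (density_F n \<mu> a v u \<phi> c)))) \<and>
     (\<forall>f0 \<phi>. least_favorable n \<mu> a (band_class v u P0) f0 \<and> canonical_factorization \<phi> f0 \<longrightarrow>
        optimal_char n \<mu> a f0 (char_formula n \<mu> a \<phi>) \<and>
        minimax_robust n \<mu> a (band_class v u P0) (char_formula n \<mu> a \<phi>))"
proof -
  have ma: "one_sided_moving_average M (incr n (int \<mu>) \<xi>)"
    if \<phi>0: "\<phi>0 \<in> nu_set n \<mu> a v u P0" and M: "has_spectral_density n M \<xi> (density_of \<phi>0)"
    for \<phi>0 and M :: "'w measure" and \<xi>
  proof -
    have can: "canonical_factorization \<phi>0 (density_of \<phi>0)" using \<phi>0 by (simp add: nu_set_def)
    obtain Z where Z: "spectral_representation n M \<xi> Z (density_of \<phi>0)" using M by (auto simp: has_spectral_density_def)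
    have "outer_factor n \<mu> (density_of \<phi>0) (phi_mu n \<mu> \<phi>0)"
      by (rule canonical_outer_factor[OF assms(2) spectral_density_of[OF canonical_l1[OF can]] can])
    then show ?thesis using Z by (rule outer_factor.moving_average)
  qed
  have minimax: "optimal_char n \<mu> a f0 (char_formula n \<mu> a \<phi>) \<and>
        minimax_robust n \<mu> a (band_class v u P0) (char_formula n \<mu> a \<phi>)"
    if lf: "least_favorable n \<mu> a (band_class v u P0) f0" and can: "canonical_factorization \<phi> f0" for f0 \<phi>
  proof -
    have mem: "f0 \<in> band_class v u P0" using lf by (simp add: least_favorable_def)
    have f0: "spectral_density f0" by (rule band_classD(1)[OF mem])
    have b: "l1 (bcoeff n \<mu> a)" by (rule admissible_l1[OF assms(3)])
    have out: "outer_factor n \<mu> f0 (phi_mu n \<mu> \<phi>)" by (rule canonical_outer_factor[OF assms(2) f0 can])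
    have pos: "AE t in circ. f0 t > 0"
      using can canonical_density_pos[OF can] by (auto simp: canonical_factorization_def)
    have saddle: "mse n \<mu> a (outer_factor.predictor (phi_mu n \<mu> \<phi>) (bcoeff n \<mu> a)) f
        \<le> mse n \<mu> a (outer_factor.predictor (phi_mu n \<mu> \<phi>) (bcoeff n \<mu> a)) f0" if "f \<in> band_class v u P0" for f
      by (rule outer_factor.least_favorable_saddle[OF out assms(2) b pos band_classD(1) band_class_convex[OF mem] lf that])
    show ?thesis
      unfolding char_formula_predictor[OF assms(3) out]
    proof
      show "minimax_robust n \<mu> a (band_class v u P0) (outer_factor.predictor (phi_mu n \<mu> \<phi>) (bcoeff n \<mu> a))"
        by (rule outer_factor.saddle_minimax[OF out b _ mem saddle]) (rule band_classD(1))
    qed (rule outer_factor.predictor_optimal[OF out b])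
  qed
  show ?thesis
    using eigen_saddle[OF assms(2,3)] ma minimax clipped_saddle[OF assms(2-5)]
    unfolding solves_extremum_def by blast
qed

end
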